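(* There exists a constant $C>0$ depending only on $N$ and $q$ such that for every nonempty compact set $F\subset\mathbb R^N$, $$U_F(x)\le C\,W_F(x)\qquad\text{for all }x\in\mathbb R^N\setminus F .$$
   Context: Throughout, $N\ge 3$, $q\ge q_c:=N/(N-2)$ and $q'=q/(q-1)$. $C_{2,q'}$ denotes the Bessel capacity of order $(2,q')$ in $\mathbb R^N$; for a compact set $K$, $C_{2,q'}(K)=\inf\{\|\eta\|^{q'}_{W^{2,q'}(\mathbb R^N)}:\eta\in C^2_c(\mathbb R^N),\ 0\le\eta\le 1,\ \eta=1 \text{ on an open neighborhood of } K\}$, extended to arbitrary sets in the standard way. A solution of $-\Delta u+|u|^{q-1}u=0$ in an open set $G$ is a function $u\in L^q_{loc}(G)$ satisfying the equation in the sense of distributions. For a compact set $F$, $U_F$ denotes the maximal solution of this equation in $\mathbb R^N\setminus F$ (the pointwise largest solution; it exists and is nonnegative). For a set $F\subset\mathbb R^N$, $x\in\mathbb R^N$ and $m\in\mathbb Z$, let $F_m(x)=F\cap\{y:2^{-(m+1)}\le|y-x|\le 2^{-m}\}$, and define the capacitary potential $W_F(x)=\sum_{m=-\infty}^{\infty}2^{2m/(q-1)}C_{2,q'}\big(2^mF_m(x)\big)$, where $aA=\{ay:y\in A\}$. *)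

theory Defs
  imports "HOL-Analysis.Analysis"
begin

definition pd :: "'a::euclidean_space \<Rightarrow> ('a \<Rightarrow> real) \<Rightarrow> 'a \<Rightarrow> real" where
  "pd b f x = frechet_derivative f (at x) b"

fun Ck :: "nat \<Rightarrow> ('a::euclidean_space \<Rightarrow> real) \<Rightarrow> bool" where
  "Ck 0 f = continuous_on UNIV f"
| "Ck (Suc n) f = ((\<forall>x. f differentiable (at x)) \<and> (\<forall>b\<in>Basis. Ck n (pd b f)))"

definition smooth :: "('a::euclidean_space \<Rightarrow> real) \<Rightarrow> bool" where
  "smooth f = (\<forall>n. Ck n f)"

definition tsupp :: "('a::euclidean_space \<Rightarrow> real) \<Rightarrow> 'a set" where
  "tsupp f = closure {x. f x \<noteq> 0}"

definition sob2_pow :: "real \<Rightarrow> ('a::euclidean_space \<Rightarrow> real) \<Rightarrow> ennreal" where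
  "sob2_pow p \<eta> =
     (\<integral>\<^sup>+ x. ennreal (\<bar>\<eta> x\<bar> powr p) \<partial>lborel)
   + (\<Sum>i\<in>Basis. \<integral>\<^sup>+ x. ennreal (\<bar>pd i \<eta> x\<bar> powr p) \<partial>lborel)
   + (\<Sum>i\<in>Basis. \<Sum>j\<in>Basis. \<integral>\<^sup>+ x. ennreal (\<bar>pd j (pd i \<eta>) x\<bar> powr p) \<partial>lborel)"

definition cap2 :: "real \<Rightarrow> 'a::euclidean_space set \<Rightarrow> ennreal" where
  "cap2 p K = (INF \<eta> \<in> {\<eta>. Ck 2 \<eta> \<and> compact (tsupp \<eta>) \<and> (\<forall>x. 0 \<le> \<eta> x \<and> \<eta> x \<le> 1)
                     \<and> (\<exists>V. open V \<and> K \<subseteq> V \<and> (\<forall>x\<in>V. \<eta> x = 1))}. sob2_pow p \<eta>)"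

definition conj_exp :: "real \<Rightarrow> real" where
  "conj_exp q = q / (q - 1)"

definition annulus_piece :: "'a::euclidean_space set \<Rightarrow> 'a \<Rightarrow> int \<Rightarrow> 'a set" where
  "annulus_piece F x m = F \<inter> {y. 2 powr (- real_of_int (m + 1)) \<le> dist y x \<and> dist y x \<le> 2 powr (- real_of_int m)}"

definition Wpot :: "real \<Rightarrow> 'a::euclidean_space set \<Rightarrow> 'a \<Rightarrow> ennreal" where
  "Wpot q F x = (\<integral>\<^sup>+ m. ennreal (2 powr (2 * real_of_int m / (q - 1)))
        * cap2 (conj_exp q) ((\<lambda>y. (2 powr real_of_int m) *\<^sub>R y) ` annulus_piece F x m)
      \<partial>count_space (UNIV :: int set))"

definition laplacian :: "('a::euclidean_space \<Rightarrow> real) \<Rightarrow> 'a \<Rightarrow> real" where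
  "laplacian f x = (\<Sum>b\<in>Basis. pd b (pd b f) x)"

text \<open>u is a (distributional) solution of -Delta u + |u|^(q-1) u = 0 in the open set G,
  with u in L^q_loc(G).\<close>
definition is_solution :: "real \<Rightarrow> 'a::euclidean_space set \<Rightarrow> ('a \<Rightarrow> real) \<Rightarrow> bool" where
  "is_solution q G u =
     (set_borel_measurable lebesgue G u
      \<and> (\<forall>K. compact K \<and> K \<subseteq> G \<longrightarrow> (\<integral>\<^sup>+ x\<in>K. ennreal (\<bar>u x\<bar> powr q) \<partial>lebesgue) < \<infinity>)
      \<and> (\<forall>\<phi>. smooth \<phi> \<and> compact (tsupp \<phi>) \<and> tsupp \<phi> \<subseteq> G \<longrightarrow>
            (\<integral>x. (- u x * laplacian \<phi> x + \<bar>u x\<bar> powr (q - 1) * u x * \<phi> x) \<partial>lebesgue) = 0))"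

text \<open>U is the maximal solution in G: a solution (taken in its continuous representative)
  dominating every solution almost everywhere in G.\<close>
definition is_maximal_solution :: "real \<Rightarrow> 'a::euclidean_space set \<Rightarrow> ('a \<Rightarrow> real) \<Rightarrow> bool" where
  "is_maximal_solution q G U =
     (is_solution q G U \<and> continuous_on G U
      \<and> (\<forall>u. is_solution q G u \<longrightarrow> (AE x in lebesgue. x \<in> G \<longrightarrow> u x \<le> U x)))"

end

theory Submission
  imports Defs
begin

text \<open>
  Everything follows from a single test function. For $x \notin F$ choose, for each of the finitely
  many $m$ with $F_m(x) \neq \emptyset$, a competitor $\eta_m$ for the capacity of $2^m F_m(x)$,
  localise it to a neighbourhood of the dyadic annulus around $x$, and let $S$ be the sum of the
  rescaled pieces and of one further function cutting off outside a large ball of radius $R$.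
  Test the equation with $\Phi = \Gamma_\varepsilon\, (1 - 2S)_+^k$, where
  $\Gamma_\varepsilon(y) = (|y - x|^2 + \varepsilon^2)^{-(N-2)/2}$ is superharmonic and
  $-\Delta\Gamma_\varepsilon$ has mass bounded below on the ball of radius $\varepsilon$.
  As $k \ge 2q'$, Young's inequality absorbs every term in which the cut-off is differentiated into
  $\int u^q \Phi$, at the price of $\int \Gamma_\varepsilon (|D^2 S| + |D S|^2 + \dots)^{q'}$.
  The Gagliardo-Nirenberg inequality $\int |\partial\eta|^{2q'} \le C \int |\partial^2\eta|^{q'}$
  for $0 \le \eta \le 1$ bounds the contribution of the $m$-th annulus by
  $2^{2m/(q-1)} \|\eta_m\|^{q'}_{W^{2,q'}}$, and the outer cut-off contributes $O(R^{2-2q'})$.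
  Letting $\varepsilon \to 0$ and $R \to \infty$ gives the estimate; neither subadditivity nor a
  comparison principle for the nonlinear equation is needed.
\<close>

section \<open>Partial derivatives and functions of class C^n\<close>

text \<open>A sum of cut-offs, rather than a product or a maximum, stays C^2 and has additive
  derivatives. At most five of its terms (four dyadic, one exterior) are active at a point, so the
  constants do not depend on the number of pieces. Only the lower bound S \<ge> 1 on F and far away
  matters: the factor 2 makes the test function vanish where S \<ge> 1/2, hence near F, and its
  support is a compact subset of the complement of F. Two derivatives of the k-th power leave the
  power k-2, and (k-2)q \<ge> k is exactly k \<ge> 2q'; they also produce (DS)^2, which is why first
  derivatives are measured in L^(2q'). The weight in the potential is a count of scales: with
  \<sigma> = 2^m the kernel contributes \<sigma>^(N-2), the second derivatives \<sigma>^(2q'), the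
  change of variables \<sigma>^(-N), in all \<sigma>^(2q'-2) = 2^(2m/(q-1)). The outer cut-off is
  the same count with \<sigma> = 1/R. Since the test function is only C^2 while solutions are tested
  against smooth functions, a mollification step comes in between.\<close>

lemma pd_eq: "(f has_derivative f') (at x) \<Longrightarrow> pd b f x = f' b"
  unfolding pd_def using frechet_derivative_at by metis

lemma has_derivative_pd:
  "f differentiable (at x) \<Longrightarrow> (f has_derivative (\<lambda>b. pd b f x)) (at x)"
  unfolding pd_def by (simp add: frechet_derivative_works)

lemma pd_add:
  assumes "f differentiable (at x)" "g differentiable (at x)"
  shows "pd b (\<lambda>x. f x + g x) x = pd b f x + pd b g x"
  by (rule pd_eq, rule has_derivative_add) (intro has_derivative_pd assms)+

lemma pd_mult:
  assumes "f differentiable (at x)" "g differentiable (at x)"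
  shows "pd b (\<lambda>x. f x * g x) x = pd b f x * g x + f x * pd b g x"
proof -
  have "((\<lambda>x. f x * g x) has_derivative (\<lambda>b. f x * pd b g x + pd b f x * g x)) (at x)"
    by (rule has_derivative_mult) (intro has_derivative_pd assms)+
  from pd_eq[OF this, of b] show ?thesis by simp
qed

lemma pd_sum:
  assumes "\<And>i. i \<in> I \<Longrightarrow> f i differentiable (at x)"
  shows "pd b (\<lambda>x. \<Sum>i\<in>I. f i x) x = (\<Sum>i\<in>I. pd b (f i) x)"
  by (rule pd_eq, rule has_derivative_sum) (intro has_derivative_pd assms)

lemma pd_const [simp]: "pd b (\<lambda>x. c) x = 0"
  by (rule pd_eq) (rule has_derivative_const)

lemma has_derivative_compose_real:
  assumes "f differentiable (at x)" "(g has_real_derivative g') (at (f x))"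
  shows "((\<lambda>x. g (f x)) has_derivative (\<lambda>b. g' * pd b f x)) (at x)"
  using has_derivative_compose[OF has_derivative_pd[OF assms(1)],
      of g "\<lambda>t. g' * t"] assms(2)
  by (simp add: has_field_derivative_def)

lemma pd_compose_real:
  assumes "f differentiable (at x)" "(g has_real_derivative g') (at (f x))"
  shows "pd b (\<lambda>x. g (f x)) x = g' * pd b f x"
  by (rule pd_eq) (rule has_derivative_compose_real[OF assms])

lemma has_derivative_affine:
  fixes f :: "'a::euclidean_space \<Rightarrow> real"
  assumes "f differentiable (at (c *\<^sub>R x + a))"
  shows "((\<lambda>x. f (c *\<^sub>R x + a)) has_derivative (\<lambda>b. c * pd b f (c *\<^sub>R x + a))) (at x)"
proof -
  let ?D = "\<lambda>b. pd b f (c *\<^sub>R x + a)"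
  have D: "(f has_derivative ?D) (at (c *\<^sub>R x + a))"
    by (rule has_derivative_pd[OF assms])
  have "((\<lambda>x. c *\<^sub>R x + a) has_derivative (\<lambda>b. c *\<^sub>R b)) (at x)"
    by (auto intro!: derivative_eq_intros)
  from has_derivative_compose[OF this D]
  have "((\<lambda>x. f (c *\<^sub>R x + a)) has_derivative (\<lambda>b. ?D (c *\<^sub>R b))) (at x)" .
  moreover have "?D (c *\<^sub>R b) = c * ?D b" for b
    using linear_scale[OF has_derivative_linear[OF D], of c b] by simp
  ultimately show ?thesis by simp
qed

lemma pd_affine:
  fixes f :: "'a::euclidean_space \<Rightarrow> real"
  assumes "f differentiable (at (c *\<^sub>R x + a))"
  shows "pd b (\<lambda>x. f (c *\<^sub>R x + a)) x = c * pd b f (c *\<^sub>R x + a)"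
  by (rule pd_eq) (rule has_derivative_affine[OF assms])

lemma has_derivative_norm_sq:
  "((\<lambda>x::'a::euclidean_space. (norm x)\<^sup>2) has_derivative (\<lambda>b. 2 * (x \<bullet> b))) (at x)"
  unfolding power2_norm_eq_inner
  by (auto intro!: derivative_eq_intros simp: inner_commute)

lemma pd_norm_sq: "pd b (\<lambda>x::'a::euclidean_space. (norm x)\<^sup>2) x = 2 * (x \<bullet> b)"
  by (rule pd_eq) (rule has_derivative_norm_sq)

lemma has_derivative_inner_const: "((\<lambda>x::'a::euclidean_space. x \<bullet> a) has_derivative (\<lambda>b. b \<bullet> a)) (at x)"
  by (auto intro!: derivative_eq_intros)

lemma pd_inner: "pd b (\<lambda>x::'a::euclidean_space. x \<bullet> a) x = b \<bullet> a"
  by (rule pd_eq) (rule has_derivative_inner_const)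

lemma Ck_imp_continuous: "Ck n f \<Longrightarrow> continuous_on UNIV f"
  by (cases n)
    (auto intro!: continuous_at_imp_continuous_on differentiable_imp_continuous_within)

lemma Ck_SucD: "Ck (Suc n) f \<Longrightarrow> Ck n f"
proof (induction n arbitrary: f)
  case 0 from Ck_imp_continuous[OF this] show ?case by simp
qed auto

lemma Ck_mono: "Ck n f \<Longrightarrow> m \<le> n \<Longrightarrow> Ck m f"
proof (induction "n - m" arbitrary: n)
  case (Suc d)
  then obtain k where "n = Suc k" by (metis Suc_diff_le diff_is_0_eq nat.exhaust zero_le Zero_not_Suc)
  with Suc show ?case by (metis Ck_SucD Suc_diff_le Suc_inject diff_Suc_1 le_Suc_eq diff_self_eq_0 Zero_not_Suc)
qed simp

lemma Ck2_imp_Ck1: "Ck 2 f \<Longrightarrow> Ck 1 f"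
  by (rule Ck_mono) auto

lemma Ck2_pd: "Ck 2 f \<Longrightarrow> b \<in> Basis \<Longrightarrow> Ck 1 (pd b f)"
  unfolding numeral_2_eq_2 One_nat_def by (subst (asm) Ck.simps(2)) simp

lemma Ck_differentiable: "Ck n f \<Longrightarrow> n \<noteq> 0 \<Longrightarrow> f differentiable (at x)"
  by (cases n) auto

lemma Ck_const [simp]: "Ck n (\<lambda>x. c)"
proof (induction n arbitrary: c)
  case (Suc n)
  have "pd b (\<lambda>x::'a. c) = (\<lambda>x. 0)" for b by (rule ext) simp
  with Suc show ?case by simp
qed simp

lemma Ck_add: "Ck n f \<Longrightarrow> Ck n g \<Longrightarrow> Ck n (\<lambda>x. f x + g x)"
proof (induction n arbitrary: f g)
  case (Suc n)
  then have "pd b (\<lambda>x. f x + g x) = (\<lambda>x. pd b f x + pd b g x)" for b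
    by (intro ext pd_add) auto
  with Suc show ?case by auto
qed (auto intro: continuous_intros)

lemma Ck_sum: "(\<And>i. i \<in> I \<Longrightarrow> Ck n (f i)) \<Longrightarrow> Ck n (\<lambda>x. \<Sum>i\<in>I. f i x)"
  by (induction I rule: infinite_finite_induct) (auto intro!: Ck_add)

lemma Ck_mult: "Ck n f \<Longrightarrow> Ck n g \<Longrightarrow> Ck n (\<lambda>x. f x * g x)"
proof (induction n arbitrary: f g)
  case (Suc n)
  then have "pd b (\<lambda>x. f x * g x) = (\<lambda>x. pd b f x * g x + f x * pd b g x)" for b
    by (intro ext pd_mult) auto
  moreover have "Ck n f" "Ck n g" using Suc.prems Ck_SucD by blast+
  ultimately show ?case using Suc by (auto intro!: Ck_add)
qed (auto intro: continuous_intros)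

lemma Ck_diff: "Ck n f \<Longrightarrow> Ck n g \<Longrightarrow> Ck n (\<lambda>x. f x - g x)"
  using Ck_add[of n f "\<lambda>x. (-1) * g x"] Ck_mult[of n "\<lambda>x. -1" g] by simp

lemma Ck_inner: "Ck n (\<lambda>x::'a::euclidean_space. x \<bullet> a)"
proof (cases n)
  case (Suc m)
  have "pd b (\<lambda>x. x \<bullet> a) = (\<lambda>x. b \<bullet> a)" for b by (rule ext) (rule pd_inner)
  with Suc has_derivative_inner_const show ?thesis by (auto intro: differentiableI)
qed (auto intro!: continuous_intros)

lemma Ck_norm_sq: "Ck n (\<lambda>x::'a::euclidean_space. (norm x)\<^sup>2)"
proof (cases n)
  case (Suc m)
  have "pd b (\<lambda>x::'a. (norm x)\<^sup>2) = (\<lambda>x. 2 * (x \<bullet> b))" for b by (rule ext) (rule pd_norm_sq)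
  with Suc has_derivative_norm_sq show ?thesis
    by (auto intro!: differentiableI Ck_mult Ck_inner)
qed (auto intro!: continuous_intros)

lemma Ck_affine:
  "Ck n f \<Longrightarrow> Ck n (\<lambda>x::'a::euclidean_space. f (c *\<^sub>R x + a))"
proof (induction n arbitrary: f)
  case 0
  then show ?case by (auto intro!: continuous_intros continuous_on_compose2[of UNIV f])
next
  case (Suc n)
  then have "pd b (\<lambda>x. f (c *\<^sub>R x + a)) = (\<lambda>x. c * pd b f (c *\<^sub>R x + a))" for b
    by (intro ext pd_affine) auto
  moreover have "(\<lambda>x. f (c *\<^sub>R x + a)) differentiable (at x)" for x
    using Suc.prems by (intro differentiableI[OF has_derivative_affine]) simp
  ultimately show ?case using Suc by (auto intro!: Ck_mult)
qed

lemma Ck_compose_real: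
  assumes "\<And>j x. j < n \<Longrightarrow> (g j has_real_derivative g (Suc j) (f x)) (at (f x))"
    and "continuous_on (range f) (g n)" and "Ck n f"
  shows "Ck n (\<lambda>x. g 0 (f x))"
  using assms
proof (induction n arbitrary: g)
  case 0
  then show ?case by (auto intro!: continuous_on_compose2[of "range f" "g 0"])
next
  case (Suc n)
  have d: "f differentiable (at x)" for x using Suc.prems by simp
  have "pd b (\<lambda>x. g 0 (f x)) = (\<lambda>x. g 1 (f x) * pd b f x)" for b
    using Suc.prems(1)[of 0] d by (intro ext pd_compose_real) auto
  moreover have "(\<lambda>x. g 0 (f x)) differentiable (at x)" for x
    using has_derivative_compose_real[OF d[of x]] Suc.prems(1)[of 0 x] by (auto intro!: differentiableI)
  moreover have "Ck n (\<lambda>x. g 1 (f x))"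
    using Suc.IH[of "\<lambda>j. g (Suc j)"] Suc.prems Ck_SucD[OF Suc.prems(3)] by auto
  ultimately show ?case using Suc.prems by (auto intro!: Ck_mult)
qed

lemma pd_pd_mult:
  assumes "Ck 2 f" "Ck 2 g" "b \<in> Basis"
  shows "pd b (pd b (\<lambda>x. f x * g x)) x
    = pd b (pd b f) x * g x + 2 * pd b f x * pd b g x + f x * pd b (pd b g) x"
proof -
  have C: "Ck 1 (pd b f)" "Ck 1 (pd b g)" "Ck 1 f" "Ck 1 g"
    using assms by (blast intro: Ck2_pd Ck2_imp_Ck1)+
  then have d: "f differentiable (at x)" "g differentiable (at x)"
    "pd b f differentiable (at x)" "pd b g differentiable (at x)" for x
    by (auto intro: Ck_differentiable)
  have eq: "pd b (\<lambda>x. f x * g x) = (\<lambda>x. pd b f x * g x + f x * pd b g x)"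
    by (intro ext pd_mult d)
  have "Ck 1 (\<lambda>x. pd b f x * g x)" "Ck 1 (\<lambda>x. f x * pd b g x)"
    using C by (auto intro!: Ck_mult simp del: Ck.simps)
  then show ?thesis unfolding eq
    by (subst pd_add) (auto simp: pd_mult d algebra_simps intro: Ck_differentiable)
qed

lemma pd_pd_compose_real:
  assumes "Ck 2 f" "b \<in> Basis"
    and "\<And>x. (g has_real_derivative g' (f x)) (at (f x))"
    and "\<And>x. (g' has_real_derivative g'' (f x)) (at (f x))"
  shows "pd b (pd b (\<lambda>x. g (f x))) x = g' (f x) * pd b (pd b f) x + g'' (f x) * (pd b f x)\<^sup>2"
proof -
  have C: "Ck 1 (pd b f)" "Ck 1 f"
    using assms by (blast intro: Ck2_pd Ck2_imp_Ck1)+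
  then have d: "f differentiable (at x)" "pd b f differentiable (at x)" for x
    by (auto intro: Ck_differentiable)
  have eq: "pd b (\<lambda>x. g (f x)) = (\<lambda>x. g' (f x) * pd b f x)"
    by (intro ext pd_compose_real d assms)
  have "(\<lambda>x. g' (f x)) differentiable (at x)"
    using has_derivative_compose_real[OF d(1) assms(4)] by (rule differentiableI)
  then show ?thesis unfolding eq
    by (subst pd_mult) (auto simp: d pd_compose_real[OF d(1) assms(4)] power2_eq_square)
qed

lemma pd_eq_0_outside_tsupp: "x \<notin> tsupp f \<Longrightarrow> pd b f x = 0"
proof -
  assume x: "x \<notin> tsupp f"
  have "((\<lambda>x. 0) has_derivative (\<lambda>b. 0)) (at x)" by simp
  then have "(f has_derivative (\<lambda>b. 0)) (at x)"
    by (rule has_derivative_transform_within_open[where s="- tsupp f"])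
      (use x closure_subset[of "{x. f x \<noteq> 0}"] in \<open>auto simp: tsupp_def\<close>)
  then show ?thesis using pd_eq by fastforce
qed

lemma tsupp_pd: "tsupp (pd b f) \<subseteq> tsupp f"
proof -
  have "{x. pd b f x \<noteq> 0} \<subseteq> tsupp f" using pd_eq_0_outside_tsupp by auto
  then show ?thesis unfolding tsupp_def[of "pd b f"]
    by (rule closure_minimal) (simp add: tsupp_def)
qed

lemma eq_0_outside_tsupp: "x \<notin> tsupp f \<Longrightarrow> f x = 0"
  using closure_subset[of "{x. f x \<noteq> 0}"] by (auto simp: tsupp_def)

lemma compact_tsuppI:
  fixes f :: "'a::euclidean_space \<Rightarrow> real"
  assumes "compact K" "\<And>x. x \<notin> K \<Longrightarrow> f x = 0"
  shows "compact (tsupp f)" "tsupp f \<subseteq> K"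
proof -
  show "tsupp f \<subseteq> K" unfolding tsupp_def
    by (rule closure_minimal) (use assms compact_imp_closed in auto)
  then show "compact (tsupp f)"
    using compact_Int_closed[OF assms(1), of "tsupp f"] by (simp add: tsupp_def inf.absorb2)
qed

section \<open>Integrals of compactly supported functions\<close>

lemma integrable_compact_support:
  fixes f :: "'a::euclidean_space \<Rightarrow> real"
  assumes "compact K" "continuous_on K f" "\<And>x. x \<notin> K \<Longrightarrow> f x = 0"
  shows "integrable lborel f"
proof -
  have "integrable lborel (\<lambda>x. indicator K x *\<^sub>R f x)"
    by (rule borel_integrable_compact[OF assms(1,2)])
  also have "(\<lambda>x. indicator K x *\<^sub>R f x) = f" using assms(3) by (auto simp: indicator_def fun_eq_iff)
  finally show ?thesis .
qed

lemma integrable_tsupp: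
  fixes f :: "'a::euclidean_space \<Rightarrow> real"
  assumes "continuous_on UNIV f" "compact (tsupp g)" "\<And>x. x \<notin> tsupp g \<Longrightarrow> f x = 0"
  shows "integrable lborel f"
  using assms by (intro integrable_compact_support[of "tsupp g"]) (auto intro: continuous_on_subset)

lemma lborel_integral_affine:
  fixes f :: "'a::euclidean_space \<Rightarrow> real"
  assumes "c \<noteq> 0" "f \<in> borel_measurable borel"
  shows "(\<integral>x. f (c *\<^sub>R x + a) \<partial>lborel) = (\<integral>x. f x \<partial>lborel) / \<bar>c\<bar> ^ DIM('a)"
proof -
  have "(\<integral>x. f x \<partial>lborel) = (\<integral>x. f x \<partial>density (distr lborel borel (\<lambda>x. a + c *\<^sub>R x)) (\<lambda>_. ennreal (\<bar>c\<bar> ^ DIM('a))))"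
    using lborel_affine[OF assms(1), of a] by simp
  also have "\<dots> = \<bar>c\<bar> ^ DIM('a) * (\<integral>x. f (c *\<^sub>R x + a) \<partial>lborel)"
    using assms(2) by (subst integral_density) (auto simp: integral_distr add.commute)
  finally show ?thesis using assms(1) by simp
qed

lemma continuous_imp_borel: "continuous_on UNIV f \<Longrightarrow> f \<in> borel_measurable borel"
  by (rule borel_measurable_continuous_onI)

lemma continuous_compact_support_bounded:
  fixes f :: "'a::euclidean_space \<Rightarrow> real"
  assumes "compact K" "continuous_on K f" "\<And>x. x \<notin> K \<Longrightarrow> f x = 0"
  obtains B where "B \<ge> 0" "\<And>x. \<bar>f x\<bar> \<le> B"
proof -
  have "bounded (f ` K)" using assms compact_continuous_image compact_imp_bounded by blast
  then obtain B where "\<And>x. x \<in> K \<Longrightarrow> \<bar>f x\<bar> \<le> B" unfolding bounded_iff by auto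
  then have "\<bar>f x\<bar> \<le> max B 0" for x using assms(3)[of x] by (cases "x \<in> K") fastforce+
  then show ?thesis using that[of "max B 0"] by simp
qed

lemma Ck1_continuous_pd: "Ck 1 f \<Longrightarrow> b \<in> Basis \<Longrightarrow> continuous_on UNIV (pd b f)"
  by simp

lemma has_real_derivative_line:
  fixes f :: "'a::euclidean_space \<Rightarrow> real"
  assumes "f differentiable (at (x + t *\<^sub>R b))"
  shows "((\<lambda>t. f (x + t *\<^sub>R b)) has_real_derivative pd b f (x + t *\<^sub>R b)) (at t)"
proof -
  note D = has_derivative_pd[OF assms]
  have "((\<lambda>t. x + t *\<^sub>R b) has_derivative (\<lambda>s. s *\<^sub>R b)) (at t)"
    by (auto intro!: derivative_eq_intros)
  from has_derivative_compose[OF this D]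
  have "((\<lambda>t. f (x + t *\<^sub>R b)) has_derivative (\<lambda>s. pd (s *\<^sub>R b) f (x + t *\<^sub>R b))) (at t)" .
  moreover have "pd (s *\<^sub>R b) f (x + t *\<^sub>R b) = pd b f (x + t *\<^sub>R b) * s" for s
    using linear_scale[OF has_derivative_linear[OF D], of s b] by simp
  ultimately show ?thesis by (simp add: has_field_derivative_def)
qed

text \<open>Differentiate the constant function $t \mapsto \int f(x + tb)\,dx$ under the integral sign.\<close>

lemma integral_pd_eq_0:
  fixes f :: "'a::euclidean_space \<Rightarrow> real"
  assumes f: "Ck 1 f" and supp: "compact (tsupp f)" and b: "b \<in> Basis"
  shows "(\<integral>x. pd b f x \<partial>lborel) = 0"
proof -
  have d: "f differentiable (at x)" for x using Ck_differentiable[OF f] by simp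
  have cpd: "continuous_on UNIV (pd b f)" by (rule Ck1_continuous_pd[OF f b])
  have cf: "continuous_on UNIV f" by (rule Ck_imp_continuous[OF f])
  obtain r where r: "tsupp f \<subseteq> cball 0 r"
    using compact_imp_bounded[OF supp] by (force simp: bounded_pos)
  obtain B where B: "B \<ge> 0" "\<And>x. \<bar>pd b f x\<bar> \<le> B"
    using continuous_compact_support_bounded[OF supp continuous_on_subset[OF cpd subset_UNIV]
      pd_eq_0_outside_tsupp] by blast
  define h where "h n = inverse (real (Suc n))" for n
  have h: "h n > 0" "h n \<le> 1" for n by (auto simp: h_def inverse_le_1_iff)
  define s where "s n x = (f (x + h n *\<^sub>R b) - f x) / h n" for n x
  \<comment> \<open>Domination of the difference quotients: by the mean value theorem they are
    values of \<open>pd b f\<close>, and since \<open>h n\<close> \<le> 1 the supports grow by at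
    most 1.\<close>
  have bound: "norm (s n x) \<le> B * indicator (cball 0 (r + 1)) x" for n x
  proof (cases "x \<in> cball 0 (r + 1)")
    case True
    obtain z where "f (x + h n *\<^sub>R b) - f (x + 0 *\<^sub>R b) = (h n - 0) * pd b f (x + z *\<^sub>R b)"
      using MVT2[of 0 "h n" "\<lambda>t. f (x + t *\<^sub>R b)" "\<lambda>t. pd b f (x + t *\<^sub>R b)"] h(1)[of n]
        has_real_derivative_line[OF d] by blast
    then have "s n x = pd b f (x + z *\<^sub>R b)" using h(1)[of n] by (simp add: s_def field_simps)
    then show ?thesis using True B by simp
  next
    case False
    then have n: "norm x > r + 1" by simp
    have "norm x \<le> norm (x + h n *\<^sub>R b) + norm (h n *\<^sub>R b)"
      using norm_triangle_ineq4[of "x + h n *\<^sub>R b" "h n *\<^sub>R b"] by simp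
    moreover have "norm (h n *\<^sub>R b) \<le> 1" using h[of n] b by simp
    ultimately have "x + h n *\<^sub>R b \<notin> tsupp f" "x \<notin> tsupp f" using n r by auto
    then show ?thesis using eq_0_outside_tsupp[of _ f] False by (simp add: s_def)
  qed
  have lim: "(\<lambda>n. s n x) \<longlonglongrightarrow> pd b f x" for x
  proof -
    have "((\<lambda>t. f (x + t *\<^sub>R b)) has_real_derivative pd b f x) (at 0)"
      using has_real_derivative_line[of f x 0 b] d by simp
    then have "((\<lambda>t. (f (x + t *\<^sub>R b) - f x) / t) \<longlongrightarrow> pd b f x) (at 0)"
      by (simp add: DERIV_def)
    moreover have "filterlim h (at 0) sequentially"
      unfolding filterlim_at using h(1) LIMSEQ_inverse_real_of_nat
      by (auto simp: h_def[abs_def] less_imp_neq[symmetric])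
    ultimately show ?thesis unfolding s_def by (rule filterlim_compose)
  qed
  have meas: "f \<in> borel_measurable borel" by (rule continuous_imp_borel[OF cf])
  have ms: "s n \<in> borel_measurable lborel" for n
  proof -
    have "continuous_on UNIV (s n)" unfolding s_def using h(1)[of n]
      by (auto intro!: continuous_intros continuous_on_compose2[OF cf] cf)
    then show ?thesis using continuous_imp_borel by simp
  qed
  have int0: "(\<integral>x. s n x \<partial>lborel) = 0" for n
  proof -
    have i1: "integrable lborel f" by (rule integrable_tsupp[OF cf supp eq_0_outside_tsupp[of _ f]])
    have i2: "integrable lborel (\<lambda>x. f (x + h n *\<^sub>R b))"
    proof (rule integrable_compact_support[of "cball 0 (r + 1)"])
      show "continuous_on (cball 0 (r + 1)) (\<lambda>x. f (x + h n *\<^sub>R b))"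
        by (auto intro!: continuous_intros continuous_on_compose2[OF cf])
      fix x :: 'a assume "x \<notin> cball 0 (r + 1)"
      then have n: "norm x > r + 1" by simp
      have "norm x \<le> norm (x + h n *\<^sub>R b) + norm (h n *\<^sub>R b)"
        using norm_triangle_ineq4[of "x + h n *\<^sub>R b" "h n *\<^sub>R b"] by simp
      moreover have "norm (h n *\<^sub>R b) \<le> 1" using h[of n] b by simp
      ultimately have "x + h n *\<^sub>R b \<notin> tsupp f" using n r by auto
      then show "f (x + h n *\<^sub>R b) = 0" by (rule eq_0_outside_tsupp)
    qed auto
    show ?thesis using lborel_integral_affine[of 1 f "h n *\<^sub>R b"] meas
      unfolding s_def by (simp add: i1 i2)
  qed
  have iB: "integrable lborel (\<lambda>x::'a. B * indicator (cball 0 (r + 1)) x)"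
    by (intro integrable_mult_right integrable_real_indicator)
      (use emeasure_lborel_cball_finite emeasure_lborel_ball_finite in auto)
  have "(\<lambda>n. \<integral>x. s n x \<partial>lborel) \<longlonglongrightarrow> (\<integral>x. pd b f x \<partial>lborel)"
    by (rule integral_dominated_convergence[OF _ ms iB])
      (use bound lim continuous_imp_borel[OF cpd] in auto)
  then show ?thesis unfolding int0 using LIMSEQ_unique tendsto_const by metis
qed

section \<open>A Gagliardo-Nirenberg inequality\<close>

text \<open>The exponent used later is 2p-2, which can be less than 1, so |t|^a alone need not be
  differentiable at 0. The extra factor t repairs this: the difference quotient at 0 is |t|^a
  itself, which tends to 0.\<close>

lemma DERIV_abs_powr_mult:
  fixes a t :: real
  assumes "a > 0"
  shows "((\<lambda>t. \<bar>t\<bar> powr a * t) has_real_derivative (a + 1) * \<bar>t\<bar> powr a) (at t)"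
proof -
  consider "t > 0" | "t < 0" | "t = 0" by linarith
  then show ?thesis
  proof cases
    case 1
    have "((\<lambda>t. t powr a * t) has_real_derivative (a + 1) * t powr a) (at t)"
      using 1 by (auto intro!: derivative_eq_intros simp: powr_diff field_simps)
    then show ?thesis using 1
      by (auto intro: has_field_derivative_transform_within_open[where S="{0<..}"])
  next
    case 2
    have "((\<lambda>t. (- t) powr a * t) has_real_derivative (a + 1) * (- t) powr a) (at t)"
      using 2 by (auto intro!: derivative_eq_intros simp: powr_diff field_simps)
    then show ?thesis using 2
      by (auto intro: has_field_derivative_transform_within_open[where S="{..<0}"])
  next
    case 3
    have "((\<lambda>t. \<bar>t\<bar> powr a) \<longlongrightarrow> 0 powr a) (at 0)"
      using assms by (intro tendsto_powr' tendsto_rabs_zero tendsto_const tendsto_ident_at) auto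
    then have "((\<lambda>t. \<bar>t\<bar> powr a) \<longlongrightarrow> 0) (at 0)" by simp
    moreover have "eventually (\<lambda>t. \<bar>t\<bar> powr a = (\<bar>t\<bar> powr a * t - 0) / (t - 0)) (at 0)"
      by (simp add: eventually_at_filter)
    ultimately have "((\<lambda>t. (\<bar>t\<bar> powr a * t - 0) / (t - 0)) \<longlongrightarrow> 0) (at 0)"
      by (rule Lim_transform_eventually)
    then show ?thesis using 3 by (simp add: has_field_derivative_iff)
  qed
qed

lemma continuous_on_abs_powr:
  fixes a :: real and f :: "'a::topological_space \<Rightarrow> real"
  assumes "a > 0" "continuous_on S f"
  shows "continuous_on S (\<lambda>x. \<bar>f x\<bar> powr a)"
  using assms by (intro continuous_on_powr' continuous_intros) auto

text \<open>Integrate $\partial_b (f\,|\partial_b f|^{2p-2}\,\partial_b f)$ and absorb by Young's inequality.\<close>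

lemma gagliardo_nirenberg:
  fixes f :: "'a::euclidean_space \<Rightarrow> real"
  assumes p: "p > 1" and f: "Ck 2 f" and supp: "compact (tsupp f)"
    and range: "\<And>x. 0 \<le> f x" "\<And>x. f x \<le> 1" and b: "b \<in> Basis"
  shows "(\<integral>x. \<bar>pd b f x\<bar> powr (2 * p) \<partial>lborel)
    \<le> 2 * (2 * (2 * p - 1)) powr p * (\<integral>x. \<bar>pd b (pd b f) x\<bar> powr p \<partial>lborel)"
proof -
  define v where "v = pd b f"
  define w where "w = pd b v"
  \<comment> \<open>With this exponent v |v|^a v = |v|^(2p), so differentiating the factor
    \<open>f\<close> of \<open>G\<close> produces exactly the integrand to be estimated.\<close>
  define a where "a = 2 * p - 2"
  have a: "a > 0" using p by (simp add: a_def)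
  have v: "Ck 1 v" and f1: "Ck 1 f" unfolding v_def using f b by (blast intro: Ck2_pd Ck2_imp_Ck1)+
  have cv: "continuous_on UNIV v" by (rule Ck_imp_continuous[OF v])
  have cw: "continuous_on UNIV w" unfolding w_def by (rule Ck1_continuous_pd[OF v b])
  have cf: "continuous_on UNIV f" by (rule Ck_imp_continuous[OF f])
  have v0: "v x = 0" and w0: "w x = 0" and f0: "f x = 0" if "x \<notin> tsupp f" for x
    using that tsupp_pd[of b f] pd_eq_0_outside_tsupp[of x] eq_0_outside_tsupp
    by (auto simp: v_def w_def)
  define g where "g j = (\<lambda>t::real. if j = 0 then \<bar>t\<bar> powr a * t else (a + 1) * \<bar>t\<bar> powr a)" for j :: nat
  have gv: "Ck 1 (\<lambda>x. g 0 (v x))"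
    by (rule Ck_compose_real[OF _ _ v])
      (use a in \<open>auto simp: g_def DERIV_abs_powr_mult intro!: continuous_intros continuous_on_abs_powr\<close>)
  define G where "G x = f x * g 0 (v x)" for x
  have G: "Ck 1 G" unfolding G_def by (rule Ck_mult[OF f1 gv])
  have "compact (tsupp G)" by (rule compact_tsuppI[OF supp]) (simp add: G_def f0)
  from integral_pd_eq_0[OF G this b] have I0: "(\<integral>x. pd b G x \<partial>lborel) = 0" .
  have dv: "v differentiable (at x)" for x using Ck_differentiable[OF v] by simp
  have df: "f differentiable (at x)" for x using Ck_differentiable[OF f1] by simp
  have pdG: "pd b G x = \<bar>v x\<bar> powr (2 * p) + f x * ((2 * p - 1) * \<bar>v x\<bar> powr a * w x)" for x
  proof -
    have "pd b (\<lambda>x. g 0 (v x)) x = (a + 1) * \<bar>v x\<bar> powr a * pd b v x"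
      by (rule pd_compose_real[OF dv]) (simp add: g_def DERIV_abs_powr_mult[OF a])
    then have "pd b G x = v x * g 0 (v x) + f x * ((a + 1) * \<bar>v x\<bar> powr a * w x)"
      unfolding G_def using Ck_differentiable[OF gv] by (subst pd_mult) (auto simp: df v_def w_def)
    moreover have "v x * g 0 (v x) = \<bar>v x\<bar> powr (2 * p)"
    proof -
      have "v x * g 0 (v x) = \<bar>v x\<bar> powr a * \<bar>v x\<bar> powr 2"
        by (simp add: g_def power2_eq_square powr_numeral)
      also have "\<dots> = \<bar>v x\<bar> powr (a + 2)" by (rule powr_add[symmetric])
      finally show ?thesis by (simp add: a_def)
    qed
    ultimately show ?thesis by (simp add: a_def)
  qed
  define C where "C = (2 * (2 * p - 1)) powr p"
  have young: "\<bar>v x\<bar> powr (2 * p) - pd b G x \<le> \<bar>v x\<bar> powr (2 * p) / 2 + C * \<bar>w x\<bar> powr p" for x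
  proof -
    \<comment> \<open>Young with exponents p/(p-1) and p: a * p/(p-1) = 2p turns the first factor
      into a multiple of |v|^(2p). The factor 2 shifted from \<open>?A\<close> to \<open>?B\<close>
      keeps that multiple at most 1/2, so that it can be absorbed.\<close>
    let ?A = "\<bar>v x\<bar> powr a / 2" and ?B = "2 * (2 * p - 1) * \<bar>w x\<bar>" and ?P = "p / (p - 1)"
    have "\<bar>v x\<bar> powr (2 * p) - pd b G x \<le> \<bar>f x * ((2 * p - 1) * \<bar>v x\<bar> powr a * w x)\<bar>"
      unfolding pdG by linarith
    also have "\<dots> \<le> 1 * ((2 * p - 1) * \<bar>v x\<bar> powr a * \<bar>w x\<bar>)"
      unfolding abs_mult using p range[of x] by (intro mult_mono) auto
    also have "\<dots> = ?A * ?B" by simp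
    also have "\<dots> \<le> ?A powr ?P / ?P + ?B powr p / p"
      using p by (intro Youngs_inequality mult_nonneg_nonneg) (auto simp: diff_divide_distrib)
    also have "?A powr ?P = (1/2) powr ?P * \<bar>v x\<bar> powr (2 * p)"
    proof -
      have "?A powr ?P = (1/2) powr ?P * (\<bar>v x\<bar> powr a) powr ?P"
        by (subst powr_mult[symmetric]) auto
      also have "(\<bar>v x\<bar> powr a) powr ?P = \<bar>v x\<bar> powr (2 * p)"
        unfolding powr_powr using p by (intro arg_cong2[where f="(powr)"]) (auto simp: a_def field_simps)
      finally show ?thesis .
    qed
    also have "(1/2) powr ?P * \<bar>v x\<bar> powr (2 * p) / ?P \<le> \<bar>v x\<bar> powr (2 * p) / 2"
    proof -
      have "(1/2) powr ?P \<le> (1/2::real) powr 1"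
        by (rule powr_mono') (use p in \<open>auto simp: field_simps\<close>)
      then have "(1/2) powr ?P \<le> (1/2::real)" by simp
      moreover have "(1/2) powr ?P * \<bar>v x\<bar> powr (2 * p) / ?P \<le> (1/2) powr ?P * \<bar>v x\<bar> powr (2 * p) / 1"
        by (rule divide_left_mono) (use p in \<open>auto simp: field_simps\<close>)
      moreover have "(1/2) powr ?P * \<bar>v x\<bar> powr (2 * p) / 1 \<le> \<bar>v x\<bar> powr (2 * p) / 2"
        using mult_right_mono[OF calculation(1), of "\<bar>v x\<bar> powr (2 * p)"] by simp
      ultimately show ?thesis by (blast intro: order_trans)
    qed
    also have "?B powr p / p \<le> ?B powr p / 1"
      by (rule divide_left_mono) (use p in auto)
    also have "?B powr p / 1 = C * \<bar>w x\<bar> powr p"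
      unfolding C_def using p by (simp add: powr_mult)
    finally show ?thesis by simp
  qed
  have i1: "integrable lborel (\<lambda>x. \<bar>v x\<bar> powr (2 * p))"
    by (rule integrable_tsupp[OF continuous_on_abs_powr[OF _ cv] supp]) (use p v0 in auto)
  have i2: "integrable lborel (\<lambda>x. \<bar>w x\<bar> powr p)"
    by (rule integrable_tsupp[OF continuous_on_abs_powr[OF _ cw] supp]) (use p w0 in auto)
  have i3: "integrable lborel (pd b G)"
    by (rule integrable_tsupp[OF Ck1_continuous_pd[OF G b] supp]) (simp add: pdG v0 w0 f0)
  \<comment> \<open>The integral of \<open>pd b G\<close> is 0, so the left side is the integral of
    |v|^(2p); half of it, finite by compact support, is then subtracted from both sides.\<close>
  have "(\<integral>x. \<bar>v x\<bar> powr (2 * p) - pd b G x \<partial>lborel)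
      \<le> (\<integral>x. \<bar>v x\<bar> powr (2 * p) / 2 + C * \<bar>w x\<bar> powr p \<partial>lborel)"
    by (rule integral_mono) (use i1 i2 i3 young in auto)
  then show ?thesis using i1 i2 i3 by (simp add: I0 C_def v_def w_def)
qed

section \<open>Convolution and mollification\<close>

lemma pd_expand:
  fixes f :: "'a::euclidean_space \<Rightarrow> real"
  assumes "f differentiable (at x)"
  shows "pd h f x = (\<Sum>i\<in>Basis. (h \<bullet> i) * pd i f x)"
proof -
  have lin: "linear (\<lambda>b. pd b f x)" by (rule has_derivative_linear[OF has_derivative_pd[OF assms]])
  have "pd h f x = pd (\<Sum>i\<in>Basis. (h \<bullet> i) *\<^sub>R i) f x" by (simp add: euclidean_representation)
  also have "\<dots> = (\<Sum>i\<in>Basis. (h \<bullet> i) * pd i f x)"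
    by (subst linear_sum[OF lin]) (simp add: linear_scale[OF lin])
  finally show ?thesis .
qed

lemma has_derivative_convolution:
  fixes f g :: "'a::euclidean_space \<Rightarrow> real"
  assumes f: "Ck 1 f" and g: "continuous_on (cbox a b) g"
  shows "((\<lambda>x. integral (cbox a b) (\<lambda>y. g y * f (x - y))) has_derivative
    (\<lambda>h. integral (cbox a b) (\<lambda>y. g y * pd h f (x - y)))) (at x)"
proof -
  have d: "f differentiable (at x)" for x using Ck_differentiable[OF f] by simp
  have cf: "continuous_on UNIV f" by (rule Ck_imp_continuous[OF f])
  have cpd: "continuous_on UNIV (pd i f)" if "i \<in> Basis" for i by (rule Ck1_continuous_pd[OF f that])
  \<comment> \<open>\<open>leibniz_rule\<close> takes the derivative as a bounded linear map;
    assembling it from the partial derivatives makes its joint continuity in (x, y) evident.\<close>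
  define fx :: "'a \<Rightarrow> 'a \<Rightarrow> 'a \<Rightarrow>\<^sub>L real"
    where "fx x y = (\<Sum>i\<in>Basis. (g y * pd i f (x - y)) *\<^sub>R blinfun_inner_left i)" for x y
  have fx: "blinfun_apply (fx x y) h = g y * pd h f (x - y)" for x y h
    unfolding fx_def pd_expand[OF d, of h]
    by (simp add: blinfun.sum_left blinfun.scaleR_left sum_distrib_left mult_ac)
  have cfx: "continuous_on (UNIV \<times> cbox a b) (\<lambda>(x, y). fx x y)"
    unfolding fx_def case_prod_beta
    by (intro continuous_intros continuous_on_compose2[OF g] continuous_on_compose2[OF cpd]) auto
  have "((\<lambda>x. integral (cbox a b) (\<lambda>y. g y * f (x - y))) has_derivative
    blinfun_apply (integral (cbox a b) (fx x))) (at x within UNIV)"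
  proof (rule leibniz_rule[where U=UNIV])
    fix x y
    have "((\<lambda>x. f (1 *\<^sub>R x + (- y))) has_derivative (\<lambda>b. 1 * pd b f (1 *\<^sub>R x + (-y)))) (at x)"
      by (rule has_derivative_affine[OF d])
    then show "((\<lambda>x. g y * f (x - y)) has_derivative blinfun_apply (fx x y)) (at x within UNIV)"
      unfolding fx using has_derivative_mult_right by force
  next
    show "(\<lambda>y. g y * f (x - y)) integrable_on cbox a b" for x
      by (intro integrable_continuous continuous_intros g continuous_on_compose2[OF cf]) auto
  qed (use cfx in auto)
  moreover have "blinfun_apply (integral (cbox a b) (fx x)) h = integral (cbox a b) (\<lambda>y. g y * pd h f (x - y))" for h
  proof -
    have "fx x integrable_on cbox a b"
      unfolding fx_def
      by (intro integrable_continuous continuous_intros g continuous_on_compose2[OF cpd]) auto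
    then show ?thesis
      using integral_linear[of "fx x" "cbox a b" "\<lambda>l. blinfun_apply l h"] 
      by (simp add: o_def fx bounded_linear_intros)
  qed
  ultimately show ?thesis by (auto elim!: has_derivative_eq_rhs)
qed

lemma pd_convolution:
  fixes f g :: "'a::euclidean_space \<Rightarrow> real"
  assumes "Ck 1 f" "continuous_on (cbox a b) g"
  shows "pd h (\<lambda>x. integral (cbox a b) (\<lambda>y. g y * f (x - y)))
    = (\<lambda>x. integral (cbox a b) (\<lambda>y. g y * pd h f (x - y)))"
  by (rule ext, rule pd_eq) (rule has_derivative_convolution[OF assms])

lemma continuous_on_convolution:
  fixes f g :: "'a::euclidean_space \<Rightarrow> real"
  assumes f: "continuous_on UNIV f" and g: "continuous_on (cbox a b) g"
  shows "continuous_on UNIV (\<lambda>x. integral (cbox a b) (\<lambda>y. g y * f (x - y)))"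
  by (rule integral_continuous_on_param)
    (auto simp: case_prod_beta intro!: continuous_intros continuous_on_compose2[OF g] continuous_on_compose2[OF f])

text \<open>Every derivative falls on the translated factor, so all regularity is taken from
  \<open>f\<close> and \<open>g\<close> need only be continuous. Exchanging the two roles later
  gives smoothness from one form and the Laplacian from the other.\<close>

lemma Ck_convolution:
  fixes f g :: "'a::euclidean_space \<Rightarrow> real"
  assumes "Ck n f" and g: "continuous_on (cbox a b) g"
  shows "Ck n (\<lambda>x. integral (cbox a b) (\<lambda>y. g y * f (x - y)))"
  using assms(1)
proof (induction n arbitrary: f)
  case 0
  then show ?case using continuous_on_convolution[OF _ g] by simp
next
  case (Suc n)
  have f: "Ck 1 f" by (rule Ck_mono[OF Suc.prems]) simp
  show ?case
    using Suc differentiableI[OF has_derivative_convolution[OF f g]]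
    by (auto simp: pd_convolution[OF f g])
qed

lemma continuous_on_laplacian: "Ck 2 f \<Longrightarrow> continuous_on UNIV (laplacian f)"
  unfolding laplacian_def[abs_def]
  by (intro continuous_on_sum Ck1_continuous_pd Ck2_pd)

lemma laplacian_eq_0_outside_tsupp:
  assumes "x \<notin> tsupp f"
  shows "laplacian f x = 0"
proof -
  have "x \<notin> tsupp (pd i f)" for i using assms tsupp_pd[of i f] by auto
  from pd_eq_0_outside_tsupp[OF this] show ?thesis unfolding laplacian_def by simp
qed

lemma integral_cbox_eq_lborel:
  fixes f :: "'a::euclidean_space \<Rightarrow> real"
  assumes "continuous_on UNIV f" "\<And>x. x \<notin> cbox a b \<Longrightarrow> f x = 0"
  shows "integral (cbox a b) f = (\<integral>x. f x \<partial>lborel)"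
proof -
  have "integrable lborel f"
    using assms by (intro integrable_compact_support[of "cbox a b"]) (auto intro: continuous_on_subset)
  then have "(\<integral>x. f x \<partial>lborel) = integral UNIV f" by (rule integral_lborel[symmetric])
  also have "\<dots> = integral UNIV (\<lambda>x. if x \<in> cbox a b then f x else 0)"
    using assms(2) by (intro arg_cong2[where f=integral]) auto
  finally show ?thesis by (simp add: integral_restrict_UNIV)
qed

lemma laplacian_convolution:
  fixes f g :: "'a::euclidean_space \<Rightarrow> real"
  assumes f: "Ck 2 f" and g: "continuous_on (cbox a b) g"
  shows "laplacian (\<lambda>x. integral (cbox a b) (\<lambda>y. g y * f (x - y))) x
    = integral (cbox a b) (\<lambda>y. g y * laplacian f (x - y))"
proof -
  have "pd i (pd i (\<lambda>x. integral (cbox a b) (\<lambda>y. g y * f (x - y)))) x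
    = integral (cbox a b) (\<lambda>y. g y * pd i (pd i f) (x - y))" if "i \<in> Basis" for i
    by (simp only: pd_convolution[OF Ck2_imp_Ck1[OF f] g] pd_convolution[OF Ck2_pd[OF f that] g])
  moreover have "(\<lambda>y. g y * pd i (pd i f) (x - y)) integrable_on cbox a b" if "i \<in> Basis" for i
    by (intro integrable_continuous continuous_intros g
        continuous_on_compose2[OF Ck1_continuous_pd[OF Ck2_pd[OF f that] that]]) auto
  ultimately show ?thesis
    unfolding laplacian_def by (simp add: sum_distrib_left integral_sum)
qed

lemma uniformly_continuous_compact_support:
  fixes f :: "'a::euclidean_space \<Rightarrow> real"
  assumes f: "continuous_on UNIV f" and K: "compact K" "\<And>x. x \<notin> K \<Longrightarrow> f x = 0" and e: "e > 0"
  obtains d where "d > 0" "\<And>x y. norm y < d \<Longrightarrow> \<bar>f (x - y) - f x\<bar> < e"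
proof -
  obtain r where r: "\<And>x. x \<in> K \<Longrightarrow> norm x \<le> r"
    using compact_imp_bounded[OF K(1)] by (force simp: bounded_pos)
  have "uniformly_continuous_on (cball 0 (r + 1)) f"
    by (intro compact_uniformly_continuous continuous_on_subset[OF f]) auto
  then obtain d where d: "d > 0"
    "\<And>x x'. x \<in> cball 0 (r + 1) \<Longrightarrow> x' \<in> cball 0 (r + 1) \<Longrightarrow> dist x' x < d \<Longrightarrow> dist (f x') (f x) < e"
    unfolding uniformly_continuous_on_def using e by metis
  show ?thesis
  proof (rule that[of "min d 1"])
    fix x y :: 'a assume y: "norm y < min d 1"
    show "\<bar>f (x - y) - f x\<bar> < e"
    \<comment> \<open>If one of the two points is within radius r, both lie in the compact ball of
      radius r + 1; otherwise both values are 0.\<close>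
    proof (cases "norm x \<le> r \<or> norm (x - y) \<le> r")
      case True
      then have "norm x \<le> r + 1" "norm (x - y) \<le> r + 1"
        using norm_triangle_ineq4[of x y] norm_triangle_ineq[of "x - y" y] y by auto
      then show ?thesis using d(2)[of x "x - y"] y by (simp add: dist_norm norm_minus_commute[of y x])
    next
      case False
      then show ?thesis using r K(2) e by (metis abs_zero diff_self)
    qed
  qed (use d in auto)
qed

text \<open>The weight is a probability density concentrated on |y| < r, so the difference is an
  average of f(x - y) - f(x).\<close>

lemma convolution_near:
  fixes f g :: "'a::euclidean_space \<Rightarrow> real"
  assumes f: "continuous_on UNIV f" and g: "continuous_on UNIV g" "\<And>y. g y \<ge> 0"
    "\<And>y. norm y \<ge> r \<Longrightarrow> g y = 0" "integral (cbox a b) g = 1"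
    and e: "\<And>x y. norm y < r \<Longrightarrow> \<bar>f (x - y) - f x\<bar> \<le> e"
  shows "\<bar>integral (cbox a b) (\<lambda>y. g y * f (x - y)) - f x\<bar> \<le> e"
proof -
  have g': "continuous_on (cbox a b) g" using g(1) continuous_on_subset by blast
  have i1: "(\<lambda>y. g y * f (x - y)) integrable_on cbox a b"
    by (intro integrable_continuous continuous_intros g' continuous_on_compose2[OF f]) auto
  have i2: "g integrable_on cbox a b" by (rule integrable_continuous[OF g'])
  have "norm (integral (cbox a b) (\<lambda>y. g y * f (x - y) - g y * f x)) \<le> integral (cbox a b) (\<lambda>y. g y * e)"
  proof (rule integral_norm_bound_integral)
    fix y
    have "norm (g y * f (x - y) - g y * f x) = g y * \<bar>f (x - y) - f x\<bar>"
      using g(2)[of y] by (simp add: abs_mult flip: right_diff_distrib)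
    also have "\<dots> \<le> g y * e" using e[of y x] g(2)[of y] g(3)[of y]
      by (cases "norm y < r") (auto intro: mult_left_mono)
    finally show "norm (g y * f (x - y) - g y * f x) \<le> g y * e" .
  qed (use i1 i2 in \<open>auto intro!: integrable_diff integrable_on_mult_left\<close>)
  moreover have "integral (cbox a b) (\<lambda>y. g y * f (x - y) - g y * f x)
      = integral (cbox a b) (\<lambda>y. g y * f (x - y)) - f x"
    using i1 i2 g(4) by (simp add: Henstock_Kurzweil_Integration.integral_diff integrable_on_mult_left)
  ultimately show ?thesis using g(4) by simp
qed

section \<open>A smooth bump function and mollifiers\<close>

definition exp_inv :: "nat \<Rightarrow> real \<Rightarrow> real" where
  "exp_inv n t = (if t > 0 then inverse t ^ n * exp (- inverse t) else 0)"

text \<open>The index n closes the family under differentiation: the derivative of t^(-n) exp(-1/t),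
  extended by 0, is a combination of two further members. At t = 0 the quotient tends to 0 because
  s^(n+1) exp(-s) does as s = 1/t grows.\<close>

lemma DERIV_exp_inv:
  "(exp_inv n has_real_derivative exp_inv (n + 2) t - real n * exp_inv (n + 1) t) (at t)"
proof -
  consider "t > 0" | "t < 0" | "t = 0" by linarith
  then show ?thesis
  proof cases
    case 1
    have "((\<lambda>t. inverse t ^ n * exp (- inverse t)) has_real_derivative
      inverse t ^ (n + 2) * exp (- inverse t) - real n * (inverse t ^ (n + 1) * exp (- inverse t))) (at t)"
    proof -
      have "((\<lambda>t. inverse t ^ n) has_real_derivative - (real n * inverse t ^ (n + 1))) (at t)"
        using DERIV_power[OF DERIV_inverse, of t n UNIV] 1 by (cases n) (simp_all add: algebra_simps)
      moreover have "((\<lambda>t. exp (- inverse t)) has_real_derivative exp (- inverse t) * inverse t ^ 2) (at t)"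
        using 1 by (auto intro!: derivative_eq_intros simp: power2_eq_square)
      ultimately show ?thesis
        by (rule DERIV_mult[THEN DERIV_cong]) (simp add: algebra_simps power2_eq_square)
    qed
    then show ?thesis using 1
      by (auto simp: exp_inv_def[abs_def] intro: has_field_derivative_transform_within_open[where S="{0<..}"])
  next
    case 2
    have "((\<lambda>t. 0::real) has_real_derivative 0) (at t)" by simp
    from has_field_derivative_transform_within_open[OF this, of "{..<0}" "exp_inv n"] show ?thesis
      using 2 by (simp add: exp_inv_def)
  next
    case 3
    have "((\<lambda>s. s ^ (n + 1) / exp s) \<longlongrightarrow> 0) (at_top :: real filter)"
      by (rule tendsto_power_div_exp_0)
    then have "((\<lambda>t. inverse t ^ (n + 1) / exp (inverse t)) \<longlongrightarrow> 0) (at_right (0::real))"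
      by (rule filterlim_compose) (rule filterlim_inverse_at_top_right)
    then have r: "((\<lambda>t. (exp_inv n t - 0) / (t - 0)) \<longlongrightarrow> 0) (at_right 0)"
      by (rule Lim_transform_eventually)
        (auto simp: eventually_at_filter exp_inv_def exp_minus field_simps)
    have "((\<lambda>t. 0::real) \<longlongrightarrow> 0) (at_left (0::real))" by simp
    then have l: "((\<lambda>t. (exp_inv n t - 0) / (t - 0)) \<longlongrightarrow> 0) (at_left 0)"
      by (rule Lim_transform_eventually) (auto simp: eventually_at_filter exp_inv_def)
    have "((\<lambda>t. (exp_inv n t - 0) / (t - 0)) \<longlongrightarrow> 0) (at 0)"
      using l r by (rule filterlim_split_at)
    then show ?thesis using 3 by (simp add: has_field_derivative_iff exp_inv_def)
  qed
qed

lemma Ck_exp_inv: "Ck n f \<Longrightarrow> Ck n (\<lambda>x. exp_inv j (f x))"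
proof (induction n arbitrary: j)
  case 0
  have "continuous_on UNIV (exp_inv j)"
    using DERIV_exp_inv DERIV_isCont continuous_at_imp_continuous_on by blast
  with 0 show ?case by (auto intro: continuous_on_compose2)
next
  case (Suc n)
  have d: "f differentiable (at x)" for x using Suc.prems by simp
  have "pd b (\<lambda>x. exp_inv j (f x)) = (\<lambda>x. (exp_inv (j + 2) (f x) - real j * exp_inv (j + 1) (f x)) * pd b f x)" for b
    by (intro ext pd_compose_real d DERIV_exp_inv)
  moreover have "(\<lambda>x. exp_inv j (f x)) differentiable (at x)" for x
    by (intro differentiableI[OF has_derivative_compose_real[OF d DERIV_exp_inv]])
  ultimately show ?case using Suc Ck_SucD[OF Suc.prems] by (auto intro!: Ck_mult Ck_diff)
qed

text \<open>The classical bump exp(-1/(r^2 - |x|^2)) divided by its integral, which is positive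
  because continuity bounds the bump below on a small ball about 0.\<close>

lemma mollifier_exists:
  assumes r: "r > 0"
  obtains \<theta> :: "'a::euclidean_space \<Rightarrow> real"
  where "smooth \<theta>" "\<And>x. \<theta> x \<ge> 0" "\<And>x. norm x \<ge> r \<Longrightarrow> \<theta> x = 0" "(\<integral>x. \<theta> x \<partial>lborel) = 1"
proof -
  define \<beta> :: "'a \<Rightarrow> real" where "\<beta> x = exp_inv 0 (r\<^sup>2 - (norm x)\<^sup>2)" for x
  have ck: "Ck n \<beta>" for n unfolding \<beta>_def by (intro Ck_exp_inv Ck_diff Ck_norm_sq Ck_const)
  have c: "continuous_on UNIV \<beta>" by (rule Ck_imp_continuous[OF ck])
  have nn: "\<beta> x \<ge> 0" for x by (simp add: \<beta>_def exp_inv_def)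
  have z: "\<beta> x = 0" if "norm x \<ge> r" for x
    using power_mono[OF that, of 2] r by (simp add: \<beta>_def exp_inv_def not_less)
  have i: "integrable lborel \<beta>"
    by (rule integrable_compact_support[of "cball 0 r"]) (use z c in \<open>auto intro: continuous_on_subset\<close>)
  have pos0: "\<beta> 0 > 0" using r by (simp add: \<beta>_def exp_inv_def)
  then obtain d where d: "d > 0" "\<And>x. dist x 0 < d \<Longrightarrow> dist (\<beta> x) (\<beta> 0) < \<beta> 0 / 2"
    using c unfolding continuous_on_iff by (metis UNIV_I half_gt_zero)
  have "(\<integral>x. \<beta> 0 / 2 * indicator (ball (0::'a) d) x \<partial>lborel) \<le> (\<integral>x. \<beta> x \<partial>lborel)"
  proof (rule integral_mono)
    show "integrable lborel \<beta>" by (rule i)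
    show "integrable lborel (\<lambda>x::'a. \<beta> 0 / 2 * indicator (ball 0 d) x)"
      by (intro integrable_mult_right integrable_real_indicator) (use emeasure_lborel_cball_finite emeasure_lborel_ball_finite in auto)
    show "\<beta> 0 / 2 * indicator (ball 0 d) x \<le> \<beta> x" for x
      using d(2)[of x] nn[of x] by (auto simp: indicator_def dist_commute dist_real_def abs_if split: if_splits)
  qed
  moreover have "(\<integral>x. \<beta> 0 / 2 * indicator (ball (0::'a) d) x \<partial>lborel) > 0"
    using pos0 content_ball_pos[OF d(1), of "0::'a"] by simp
  ultimately have I: "(\<integral>x. \<beta> x \<partial>lborel) > 0" by linarith
  show ?thesis
  proof (rule that[of "\<lambda>x. 1 / (\<integral>x. \<beta> x \<partial>lborel) * \<beta> x"])
    show "smooth (\<lambda>x. 1 / (\<integral>x. \<beta> x \<partial>lborel) * \<beta> x)"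
      unfolding smooth_def by (intro allI Ck_mult Ck_const ck)
  qed (use nn z I in auto)
qed

section \<open>From smooth to C^2 test functions\<close>

lemma compact_thickening:
  fixes K :: "'a::euclidean_space set"
  assumes "compact K" "open G" "K \<subseteq> G"
  obtains r where "r > 0" "compact (\<Union>x\<in>K. cball x r)" "(\<Union>x\<in>K. cball x r) \<subseteq> G"
proof -
  obtain r where r: "r > 0" "(\<Union>x\<in>K. cball x r) \<subseteq> G"
    using compact_subset_open_imp_cball_epsilon_subset[OF assms] by blast
  \<comment> \<open>The thickening is the Minkowski sum with a closed ball, hence compact.\<close>
  have "(\<Union>x\<in>K. cball x r) = {x + y |x y. x \<in> K \<and> y \<in> cball 0 r}"
  proof (intro set_eqI iffI)
    fix z assume "z \<in> (\<Union>x\<in>K. cball x r)"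
    then obtain x where "x \<in> K" "norm (z - x) \<le> r" by (auto simp: dist_norm norm_minus_commute)
    then show "z \<in> {x + y |x y. x \<in> K \<and> y \<in> cball 0 r}"
      by (intro CollectI exI[of _ x] exI[of _ "z - x"]) auto
  next
    fix z assume "z \<in> {x + y |x y. x \<in> K \<and> y \<in> cball 0 r}"
    then obtain x y where "x \<in> K" "norm y \<le> r" "z = x + y" by auto
    then show "z \<in> (\<Union>x\<in>K. cball x r)" by (intro UN_I[of x]) (auto simp: dist_norm)
  qed
  then have "compact (\<Union>x\<in>K. cball x r)"
    using compact_sums[OF assms(1) compact_cball[of 0 r]] by simp
  with r show ?thesis by (intro that)
qed

text \<open>Mollifying \<open>f\<close> approximates both \<open>f\<close> and its Laplacian
  uniformly, with supports in one compact subset of \<open>G\<close> on which \<open>u\<close> and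
  \<open>w\<close> are integrable; so the identity passes to the limit.\<close>

lemma weak_identity_C2:
  fixes u w :: "'a::euclidean_space \<Rightarrow> real"
  assumes G: "open G" and u: "continuous_on G u" and w: "continuous_on G w"
    and weak: "\<And>\<phi>. smooth \<phi> \<Longrightarrow> compact (tsupp \<phi>) \<Longrightarrow> tsupp \<phi> \<subseteq> G \<Longrightarrow>
      (\<integral>x. - u x * laplacian \<phi> x + w x * \<phi> x \<partial>lebesgue) = 0"
    and f: "Ck 2 f" "compact (tsupp f)" "tsupp f \<subseteq> G"
  shows "(\<integral>x. - u x * laplacian f x + w x * f x \<partial>lborel) = 0"
proof -
  obtain r0 where r0: "r0 > 0" and K: "compact (\<Union>x\<in>tsupp f. cball x r0)" "(\<Union>x\<in>tsupp f. cball x r0) \<subseteq> G"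
    using compact_thickening[OF f(2) G f(3)] .
  define K where "K = (\<Union>x\<in>tsupp f. cball x r0)"
  note K = K[folded K_def]
  have sK: "tsupp f \<subseteq> K" using r0 by (force simp: K_def)
  have uK: "continuous_on K u" "continuous_on K w" using u w K(2) continuous_on_subset by blast+
  have cf: "continuous_on UNIV f" by (rule Ck_imp_continuous[OF f(1)])
  have cL: "continuous_on UNIV (laplacian f)" by (rule continuous_on_laplacian[OF f(1)])
  have int: "integrable lborel (\<lambda>x. - u x * laplacian \<phi> x + w x * \<phi> x)"
    if "Ck 2 \<phi>" "tsupp \<phi> \<subseteq> K" for \<phi>
  proof (rule integrable_compact_support[OF K(1)])
    show "continuous_on K (\<lambda>x. - u x * laplacian \<phi> x + w x * \<phi> x)"
      by (intro continuous_intros uK continuous_on_subset[OF continuous_on_laplacian[OF that(1)]]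
          continuous_on_subset[OF Ck_imp_continuous[OF that(1)]]) auto
    fix x assume "x \<notin> K"
    then have "x \<notin> tsupp \<phi>" using that(2) by auto
    then show "- u x * laplacian \<phi> x + w x * \<phi> x = 0"
      by (simp add: eq_0_outside_tsupp laplacian_eq_0_outside_tsupp)
  qed
  define M where "M = (\<integral>x. indicator K x * (\<bar>u x\<bar> + \<bar>w x\<bar>) \<partial>lborel)"
  have iM: "integrable lborel (\<lambda>x. indicator K x * (\<bar>u x\<bar> + \<bar>w x\<bar>))"
    using borel_integrable_compact[OF K(1) continuous_on_add[OF uK[THEN continuous_on_rabs]]] by simp
  let ?I = "\<lambda>\<phi>. \<integral>x. - u x * laplacian \<phi> x + w x * \<phi> x \<partial>lborel"
  obtain c :: 'a where c: "cball 0 1 \<subseteq> cbox (-c) c"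
    using bounded_subset_cbox_symmetric[OF bounded_cball[of "0::'a" 1]] by auto
  obtain c' :: 'a where c': "tsupp f \<subseteq> cbox (-c') c'"
    using bounded_subset_cbox_symmetric[OF compact_imp_bounded[OF f(2)]] by auto
  \<comment> \<open>The mollified function satisfies the identity exactly, so the defect for
    \<open>f\<close> is at most the uniform distance e times the fixed mass
    \<open>M\<close>.\<close>
  have small: "\<bar>?I f\<bar> \<le> e * M" if e: "e > 0" for e
  proof -
    obtain d1 where d1: "d1 > 0" "\<And>x y. norm y < d1 \<Longrightarrow> \<bar>f (x - y) - f x\<bar> < e"
      using uniformly_continuous_compact_support[OF cf f(2) eq_0_outside_tsupp[of _ f] e] by blast
    obtain d2 where d2: "d2 > 0" "\<And>x y. norm y < d2 \<Longrightarrow> \<bar>laplacian f (x - y) - laplacian f x\<bar> < e"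
      using uniformly_continuous_compact_support[OF cL f(2) laplacian_eq_0_outside_tsupp e] by blast
    \<comment> \<open>The bounds d1 and d2 give uniform closeness, r0 keeps the support of the
      mollified function in \<open>K\<close>, and 1 puts the mollifier inside the box
      \<open>cbox (-c) c\<close>.\<close>
    define r where "r = min (min d1 d2) (min r0 1)"
    have r: "r > 0" "r \<le> d1" "r \<le> d2" "r \<le> r0" "r \<le> 1" using d1(1) d2(1) r0 by (auto simp: r_def)
    obtain \<theta> :: "'a \<Rightarrow> real" where \<theta>: "smooth \<theta>" "\<And>x. \<theta> x \<ge> 0" "\<And>x. norm x \<ge> r \<Longrightarrow> \<theta> x = 0"
      "(\<integral>x. \<theta> x \<partial>lborel) = 1" using mollifier_exists[OF r(1)] by blast
    have c\<theta>: "continuous_on UNIV \<theta>" using \<theta>(1) Ck_imp_continuous by (auto simp: smooth_def)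
    have \<theta>0: "\<theta> y = 0" if "y \<notin> cbox (-c) c" for y
    proof -
      have "norm y > 1" using that c by (force simp: subset_iff)
      then show ?thesis using \<theta>(3)[of y] r(5) by simp
    qed
    have \<theta>1: "integral (cbox (-c) c) \<theta> = 1" using integral_cbox_eq_lborel[OF c\<theta> \<theta>0] \<theta>(4) by simp
    define \<phi> where "\<phi> x = integral (cbox (-c) c) (\<lambda>y. \<theta> y * f (x - y))" for x
    have g: "continuous_on (cbox (-c) c) \<theta>" using c\<theta> continuous_on_subset by blast
    \<comment> \<open>Reflecting the integration variable: the definition of \<open>\<phi>\<close>
      puts derivatives on \<open>f\<close> and yields the Laplacian, whereas this form puts them on
      the smooth \<open>\<theta>\<close> and shows that \<open>\<phi>\<close> is smooth.\<close>
    have swap: "\<phi> x = integral (cbox (-c') c') (\<lambda>y. f y * \<theta> (x - y))" for x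
    proof -
      have cc: "continuous_on UNIV (\<lambda>y. f y * \<theta> (x - y))" "continuous_on UNIV (\<lambda>y. \<theta> y * f (x - y))"
        by (intro continuous_intros cf c\<theta> continuous_on_compose2[OF cf] continuous_on_compose2[OF c\<theta>] | auto)+
      have "\<phi> x = (\<integral>y. \<theta> y * f (x - y) \<partial>lborel)" unfolding \<phi>_def
        by (rule integral_cbox_eq_lborel[OF cc(2)]) (use \<theta>0 in auto)
      also have "\<dots> = (\<integral>y. f ((-1) *\<^sub>R y + x) * \<theta> (x - ((-1) *\<^sub>R y + x)) \<partial>lborel)" by (simp add: mult.commute)
      also have "\<dots> = (\<integral>y. f y * \<theta> (x - y) \<partial>lborel)"
        using lborel_integral_affine[of "-1" "\<lambda>y. f y * \<theta> (x - y)" x] continuous_imp_borel[OF cc(1)] by simp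
      also have "\<dots> = integral (cbox (-c') c') (\<lambda>y. f y * \<theta> (x - y))"
        by (rule integral_cbox_eq_lborel[OF cc(1), symmetric]) (use c' eq_0_outside_tsupp[of _ f] in auto)
      finally show ?thesis .
    qed
    have sm: "smooth \<phi>" unfolding smooth_def swap[abs_def]
      using Ck_convolution[OF _ continuous_on_subset[OF cf]] \<theta>(1) by (auto simp: smooth_def)
    have \<phi>2: "Ck 2 \<phi>" using sm by (simp add: smooth_def)
    have \<phi>0: "\<phi> x = 0" if "x \<notin> K" for x
    proof -
      have "\<theta> y * f (x - y) = 0" for y
      proof (cases "norm y < r")
        case True
        then have "x - y \<notin> tsupp f" using that r(4) by (force simp: K_def dist_norm)
        then show ?thesis by (simp add: eq_0_outside_tsupp)
      qed (use \<theta>(3) in auto)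
      then have "(\<lambda>y. \<theta> y * f (x - y)) = (\<lambda>y. 0)" by blast
      then show ?thesis by (simp add: \<phi>_def)
    qed
    have s\<phi>: "compact (tsupp \<phi>)" "tsupp \<phi> \<subseteq> K" using compact_tsuppI[OF K(1) \<phi>0] by auto
    have "(\<integral>x. - u x * laplacian \<phi> x + w x * \<phi> x \<partial>lebesgue) = ?I \<phi>"
      by (rule integral_completion) (use int[OF \<phi>2 s\<phi>(2)] in auto)
    then have I0: "?I \<phi> = 0" using weak[OF sm s\<phi>(1)] s\<phi>(2) K(2) by simp
    have n1: "\<bar>\<phi> x - f x\<bar> \<le> e" for x unfolding \<phi>_def
      by (rule convolution_near[OF cf c\<theta> \<theta>(2,3) \<theta>1]) (use d1(2) r in \<open>auto intro: less_imp_le\<close>)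
    have n2: "\<bar>laplacian \<phi> x - laplacian f x\<bar> \<le> e" for x
      unfolding \<phi>_def laplacian_convolution[OF f(1) g]
      by (rule convolution_near[OF cL c\<theta> \<theta>(2,3) \<theta>1]) (use d2(2) r in \<open>auto intro: less_imp_le\<close>)
    have "?I f = ?I f - ?I \<phi>" using I0 by simp
    also have "\<dots> = (\<integral>x. (- u x * laplacian f x + w x * f x) - (- u x * laplacian \<phi> x + w x * \<phi> x) \<partial>lborel)"
      by (rule Bochner_Integration.integral_diff[symmetric]) (intro int f sK \<phi>2 s\<phi>)+
    also have "\<bar>\<dots>\<bar> \<le> (\<integral>x. e * (indicator K x * (\<bar>u x\<bar> + \<bar>w x\<bar>)) \<partial>lborel)"
    proof (rule order_trans[OF integral_abs_bound], rule integral_mono)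
      show "integrable lborel (\<lambda>x. \<bar>(- u x * laplacian f x + w x * f x) - (- u x * laplacian \<phi> x + w x * \<phi> x)\<bar>)"
        using int[OF f(1) sK] int[OF \<phi>2 s\<phi>(2)] by auto
      show "integrable lborel (\<lambda>x. e * (indicator K x * (\<bar>u x\<bar> + \<bar>w x\<bar>)))" using iM by simp
      fix x
      show "\<bar>(- u x * laplacian f x + w x * f x) - (- u x * laplacian \<phi> x + w x * \<phi> x)\<bar>
        \<le> e * (indicator K x * (\<bar>u x\<bar> + \<bar>w x\<bar>))"
      proof (cases "x \<in> K")
        case True
        have "\<bar>(- u x * laplacian f x + w x * f x) - (- u x * laplacian \<phi> x + w x * \<phi> x)\<bar>
          = \<bar>u x * (laplacian \<phi> x - laplacian f x) - w x * (\<phi> x - f x)\<bar>" by (simp add: algebra_simps)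
        also have "\<dots> \<le> \<bar>u x\<bar> * \<bar>laplacian \<phi> x - laplacian f x\<bar> + \<bar>w x\<bar> * \<bar>\<phi> x - f x\<bar>"
          by (rule order_trans[OF abs_triangle_ineq4]) (simp add: abs_mult)
        also have "\<dots> \<le> \<bar>u x\<bar> * e + \<bar>w x\<bar> * e"
          by (intro add_mono mult_left_mono n1 n2) auto
        finally show ?thesis using True by (simp add: algebra_simps)
      next
        case False
        then have "x \<notin> tsupp f" "x \<notin> tsupp \<phi>" using sK s\<phi> by auto
        then show ?thesis using False by (simp add: laplacian_eq_0_outside_tsupp eq_0_outside_tsupp)
      qed
    qed
    finally show ?thesis by (simp add: M_def)
  qed
  have M: "M \<ge> 0" unfolding M_def by (intro Bochner_Integration.integral_nonneg) auto
  have "\<bar>?I f\<bar> \<le> 0 + e" if "e > 0" for e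
  proof -
    have "e / (M + 1) * M \<le> e" using that M by (simp add: field_simps)
    then show ?thesis using small[of "e / (M + 1)"] that M by simp
  qed
  then have "\<bar>?I f\<bar> \<le> 0" by (rule field_le_epsilon)
  then show ?thesis by simp
qed

section \<open>Cut-off functions\<close>

lemma Ck2_compose_real:
  assumes "\<And>x. (g has_real_derivative g' (f x)) (at (f x))"
    and "\<And>x. (g' has_real_derivative g'' (f x)) (at (f x))"
    and "continuous_on (range f) g''" and "Ck 2 f"
  shows "Ck 2 (\<lambda>x. g (f x))"
proof -
  define G where "G j = (if j = 0 then g else if j = 1 then g' else g'')" for j :: nat
  have "Ck 2 (\<lambda>x. G 0 (f x))"
    by (rule Ck_compose_real) (use assms in \<open>auto simp: G_def less_2_cases_iff\<close>)
  then show ?thesis by (simp add: G_def)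
qed

lemma DERIV_max_power:
  fixes t :: real
  assumes "n \<ge> 2"
  shows "((\<lambda>t. max 0 t ^ n) has_real_derivative real n * max 0 t ^ (n - 1)) (at t)"
proof -
  consider "t > 0" | "t < 0" | "t = 0" by linarith
  then show ?thesis
  proof cases
    case 1
    have "((\<lambda>t. t ^ n) has_real_derivative real n * t ^ (n - 1)) (at t)"
      by (auto intro!: derivative_eq_intros)
    from has_field_derivative_transform_within_open[OF this, of "{0<..}" "\<lambda>t. max 0 t ^ n"]
    show ?thesis using 1 by simp
  next
    case 2
    have "((\<lambda>t. 0::real) has_real_derivative 0) (at t)" by simp
    from has_field_derivative_transform_within_open[OF this, of "{..<0}" "\<lambda>t. max 0 t ^ n"]
    show ?thesis using 2 assms by (simp add: power_0_left)
  next
    case 3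
    have "((\<lambda>t. max 0 t ^ (n - 1)) \<longlongrightarrow> max 0 0 ^ (n - 1)) (at (0::real))"
      by (intro tendsto_intros)
    moreover have "max 0 0 ^ (n - 1) = (0::real)" using assms by (simp add: power_0_left)
    ultimately have "((\<lambda>t. max 0 t ^ (n - 1)) \<longlongrightarrow> 0) (at (0::real))" by (simp only:)
    moreover have "max 0 t ^ (n - 1) = (max 0 t ^ n - 0) / (t - 0)" if "t \<noteq> 0" for t :: real
      using that assms by (cases "t > 0"; cases n) (auto simp: max_def)
    then have "eventually (\<lambda>t. max 0 t ^ (n - 1) = (max 0 t ^ n - 0) / (t - 0)) (at (0::real))"
      by (simp add: eventually_at_filter)
    ultimately have "((\<lambda>t. (max 0 t ^ n - 0) / (t - 0)) \<longlongrightarrow> 0) (at (0::real))"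
      by (rule Lim_transform_eventually)
    then show ?thesis using 3 assms by (simp add: has_field_derivative_iff power_0_left)
  qed
qed

text \<open>The cube is the lowest integer power of the positive part that is C^2; piecewise
  polynomial cut-offs therefore suffice.\<close>

lemma Ck2_max_cube:
  assumes "Ck 2 f"
  shows "Ck 2 (\<lambda>x. max 0 (f x) ^ 3)"
proof (rule Ck2_compose_real[OF _ _ _ assms])
  show "((\<lambda>t. max 0 t ^ 3) has_real_derivative 3 * max 0 (f x) ^ 2) (at (f x))" for x
    using DERIV_max_power[of 3 "f x"] by simp
  show "((\<lambda>t. 3 * max 0 t ^ 2) has_real_derivative 6 * max 0 (f x)) (at (f x))" for x
    using DERIV_cmult[OF DERIV_max_power[of 2 "f x"], of 3] by simp
qed (intro continuous_intros)

text \<open>Vanishes unless 1/4 < |z| < 2. On 1/2 \<le> |z| \<le> 1 the two factors are at least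
  3/16 and 3, so (16/9)^3 makes the value at least 1. Exceeding 1 does no harm, since the sum of the
  pieces is truncated at 1/2 in the end.\<close>

definition annulus_cut :: "'a::euclidean_space \<Rightarrow> real" where
  "annulus_cut z = (16/9)^3 * (max 0 ((norm z)\<^sup>2 - 1/16) ^ 3 * max 0 (4 - (norm z)\<^sup>2) ^ 3)"

text \<open>The growth at infinity is harmless: derivatives are needed only where the sum of all
  cut-offs is below 1/2, hence where |z| < 2.\<close>

definition exterior_cut :: "'a::euclidean_space \<Rightarrow> real" where
  "exterior_cut z = max 0 ((norm z)\<^sup>2 - 1) ^ 3"

lemma Ck2_annulus_cut: "Ck 2 annulus_cut"
  unfolding annulus_cut_def[abs_def]
  by (intro Ck_mult Ck_const Ck2_max_cube Ck_diff Ck_norm_sq)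

lemma Ck2_exterior_cut: "Ck 2 exterior_cut"
  unfolding exterior_cut_def[abs_def]
  by (intro Ck2_max_cube Ck_diff Ck_const Ck_norm_sq)

lemma annulus_cut_nonneg: "annulus_cut z \<ge> 0" by (simp add: annulus_cut_def)

lemma exterior_cut_nonneg: "exterior_cut z \<ge> 0" by (simp add: exterior_cut_def)

lemma annulus_cut_eq_0: "norm z \<le> 1/4 \<or> norm z \<ge> 2 \<Longrightarrow> annulus_cut z = 0"
  using power_mono[of "norm z" "1/4" 2] power_mono[of 2 "norm z" 2]
  by (auto simp: annulus_cut_def power2_eq_square)

lemma annulus_cut_ge_1:
  assumes "1/2 \<le> norm z" "norm z \<le> 1"
  shows "annulus_cut z \<ge> 1"
proof -
  have "(norm z)\<^sup>2 \<ge> (1/2)\<^sup>2" "(norm z)\<^sup>2 \<le> 1\<^sup>2"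
    using power_mono[of "1/2" "norm z" 2] power_mono[of "norm z" 1 2] assms by auto
  then have b: "(norm z)\<^sup>2 - 1/16 \<ge> 3/16" "4 - (norm z)\<^sup>2 \<ge> 3" by (auto simp: power2_eq_square)
  have "(3/16)^3 * 3^3 \<le> max 0 ((norm z)\<^sup>2 - 1/16) ^ 3 * max 0 (4 - (norm z)\<^sup>2) ^ 3"
    by (intro mult_mono power_mono) (use b in auto)
  from mult_left_mono[OF this, of "(16/9)^3"] show ?thesis
    by (simp add: annulus_cut_def power3_eq_cube)
qed

lemma exterior_cut_eq_0: "norm z \<le> 1 \<Longrightarrow> exterior_cut z = 0"
  using power_mono[of "norm z" 1 2] by (auto simp: exterior_cut_def)

lemma exterior_cut_ge_1: "norm z \<ge> 2 \<Longrightarrow> exterior_cut z \<ge> 1"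
  using power_mono[of 2 "norm z" 2] by (auto simp: exterior_cut_def)

lemma Ck2_bounded_on_compact:
  fixes f :: "'a::euclidean_space \<Rightarrow> real"
  assumes f: "Ck 2 f" and K: "compact K"
  obtains A where "A \<ge> 1" "\<And>x. x \<in> K \<Longrightarrow> \<bar>f x\<bar> \<le> A"
    "\<And>x i. x \<in> K \<Longrightarrow> i \<in> Basis \<Longrightarrow> \<bar>pd i f x\<bar> \<le> A"
    "\<And>x i. x \<in> K \<Longrightarrow> i \<in> Basis \<Longrightarrow> \<bar>pd i (pd i f) x\<bar> \<le> A"
proof -
  define s where "s x = \<bar>f x\<bar> + (\<Sum>i\<in>Basis. \<bar>pd i f x\<bar>) + (\<Sum>i\<in>Basis. \<bar>pd i (pd i f) x\<bar>)" for x
  have c: "continuous_on UNIV f" "\<And>i. i \<in> Basis \<Longrightarrow> continuous_on UNIV (pd i f)"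
     "\<And>i. i \<in> Basis \<Longrightarrow> continuous_on UNIV (pd i (pd i f))"
    using Ck_imp_continuous[OF f] Ck_imp_continuous[OF Ck2_pd[OF f]] Ck1_continuous_pd[OF Ck2_pd[OF f]]
    by auto
  have "continuous_on UNIV s" unfolding s_def by (intro continuous_intros c)
  then have "bounded (s ` K)"
    by (intro compact_imp_bounded compact_continuous_image K) (rule continuous_on_subset, auto)
  then obtain A where A: "\<And>x. x \<in> K \<Longrightarrow> \<bar>s x\<bar> \<le> A" unfolding bounded_iff by auto
  have le: "\<bar>f x\<bar> \<le> s x" "i \<in> Basis \<Longrightarrow> \<bar>pd i f x\<bar> \<le> s x" "i \<in> Basis \<Longrightarrow> \<bar>pd i (pd i f) x\<bar> \<le> s x" for x i :: 'a
  proof -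
    have n: "(\<Sum>i\<in>Basis. \<bar>pd i f x\<bar>) \<ge> 0" "(\<Sum>i\<in>Basis. \<bar>pd i (pd i f) x\<bar>) \<ge> 0"
      by (intro sum_nonneg; simp)+
    then show "\<bar>f x\<bar> \<le> s x" unfolding s_def by linarith
    assume i: "i \<in> Basis"
    have "\<bar>pd i f x\<bar> \<le> (\<Sum>i\<in>Basis. \<bar>pd i f x\<bar>)"
      by (rule member_le_sum[OF i]) auto
    then show "\<bar>pd i f x\<bar> \<le> s x" using n unfolding s_def by linarith
    have "\<bar>pd i (pd i f) x\<bar> \<le> (\<Sum>i\<in>Basis. \<bar>pd i (pd i f) x\<bar>)"
      by (rule member_le_sum[OF i]) auto
    then show "\<bar>pd i (pd i f) x\<bar> \<le> s x" using n unfolding s_def by linarith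
  qed
  show ?thesis
  proof (rule that[of "max A 1"])
    fix x i :: 'a assume "x \<in> K"
    then have *: "s x \<le> max A 1" using A[of x] by simp
    show "\<bar>f x\<bar> \<le> max A 1" using le(1)[of x] * by linarith
    assume "i \<in> Basis"
    show "\<bar>pd i f x\<bar> \<le> max A 1" using le(2)[OF \<open>i \<in> Basis\<close>, of x] * by linarith
    show "\<bar>pd i (pd i f) x\<bar> \<le> max A 1" using le(3)[OF \<open>i \<in> Basis\<close>, of x] * by linarith
  qed simp
qed

section \<open>Jets of the cut-offs and their behaviour under dilation\<close>

lemma pd_pd_affine:
  fixes f :: "'a::euclidean_space \<Rightarrow> real"
  assumes "Ck 2 f" "i \<in> Basis"
  shows "pd i (\<lambda>x. f (c *\<^sub>R x + a)) x = c * pd i f (c *\<^sub>R x + a)"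
    "pd i (pd i (\<lambda>x. f (c *\<^sub>R x + a))) x = c\<^sup>2 * pd i (pd i f) (c *\<^sub>R x + a)"
proof -
  have d: "f differentiable (at x)" "pd i f differentiable (at x)" for x
    using Ck_differentiable[OF assms(1)] Ck_differentiable[OF Ck2_pd[OF assms]] by auto
  have eq: "pd i (\<lambda>x. f (c *\<^sub>R x + a)) = (\<lambda>x. c * pd i f (c *\<^sub>R x + a))"
    by (intro ext pd_affine d)
  show "pd i (\<lambda>x. f (c *\<^sub>R x + a)) x = c * pd i f (c *\<^sub>R x + a)" by (simp add: eq)
  show "pd i (pd i (\<lambda>x. f (c *\<^sub>R x + a))) x = c\<^sup>2 * pd i (pd i f) (c *\<^sub>R x + a)"
    unfolding eq
    by (subst pd_mult)
      (auto simp: pd_affine d power2_eq_square intro!: differentiableI[OF has_derivative_affine])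
qed

text \<open>The squares of the first derivatives come from differentiating a power of the cut-off
  twice; the terms of order 0 and 1 come from the product with \<open>annulus_cut\<close>. Mixed
  second derivatives do not occur in a Laplacian.\<close>

definition jet_size :: "('a::euclidean_space \<Rightarrow> real) \<Rightarrow> 'a \<Rightarrow> real" where
  "jet_size \<eta> z = \<bar>\<eta> z\<bar> + (\<Sum>i\<in>Basis. \<bar>pd i \<eta> z\<bar>) + (\<Sum>i\<in>Basis. (pd i \<eta> z)\<^sup>2)
    + (\<Sum>i\<in>Basis. \<bar>pd i (pd i \<eta>) z\<bar>)"

lemma jet_size_ge:
  shows "i \<in> Basis \<Longrightarrow> \<bar>\<eta> z\<bar> + \<bar>pd i \<eta> z\<bar> \<le> jet_size \<eta> z"
    "i \<in> Basis \<Longrightarrow> \<bar>\<eta> z\<bar> + (pd i \<eta> z)\<^sup>2 \<le> jet_size \<eta> z"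
    "i \<in> Basis \<Longrightarrow> \<bar>\<eta> z\<bar> + \<bar>pd i \<eta> z\<bar> + \<bar>pd i (pd i \<eta>) z\<bar> \<le> jet_size \<eta> z"
    "0 \<le> jet_size \<eta> z"
proof -
  have n: "(\<Sum>i\<in>Basis. \<bar>pd i \<eta> z\<bar>) \<ge> 0" "(\<Sum>i\<in>Basis. (pd i \<eta> z)\<^sup>2) \<ge> 0"
    "(\<Sum>i\<in>Basis. \<bar>pd i (pd i \<eta>) z\<bar>) \<ge> 0"
    by (intro sum_nonneg; simp)+
  then show "0 \<le> jet_size \<eta> z" unfolding jet_size_def by linarith
  assume i: "i \<in> Basis"
  have "\<bar>pd i \<eta> z\<bar> \<le> (\<Sum>i\<in>Basis. \<bar>pd i \<eta> z\<bar>)" "(pd i \<eta> z)\<^sup>2 \<le> (\<Sum>i\<in>Basis. (pd i \<eta> z)\<^sup>2)"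
    "\<bar>pd i (pd i \<eta>) z\<bar> \<le> (\<Sum>i\<in>Basis. \<bar>pd i (pd i \<eta>) z\<bar>)"
    using i by (auto intro!: member_le_sum[of _ _ "\<lambda>i. \<bar>pd i \<eta> z\<bar>"]
        member_le_sum[of _ _ "\<lambda>i. (pd i \<eta> z)\<^sup>2"] member_le_sum[of _ _ "\<lambda>i. \<bar>pd i (pd i \<eta>) z\<bar>"])
  with n show "\<bar>\<eta> z\<bar> + \<bar>pd i \<eta> z\<bar> \<le> jet_size \<eta> z" "\<bar>\<eta> z\<bar> + (pd i \<eta> z)\<^sup>2 \<le> jet_size \<eta> z"
    "\<bar>\<eta> z\<bar> + \<bar>pd i \<eta> z\<bar> + \<bar>pd i (pd i \<eta>) z\<bar> \<le> jet_size \<eta> z"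
    unfolding jet_size_def by linarith+
qed

lemma continuous_on_jet_size:
  assumes f: "Ck 2 \<eta>"
  shows "continuous_on UNIV (jet_size \<eta>)"
proof -
  have "continuous_on UNIV \<eta>" "\<And>i. i \<in> Basis \<Longrightarrow> continuous_on UNIV (pd i \<eta>)"
     "\<And>i. i \<in> Basis \<Longrightarrow> continuous_on UNIV (pd i (pd i \<eta>))"
    using Ck_imp_continuous[OF f] Ck_imp_continuous[OF Ck2_pd[OF f]] Ck1_continuous_pd[OF Ck2_pd[OF f]]
    by auto
  then show ?thesis unfolding jet_size_def[abs_def] by (intro continuous_intros)
qed

lemma jet_size_eq_0: "z \<notin> tsupp \<eta> \<Longrightarrow> jet_size \<eta> z = 0"
proof -
  assume z: "z \<notin> tsupp \<eta>"
  then have "z \<notin> tsupp (pd i \<eta>)" for i using tsupp_pd[of i \<eta>] by auto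
  from pd_eq_0_outside_tsupp[OF this] pd_eq_0_outside_tsupp[OF z] eq_0_outside_tsupp[OF z]
  show ?thesis by (simp add: jet_size_def)
qed

text \<open>Squared first derivatives and second derivatives both scale like c^2 under a dilation by
  c, so a single density \<open>P\<close> can govern all three quantities and is merely transported
  by the dilation.\<close>

definition jet_bound :: "('a::euclidean_space \<Rightarrow> real) \<Rightarrow> real \<Rightarrow> real \<Rightarrow> 'a \<Rightarrow> bool" where
  "jet_bound \<zeta> c P y \<longleftrightarrow> (\<forall>i\<in>Basis. \<bar>pd i \<zeta> y\<bar> \<le> c * P \<and> (pd i \<zeta> y)\<^sup>2 \<le> c\<^sup>2 * P
    \<and> \<bar>pd i (pd i \<zeta>) y\<bar> \<le> c\<^sup>2 * P)"

lemma jet_bound_affine: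
  fixes \<zeta> :: "'a::euclidean_space \<Rightarrow> real"
  assumes "Ck 2 \<zeta>" "c > 0" "jet_bound \<zeta> 1 P (c *\<^sub>R y + a)"
  shows "jet_bound (\<lambda>y. \<zeta> (c *\<^sub>R y + a)) c P y"
  using assms(2,3) unfolding jet_bound_def
  by (auto simp: pd_pd_affine[OF assms(1)] abs_mult power_mult_distrib)

lemma jet_bound_outside_tsupp: "y \<notin> tsupp \<zeta> \<Longrightarrow> P \<ge> 0 \<Longrightarrow> c \<ge> 0 \<Longrightarrow> jet_bound \<zeta> c P y"
proof -
  assume z: "y \<notin> tsupp \<zeta>" and P: "P \<ge> 0" "c \<ge> 0"
  then have "y \<notin> tsupp (pd i \<zeta>)" for i using tsupp_pd[of i \<zeta>] by auto
  from pd_eq_0_outside_tsupp[OF this] pd_eq_0_outside_tsupp[OF z] P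
  show ?thesis by (simp add: jet_bound_def)
qed

text \<open>Here c is the reciprocal of the scale. For c = 2^m this is the dyadic annulus of index m
  enlarged by a factor 2 on each side, to match the support of the rescaled
  \<open>annulus_cut\<close>.\<close>

definition annulus :: "'a::euclidean_space \<Rightarrow> real \<Rightarrow> 'a set" where
  "annulus x c = {y. 1/4 \<le> c * dist y x \<and> c * dist y x \<le> 2}"

lemma annulus_rescale:
  fixes x y :: "'a::euclidean_space"
  shows "c > 0 \<Longrightarrow> y \<in> annulus x c \<longleftrightarrow> 1/4 \<le> norm (c *\<^sub>R y + - (c *\<^sub>R x)) \<and> norm (c *\<^sub>R y + - (c *\<^sub>R x)) \<le> 2"
proof -
  assume c: "c > 0"
  have "norm (c *\<^sub>R y + - (c *\<^sub>R x)) = c * dist y x"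
    using c by (simp add: dist_norm flip: scaleR_diff_right)
  then show ?thesis by (simp add: annulus_def)
qed

lemma compact_annulus:
  fixes x :: "'a::euclidean_space"
  assumes "c > 0"
  shows "compact (annulus x c)"
proof -
  have "closed (annulus x c)" unfolding annulus_def
    by (intro closed_Collect_conj closed_Collect_le continuous_intros)
  moreover have "annulus x c \<subseteq> cball x (2 / c)"
    using assms by (auto simp: annulus_def dist_commute field_simps)
  ultimately show ?thesis using bounded_subset[OF bounded_cball] compact_eq_bounded_closed by blast
qed

text \<open>The bounds hold with the jet of \<open>\<eta>\<close> itself because $0 \le \eta \le 1$ gives
  $\eta^2 \le \eta$ in the square of the first derivatives.\<close>

lemma annulus_piece_jet:
  obtains B where "B \<ge> 1" "\<And>(\<eta> :: 'a::euclidean_space \<Rightarrow> real) c x y. Ck 2 \<eta> \<Longrightarrow> (\<And>z. 0 \<le> \<eta> z \<and> \<eta> z \<le> 1) \<Longrightarrow> c > 0 \<Longrightarrow>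
    jet_bound (\<lambda>y. annulus_cut (c *\<^sub>R y + - (c *\<^sub>R x)) * \<eta> (c *\<^sub>R y)) c
      (indicator (annulus x c) y * (B * jet_size \<eta> (c *\<^sub>R y))) y"
proof -
  obtain A where A: "A \<ge> 1" and A': "\<And>x::'a. x \<in> cball 0 2 \<Longrightarrow> \<bar>annulus_cut x\<bar> \<le> A"
    "\<And>(x::'a) i. x \<in> cball 0 2 \<Longrightarrow> i \<in> Basis \<Longrightarrow> \<bar>pd i annulus_cut x\<bar> \<le> A"
    "\<And>(x::'a) i. x \<in> cball 0 2 \<Longrightarrow> i \<in> Basis \<Longrightarrow> \<bar>pd i (pd i annulus_cut) x\<bar> \<le> A"
    using Ck2_bounded_on_compact[OF Ck2_annulus_cut compact_cball[of "0::'a" 2]] by blast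
  \<comment> \<open>Covers the constants A, 2 A^2 and 2 A of the three estimates below, because A
    \<ge> 1.\<close>
  define B where "B = 2 * A * A"
  have AB: "A \<le> B" "2 * A \<le> B" using A mult_mono[of 1 A A A] by (auto simp: B_def)
  show ?thesis
  proof (rule that[of B])
    show "B \<ge> 1" using A AB by linarith
    fix \<eta> :: "'a \<Rightarrow> real" and c :: real and x y :: 'a
    assume \<eta>: "Ck 2 \<eta>" and rg: "\<And>z. 0 \<le> \<eta> z \<and> \<eta> z \<le> 1" and c: "c > 0"
    define a where "a = - (c *\<^sub>R x)"
    define \<kappa> where "\<kappa> z = annulus_cut (1 *\<^sub>R z + a)" for z
    define g where "g z = \<kappa> z * \<eta> z" for z
    have \<kappa>: "Ck 2 \<kappa>" unfolding \<kappa>_def by (rule Ck_affine[OF Ck2_annulus_cut])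
    have gC: "Ck 2 g" unfolding g_def by (rule Ck_mult[OF \<kappa> \<eta>])
    have eq: "(\<lambda>y. annulus_cut (c *\<^sub>R y + - (c *\<^sub>R x)) * \<eta> (c *\<^sub>R y)) = (\<lambda>y. g (c *\<^sub>R y + 0))"
      by (simp add: g_def \<kappa>_def a_def)
    define z where "z = c *\<^sub>R y + 0"
    have "jet_bound g 1 (indicator (annulus x c) y * (B * jet_size \<eta> z)) z"
    proof (cases "y \<in> annulus x c")
      case False
      \<comment> \<open>\<open>K\<close> is a closed shell containing the support of
        \<open>g\<close>; a point outside it has a neighbourhood on which \<open>g\<close> is 0, so
        its derivatives vanish there too.\<close>
      define K where "K = cball (-a) 2 - ball (-a) (1/4)"
      have dK: "dist (-a) w = norm (w + a)" for w
        by (simp add: dist_norm norm_minus_commute flip: norm_minus_cancel[of "- a - w"])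
      have K: "g w = 0" if "w \<notin> K" for w
        using that annulus_cut_eq_0[of "w + a"] by (auto simp: g_def \<kappa>_def K_def dK)
      have "z \<notin> K"
        using False c annulus_rescale[of c y x] by (auto simp: z_def a_def[symmetric] K_def dK)
      moreover have "compact K" unfolding K_def by (intro compact_diff) auto
      then have "tsupp g \<subseteq> K" using K by (rule compact_tsuppI(2))
      ultimately have "z \<notin> tsupp g" by auto
      then show ?thesis by (rule jet_bound_outside_tsupp) (use False in auto)
    next
      case True
      have za: "1 *\<^sub>R z + a \<in> cball 0 2"
        using True annulus_rescale[OF c, of y x] by (simp add: z_def a_def)
      have d: "\<kappa> differentiable (at w)" "\<eta> differentiable (at w)" for w
        using Ck_differentiable[OF \<kappa>] Ck_differentiable[OF \<eta>] by auto
      have b0: "\<bar>\<kappa> z\<bar> \<le> A" using A'(1)[OF za] by (simp add: \<kappa>_def)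
      have "\<bar>pd i g z\<bar> \<le> B * jet_size \<eta> z \<and> (pd i g z)\<^sup>2 \<le> B * jet_size \<eta> z
          \<and> \<bar>pd i (pd i g) z\<bar> \<le> B * jet_size \<eta> z" if i: "i \<in> Basis" for i
      proof (intro conjI)
        have b1: "\<bar>pd i \<kappa> z\<bar> \<le> A" using A'(2)[OF za i]
          by (simp add: \<kappa>_def[abs_def] pd_pd_affine(1)[OF Ck2_annulus_cut i, of 1, simplified])
        have b2: "\<bar>pd i (pd i \<kappa>) z\<bar> \<le> A" using A'(3)[OF za i]
          by (simp add: \<kappa>_def[abs_def] pd_pd_affine(2)[OF Ck2_annulus_cut i, of 1, simplified])
        have p1: "pd i g z = pd i \<kappa> z * \<eta> z + \<kappa> z * pd i \<eta> z"
          unfolding g_def by (rule pd_mult[OF d])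
        have l1: "\<bar>pd i g z\<bar> \<le> A * (\<bar>\<eta> z\<bar> + \<bar>pd i \<eta> z\<bar>)"
        proof -
          have "\<bar>pd i g z\<bar> \<le> \<bar>pd i \<kappa> z\<bar> * \<bar>\<eta> z\<bar> + \<bar>\<kappa> z\<bar> * \<bar>pd i \<eta> z\<bar>"
            unfolding p1 by (rule order_trans[OF abs_triangle_ineq]) (simp add: abs_mult)
          also have "\<dots> \<le> A * \<bar>\<eta> z\<bar> + A * \<bar>pd i \<eta> z\<bar>"
            by (intro add_mono mult_right_mono b0 b1) auto
          finally show ?thesis by (simp add: algebra_simps)
        qed
        also have "\<dots> \<le> B * jet_size \<eta> z"
          by (intro mult_mono AB jet_size_ge i) (use A AB in auto)
        finally show "\<bar>pd i g z\<bar> \<le> B * jet_size \<eta> z" .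
        have "(pd i g z)\<^sup>2 \<le> (A * (\<bar>\<eta> z\<bar> + \<bar>pd i \<eta> z\<bar>))\<^sup>2"
          using l1 by (simp add: abs_le_square_iff[symmetric])
        also have "\<dots> = A * A * (\<bar>\<eta> z\<bar> + \<bar>pd i \<eta> z\<bar>)\<^sup>2" by (simp add: power2_eq_square)
        also have "\<dots> \<le> A * A * (2 * (\<bar>\<eta> z\<bar> + (pd i \<eta> z)\<^sup>2))"
        proof (rule mult_left_mono)
          have "(\<bar>\<eta> z\<bar> + \<bar>pd i \<eta> z\<bar>)\<^sup>2 \<le> 2 * (\<eta> z)\<^sup>2 + 2 * (pd i \<eta> z)\<^sup>2"
            using sum_squares_bound[of "\<bar>\<eta> z\<bar>" "\<bar>pd i \<eta> z\<bar>"] by (simp add: power2_sum)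
          moreover have "(\<eta> z)\<^sup>2 \<le> \<bar>\<eta> z\<bar>"
            using rg[of z] mult_left_le[of "\<eta> z" "\<eta> z"] by (simp add: power2_eq_square)
          ultimately show "(\<bar>\<eta> z\<bar> + \<bar>pd i \<eta> z\<bar>)\<^sup>2 \<le> 2 * (\<bar>\<eta> z\<bar> + (pd i \<eta> z)\<^sup>2)" by simp
        qed (use A in auto)
        also have "\<dots> = B * (\<bar>\<eta> z\<bar> + (pd i \<eta> z)\<^sup>2)" by (simp add: B_def)
        also have "\<dots> \<le> B * jet_size \<eta> z"
          by (intro mult_left_mono jet_size_ge i) (use A AB in auto)
        finally show "(pd i g z)\<^sup>2 \<le> B * jet_size \<eta> z" .
        have p2: "pd i (pd i g) z = pd i (pd i \<kappa>) z * \<eta> z + 2 * pd i \<kappa> z * pd i \<eta> z + \<kappa> z * pd i (pd i \<eta>) z"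
          unfolding g_def by (rule pd_pd_mult[OF \<kappa> \<eta> i])
        have "\<bar>pd i (pd i g) z\<bar> \<le> \<bar>pd i (pd i \<kappa>) z * \<eta> z\<bar> + \<bar>2 * pd i \<kappa> z * pd i \<eta> z\<bar> + \<bar>\<kappa> z * pd i (pd i \<eta>) z\<bar>"
          unfolding p2 by linarith
        also have "\<dots> = \<bar>pd i (pd i \<kappa>) z\<bar> * \<bar>\<eta> z\<bar> + 2 * (\<bar>pd i \<kappa> z\<bar> * \<bar>pd i \<eta> z\<bar>) + \<bar>\<kappa> z\<bar> * \<bar>pd i (pd i \<eta>) z\<bar>"
          by (simp add: abs_mult)
        also have "\<dots> \<le> A * \<bar>\<eta> z\<bar> + 2 * (A * \<bar>pd i \<eta> z\<bar>) + A * \<bar>pd i (pd i \<eta>) z\<bar>"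
          by (intro add_mono mult_right_mono mult_left_mono b0 b1 b2) auto
        also have "\<dots> \<le> 2 * A * (\<bar>\<eta> z\<bar> + \<bar>pd i \<eta> z\<bar> + \<bar>pd i (pd i \<eta>) z\<bar>)"
          using A by (simp add: algebra_simps)
        also have "\<dots> \<le> B * jet_size \<eta> z"
          by (intro mult_mono AB jet_size_ge i) (use A AB in auto)
        finally show "\<bar>pd i (pd i g) z\<bar> \<le> B * jet_size \<eta> z" .
      qed
      then show ?thesis using True by (simp add: jet_bound_def)
    qed
    from jet_bound_affine[OF gC c this[unfolded z_def]] 
    show "jet_bound (\<lambda>y. annulus_cut (c *\<^sub>R y + - (c *\<^sub>R x)) * \<eta> (c *\<^sub>R y)) c
      (indicator (annulus x c) y * (B * jet_size \<eta> (c *\<^sub>R y))) y"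
      unfolding eq by simp
  qed
qed

text \<open>A constant density on the annulus is enough, because the cut-off is identically 0 around
  the inner hole. The restriction c * dist \<le> 2 keeps the argument in a compact ball, on which
  the jets are bounded.\<close>

lemma exterior_piece_jet:
  obtains B where "B \<ge> 1" "\<And>c (x::'a::euclidean_space) y. c > 0 \<Longrightarrow> c * dist y x \<le> 2 \<Longrightarrow>
    jet_bound (\<lambda>y. exterior_cut (c *\<^sub>R y + - (c *\<^sub>R x))) c (indicator (annulus x c) y * B) y"
proof -
  obtain A where A: "A \<ge> 1" and "\<And>x::'a. x \<in> cball 0 2 \<Longrightarrow> \<bar>exterior_cut x\<bar> \<le> A"
    and A': "\<And>(x::'a) i. x \<in> cball 0 2 \<Longrightarrow> i \<in> Basis \<Longrightarrow> \<bar>pd i exterior_cut x\<bar> \<le> A"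
    "\<And>(x::'a) i. x \<in> cball 0 2 \<Longrightarrow> i \<in> Basis \<Longrightarrow> \<bar>pd i (pd i exterior_cut) x\<bar> \<le> A"
    using Ck2_bounded_on_compact[OF Ck2_exterior_cut compact_cball[of "0::'a" 2]] by blast
  show ?thesis
  proof (rule that[of "A * A"])
    have AA: "A \<le> A * A" using A by simp
    show "A * A \<ge> 1" using A AA by linarith
    fix c and x y :: 'a assume c: "c > 0" and y: "c * dist y x \<le> 2"
    define a where "a = - (c *\<^sub>R x)"
    define z where "z = c *\<^sub>R y + a"
    have nz: "norm z = c * dist y x"
      using c by (simp add: z_def a_def dist_norm flip: scaleR_diff_right)
    have "jet_bound exterior_cut 1 (indicator (annulus x c) y * (A * A)) z"
    proof (cases "y \<in> annulus x c")
      case True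
      have z: "z \<in> cball 0 2" using nz y by simp
      have "\<bar>pd i exterior_cut z\<bar> \<le> A * A \<and> (pd i exterior_cut z)\<^sup>2 \<le> A * A
          \<and> \<bar>pd i (pd i exterior_cut) z\<bar> \<le> A * A" if i: "i \<in> Basis" for i
        using A'(1)[OF z i] A'(2)[OF z i] AA abs_le_square_iff[of "pd i exterior_cut z" A] A
        by (auto simp: power2_eq_square intro: order_trans)
      then show ?thesis using True by (simp add: jet_bound_def)
    next
      case False
      then have "norm z < 1/4" using nz y by (auto simp: annulus_def)
      moreover have "tsupp (exterior_cut :: 'a \<Rightarrow> real) \<subseteq> - ball 0 1" unfolding tsupp_def
        by (rule closure_minimal) (use exterior_cut_eq_0 in \<open>force simp: not_less\<close>, auto)
      ultimately have "z \<notin> tsupp exterior_cut" by auto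
      then show ?thesis by (rule jet_bound_outside_tsupp) (use False in auto)
    qed
    from jet_bound_affine[OF Ck2_exterior_cut c this[unfolded z_def]]
    show "jet_bound (\<lambda>y. exterior_cut (c *\<^sub>R y + - (c *\<^sub>R x))) c (indicator (annulus x c) y * (A * A)) y"
      by (simp add: a_def)
  qed
qed

section \<open>Powers of sums and the capacity norm\<close>

text \<open>The sum is at most K times its largest term. Counting only the nonzero terms lets the
  bounded overlap of the annuli replace the total number of pieces.\<close>

lemma sum_powr_le:
  fixes a :: "'b \<Rightarrow> real"
  assumes "finite I" "\<And>i. i \<in> I \<Longrightarrow> a i \<ge> 0" "card {i\<in>I. a i \<noteq> 0} \<le> K" "p > 0"
  shows "(\<Sum>i\<in>I. a i) powr p \<le> real K powr p * (\<Sum>i\<in>I. a i powr p)"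
proof (cases "{i\<in>I. a i \<noteq> 0} = {}")
  case True
  then have "(\<Sum>i\<in>I. a i) = 0" by (intro sum.neutral) auto
  then show ?thesis by (simp add: sum_nonneg)
next
  case False
  define J where "J = {i\<in>I. a i \<noteq> 0}"
  have J: "finite J" "J \<noteq> {}" "J \<subseteq> I" using assms(1) False by (auto simp: J_def)
  define m where "m = Max (a ` J)"
  have "m \<in> a ` J" unfolding m_def by (rule Max_in) (use J in auto)
  then obtain j where j: "j \<in> J" "m = a j" by auto
  have "(\<Sum>i\<in>I. a i) = (\<Sum>i\<in>J. a i)"
    by (rule sum.mono_neutral_right[OF assms(1) J(3)]) (auto simp: J_def)
  also have "\<dots> \<le> real (card J) * m" using J by (intro sum_bounded_above) (auto simp: m_def)
  also have "\<dots> \<le> real K * m" using assms(2,3) j J by (intro mult_right_mono) (auto simp: J_def)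
  finally have "(\<Sum>i\<in>I. a i) powr p \<le> (real K * m) powr p"
    using assms by (intro powr_mono2 sum_nonneg) auto
  also have "\<dots> = real K powr p * a j powr p"
    using assms(2) j J by (auto simp: powr_mult)
  also have "a j powr p \<le> (\<Sum>i\<in>I. a i powr p)"
    using j J assms(1) by (intro member_le_sum) auto
  finally show ?thesis by (simp add: mult_left_mono)
qed

lemma sum_powr_le_card:
  fixes a :: "'b \<Rightarrow> real"
  assumes "finite I" "\<And>i. i \<in> I \<Longrightarrow> a i \<ge> 0" "p > 0"
  shows "(\<Sum>i\<in>I. a i) powr p \<le> real (card I) powr p * (\<Sum>i\<in>I. a i powr p)"
  by (rule sum_powr_le) (use assms in \<open>auto intro: card_mono\<close>)

lemma jet_size_powr_le:
  assumes "p > 0"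
  shows "jet_size \<eta> z powr p \<le> (4 * real DIM('a)) powr p * (\<bar>\<eta> z\<bar> powr p + (\<Sum>i\<in>Basis. \<bar>pd i \<eta> z\<bar> powr p)
    + (\<Sum>i\<in>Basis. \<bar>pd i \<eta> z\<bar> powr (2 * p)) + (\<Sum>i\<in>Basis. \<bar>pd i (pd i \<eta>) (z::'a::euclidean_space)\<bar> powr p))"
proof -
  define s where "s = (\<lambda>n::nat. if n = 0 then \<bar>\<eta> z\<bar> else if n = 1 then (\<Sum>i\<in>Basis. \<bar>pd i \<eta> z\<bar>)
    else if n = 2 then (\<Sum>i\<in>Basis. (pd i \<eta> z)\<^sup>2) else (\<Sum>i\<in>Basis. \<bar>pd i (pd i \<eta>) z\<bar>))"
  let ?N = "real DIM('a) powr p"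
  have N: "?N \<ge> 1" using DIM_positive[where 'a='a] assms by (intro ge_one_powr_ge_zero) auto
  have "jet_size \<eta> z = (\<Sum>n<4. s n)"
    by (simp add: jet_size_def s_def eval_nat_numeral)
  also have "\<dots> powr p \<le> real (card {..<4::nat}) powr p * (\<Sum>n<4. s n powr p)"
    by (rule sum_powr_le_card) (use assms in \<open>auto simp: s_def intro!: sum_nonneg\<close>)
  also have "(\<Sum>n<4. s n powr p) = s 0 powr p + s 1 powr p + s 2 powr p + s 3 powr p"
    by (simp add: eval_nat_numeral)
  also have "s 0 powr p \<le> ?N * \<bar>\<eta> z\<bar> powr p" using N by (simp add: s_def mult_le_cancel_right1)
  also have "s 1 powr p \<le> ?N * (\<Sum>i\<in>Basis. \<bar>pd i \<eta> z\<bar> powr p)"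
    unfolding s_def using sum_powr_le_card[of "Basis::'a set" "\<lambda>i. \<bar>pd i \<eta> z\<bar>" p] assms by simp
  also have "s 2 powr p \<le> ?N * (\<Sum>i\<in>Basis. ((pd i \<eta> z)\<^sup>2) powr p)"
    unfolding s_def using sum_powr_le_card[of "Basis::'a set" "\<lambda>i. (pd i \<eta> z)\<^sup>2" p] assms by simp
  also have "s 3 powr p \<le> ?N * (\<Sum>i\<in>Basis. \<bar>pd i (pd i \<eta>) z\<bar> powr p)"
    unfolding s_def using sum_powr_le_card[of "Basis::'a set" "\<lambda>i. \<bar>pd i (pd i \<eta>) z\<bar>" p] assms by simp
  also have "(\<lambda>i. ((pd i \<eta> z)\<^sup>2) powr p) = (\<lambda>i. \<bar>pd i \<eta> z\<bar> powr (2 * p))"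
  proof
    fix i
    have "(pd i \<eta> z)\<^sup>2 = \<bar>pd i \<eta> z\<bar> powr 2" by (simp add: powr_numeral)
    then show "((pd i \<eta> z)\<^sup>2) powr p = \<bar>pd i \<eta> z\<bar> powr (2 * p)" by (simp only: powr_powr)
  qed
  finally show ?thesis
    by (simp add: powr_mult distrib_left mult.assoc mult_left_mono)
qed

text \<open>The L^(2p) norms of the first derivatives are not part of the Sobolev norm;
  \<open>gagliardo_nirenberg\<close> trades each of them for a pure second derivative, using 0 \<le>
  \<eta> \<le> 1.\<close>

lemma jet_size_capacity:
  assumes p: "p > 1"
  obtains C where "C > 0" "\<And>\<eta> :: 'a::euclidean_space \<Rightarrow> real. Ck 2 \<eta> \<Longrightarrow> compact (tsupp \<eta>) \<Longrightarrow>
    (\<And>x. 0 \<le> \<eta> x \<and> \<eta> x \<le> 1) \<Longrightarrow> ennreal (\<integral>z. jet_size \<eta> z powr p \<partial>lborel) \<le> ennreal C * sob2_pow p \<eta>"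
proof -
  define D where "D = 2 * (2 * (2 * p - 1)) powr p"
  define C where "C = (4 * real DIM('a)) powr p * (1 + D)"
  have D: "D \<ge> 0" by (simp add: D_def)
  show ?thesis
  proof (rule that[of C])
    show "C > 0" unfolding C_def using D by (intro mult_pos_pos) (auto simp: add_pos_nonneg)
    fix \<eta> :: "'a \<Rightarrow> real"
    assume \<eta>: "Ck 2 \<eta>" and supp: "compact (tsupp \<eta>)" and rg: "\<And>x. 0 \<le> \<eta> x \<and> \<eta> x \<le> 1"
    have c: "continuous_on UNIV \<eta>" "\<And>i. i \<in> Basis \<Longrightarrow> continuous_on UNIV (pd i \<eta>)"
      "\<And>i. i \<in> Basis \<Longrightarrow> continuous_on UNIV (pd i (pd i \<eta>))"
      using Ck_imp_continuous[OF \<eta>] Ck_imp_continuous[OF Ck2_pd[OF \<eta>]] Ck1_continuous_pd[OF Ck2_pd[OF \<eta>]]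
      by auto
    have z: "\<eta> x = 0" "pd i \<eta> x = 0" "pd i (pd i \<eta>) x = 0" if "x \<notin> tsupp \<eta>" for x i
      using that tsupp_pd[of i \<eta>] pd_eq_0_outside_tsupp[OF that] eq_0_outside_tsupp[OF that]
        pd_eq_0_outside_tsupp[of x "pd i \<eta>"] by auto
    have int: "integrable lborel (\<lambda>x. \<bar>\<eta> x\<bar> powr p)"
      "\<And>i. i \<in> Basis \<Longrightarrow> integrable lborel (\<lambda>x. \<bar>pd i \<eta> x\<bar> powr p)"
      "\<And>i. i \<in> Basis \<Longrightarrow> integrable lborel (\<lambda>x. \<bar>pd i \<eta> x\<bar> powr (2 * p))"
      "\<And>i. i \<in> Basis \<Longrightarrow> integrable lborel (\<lambda>x. \<bar>pd i (pd i \<eta>) x\<bar> powr p)"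
      using p z by (auto intro!: integrable_tsupp[OF _ supp] continuous_on_abs_powr c)
    have ij: "integrable lborel (\<lambda>z. jet_size \<eta> z powr p)"
    proof (rule integrable_tsupp[OF _ supp])
      show "continuous_on UNIV (\<lambda>z. jet_size \<eta> z powr p)"
        using continuous_on_abs_powr[of p UNIV "jet_size \<eta>"] continuous_on_jet_size[OF \<eta>] p jet_size_ge(4)[of \<eta>]
        by simp
      show "jet_size \<eta> x powr p = 0" if "x \<notin> tsupp \<eta>" for x using jet_size_eq_0[OF that] by simp
    qed
    define I0 where "I0 = (\<integral>x. \<bar>\<eta> x\<bar> powr p \<partial>lborel)"
    define I1 where "I1 = (\<Sum>i\<in>Basis. \<integral>x. \<bar>pd i \<eta> x\<bar> powr p \<partial>lborel)"
    define I2 where "I2 = (\<Sum>i\<in>Basis. \<integral>x. \<bar>pd i (pd i \<eta>) x\<bar> powr p \<partial>lborel)"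
    have nn: "I0 \<ge> 0" "I1 \<ge> 0" "I2 \<ge> 0"
      unfolding I0_def I1_def I2_def by (auto intro!: sum_nonneg Bochner_Integration.integral_nonneg)
    have "(\<integral>z. jet_size \<eta> z powr p \<partial>lborel) \<le> (\<integral>z. (4 * real DIM('a)) powr p * (\<bar>\<eta> z\<bar> powr p + (\<Sum>i\<in>Basis. \<bar>pd i \<eta> z\<bar> powr p)
      + (\<Sum>i\<in>Basis. \<bar>pd i \<eta> z\<bar> powr (2 * p)) + (\<Sum>i\<in>Basis. \<bar>pd i (pd i \<eta>) z\<bar> powr p)) \<partial>lborel)"
    proof (rule integral_mono[OF ij])
      show "integrable lborel (\<lambda>z. (4 * real DIM('a)) powr p * (\<bar>\<eta> z\<bar> powr p + (\<Sum>i\<in>Basis. \<bar>pd i \<eta> z\<bar> powr p)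
      + (\<Sum>i\<in>Basis. \<bar>pd i \<eta> z\<bar> powr (2 * p)) + (\<Sum>i\<in>Basis. \<bar>pd i (pd i \<eta>) z\<bar> powr p)))"
        using int by (intro integrable_mult_right Bochner_Integration.integrable_add Bochner_Integration.integrable_sum) auto
      show "jet_size \<eta> z powr p \<le> (4 * real DIM('a)) powr p * (\<bar>\<eta> z\<bar> powr p + (\<Sum>i\<in>Basis. \<bar>pd i \<eta> z\<bar> powr p)
      + (\<Sum>i\<in>Basis. \<bar>pd i \<eta> z\<bar> powr (2 * p)) + (\<Sum>i\<in>Basis. \<bar>pd i (pd i \<eta>) z\<bar> powr p))" for z
        by (rule jet_size_powr_le) (use p in simp)
    qed
    also have "\<dots> = (4 * real DIM('a)) powr p * (I0 + I1 + (\<Sum>i\<in>Basis. \<integral>z. \<bar>pd i \<eta> z\<bar> powr (2 * p) \<partial>lborel) + I2)"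
      using int by (simp add: I0_def I1_def I2_def Bochner_Integration.integral_sum)
    also have "\<dots> \<le> (4 * real DIM('a)) powr p * (I0 + I1 + D * I2 + I2)"
    proof -
      have "(\<Sum>i\<in>Basis. \<integral>z. \<bar>pd i \<eta> z\<bar> powr (2 * p) \<partial>lborel) \<le> D * I2"
        unfolding I2_def sum_distrib_left D_def
        using rg by (intro sum_mono gagliardo_nirenberg p \<eta> supp) auto
      then show ?thesis by (intro mult_left_mono) auto
    qed
    also have "\<dots> \<le> C * (I0 + I1 + I2)"
    proof -
      have "I0 + I1 + D * I2 + I2 \<le> (1 + D) * (I0 + I1 + I2)" using nn D by (simp add: algebra_simps)
      then show ?thesis unfolding C_def mult.assoc by (intro mult_left_mono) auto
    qed
    finally have "ennreal (\<integral>z. jet_size \<eta> z powr p \<partial>lborel) \<le> ennreal (C * (I0 + I1 + I2))"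
      by (rule ennreal_leI)
    also have "\<dots> = ennreal C * (ennreal I0 + ennreal I1 + ennreal I2)"
      using nn \<open>C > 0\<close> by (simp add: ennreal_mult ennreal_plus)
    also have "\<dots> \<le> ennreal C * sob2_pow p \<eta>"
    proof -
      have e0: "ennreal I0 = (\<integral>\<^sup>+ x. ennreal (\<bar>\<eta> x\<bar> powr p) \<partial>lborel)"
        unfolding I0_def using int by (intro nn_integral_eq_integral[symmetric]) auto
      have "ennreal I1 = (\<Sum>i\<in>Basis. ennreal (\<integral>x. \<bar>pd i \<eta> x\<bar> powr p \<partial>lborel))"
        unfolding I1_def by (rule sum_ennreal[symmetric]) simp
      also have "\<dots> = (\<Sum>i\<in>Basis. \<integral>\<^sup>+ x. ennreal (\<bar>pd i \<eta> x\<bar> powr p) \<partial>lborel)"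
        using int(2) by (intro sum.cong refl nn_integral_eq_integral[symmetric]) auto
      finally have e1: "ennreal I1 = (\<Sum>i\<in>Basis. \<integral>\<^sup>+ x. ennreal (\<bar>pd i \<eta> x\<bar> powr p) \<partial>lborel)" .
      have "ennreal I2 = (\<Sum>i\<in>Basis. ennreal (\<integral>x. \<bar>pd i (pd i \<eta>) x\<bar> powr p \<partial>lborel))"
        unfolding I2_def by (rule sum_ennreal[symmetric]) simp
      also have "\<dots> = (\<Sum>i\<in>Basis. \<integral>\<^sup>+ x. ennreal (\<bar>pd i (pd i \<eta>) x\<bar> powr p) \<partial>lborel)"
        using int(4) by (intro sum.cong refl nn_integral_eq_integral[symmetric]) auto
      \<comment> \<open>The jets contain only pure second derivatives; the mixed ones of the Sobolev
        norm are nonnegative extra terms.\<close>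
      also have "\<dots> \<le> (\<Sum>i\<in>Basis. \<Sum>j\<in>Basis. \<integral>\<^sup>+ x. ennreal (\<bar>pd j (pd i \<eta>) x\<bar> powr p) \<partial>lborel)"
        by (intro sum_mono member_le_sum[of _ _ "\<lambda>j. \<integral>\<^sup>+ x. ennreal (\<bar>pd j (pd _ \<eta>) x\<bar> powr p) \<partial>lborel"]) auto
      finally show ?thesis unfolding sob2_pow_def e0 e1 by (intro mult_left_mono add_mono order_refl) auto
    qed
    finally show "ennreal (\<integral>z. jet_size \<eta> z powr p \<partial>lborel) \<le> ennreal C * sob2_pow p \<eta>" .
  qed
qed

section \<open>The regularised Newtonian kernel\<close>

lemma pd_dist_sq:
  fixes x :: "'a::euclidean_space"
  shows "pd i (\<lambda>y. (norm (y - x))\<^sup>2 + e) = (\<lambda>y. 2 * ((y - x) \<bullet> i))"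
proof
  fix y
  have "((\<lambda>y. (norm (y - x))\<^sup>2 + e) has_derivative (\<lambda>b. 2 * ((y - x) \<bullet> b))) (at y)"
    unfolding power2_norm_eq_inner by (auto intro!: derivative_eq_intros simp: inner_commute)
  then show "pd i (\<lambda>y. (norm (y - x))\<^sup>2 + e) y = 2 * ((y - x) \<bullet> i)" by (rule pd_eq)
qed

lemma pd_pd_dist_sq:
  fixes x :: "'a::euclidean_space"
  assumes "i \<in> Basis"
  shows "pd i (pd i (\<lambda>y. (norm (y - x))\<^sup>2 + e)) y = 2"
proof -
  have "((\<lambda>y. 2 * ((y - x) \<bullet> i)) has_derivative (\<lambda>b. 2 * (b \<bullet> i))) (at y)"
    by (auto intro!: derivative_eq_intros)
  from pd_eq[OF this, of i] show ?thesis unfolding pd_dist_sq using assms by simp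
qed

lemma Ck_dist_sq: "Ck n (\<lambda>y::'a::euclidean_space. (norm (y - x))\<^sup>2 + e)"
  using Ck_add[OF Ck_affine[OF Ck_norm_sq, of n 1 "- x"] Ck_const[of n e]] by simp

definition newton :: "'a::euclidean_space \<Rightarrow> real \<Rightarrow> 'a \<Rightarrow> real" where
  "newton x \<epsilon> y = ((norm (y - x))\<^sup>2 + \<epsilon>\<^sup>2) powr (- ((real DIM('a) - 2) / 2))"

context
  fixes x :: "'a::euclidean_space" and \<epsilon> \<alpha> :: real and \<rho> :: "'a \<Rightarrow> real"
  assumes dim: "DIM('a) \<ge> 3" and eps: "\<epsilon> > 0"
  defines "\<alpha> \<equiv> (real DIM('a) - 2) / 2" and "\<rho> \<equiv> \<lambda>y. (norm (y - x))\<^sup>2 + \<epsilon>\<^sup>2"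
begin

lemma rho_pos: "\<rho> y > 0" unfolding \<rho>_def using eps by (simp add: add_nonneg_pos)

lemma newton_eq: "newton x \<epsilon> = (\<lambda>y. \<rho> y powr (- \<alpha>))"
  by (simp add: newton_def \<alpha>_def \<rho>_def fun_eq_iff)

lemma newton_pos: "newton x \<epsilon> y > 0"
  using rho_pos[of y] by (simp add: newton_eq)

lemma newton_derivs:
  "((\<lambda>t. t powr (- \<alpha>)) has_real_derivative - \<alpha> * \<rho> y powr (- \<alpha> - 1)) (at (\<rho> y))"
  "((\<lambda>t. - \<alpha> * t powr (- \<alpha> - 1)) has_real_derivative \<alpha> * (\<alpha> + 1) * \<rho> y powr (- \<alpha> - 2)) (at (\<rho> y))"
proof -
  show "((\<lambda>t. t powr (- \<alpha>)) has_real_derivative - \<alpha> * \<rho> y powr (- \<alpha> - 1)) (at (\<rho> y))"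
    by (rule has_real_derivative_powr[OF rho_pos])
  have "((\<lambda>t. - \<alpha> * t powr (- \<alpha> - 1)) has_real_derivative
      - \<alpha> * ((- \<alpha> - 1) * \<rho> y powr (- \<alpha> - 1 - 1))) (at (\<rho> y))"
    by (rule DERIV_cmult[OF has_real_derivative_powr[OF rho_pos]])
  then show "((\<lambda>t. - \<alpha> * t powr (- \<alpha> - 1)) has_real_derivative \<alpha> * (\<alpha> + 1) * \<rho> y powr (- \<alpha> - 2)) (at (\<rho> y))"
    by (simp add: algebra_simps)
qed

lemma Ck2_newton: "Ck 2 (newton x \<epsilon>)"
  unfolding newton_eq
proof (rule Ck2_compose_real[of "\<lambda>t. t powr (- \<alpha>)" "\<lambda>t. - \<alpha> * t powr (- \<alpha> - 1)" \<rho>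
      "\<lambda>t. \<alpha> * (\<alpha> + 1) * t powr (- \<alpha> - 2)", OF newton_derivs])
  show "continuous_on (range \<rho>) (\<lambda>t. \<alpha> * (\<alpha> + 1) * t powr (- \<alpha> - 2))"
    using rho_pos by (intro continuous_intros) (auto simp: less_imp_neq[symmetric])
  show "Ck 2 \<rho>" unfolding \<rho>_def by (rule Ck_dist_sq)
qed

text \<open>A derivative of the kernel costs one factor of distance, uniformly in \<epsilon>, since
  the component of y - x times its norm is at most \<open>\<rho> y\<close>. The product form also
  makes sense at y = x.\<close>

lemma pd_newton_bound:
  assumes "i \<in> Basis"
  shows "\<bar>pd i (newton x \<epsilon>) y\<bar> * dist y x \<le> (real DIM('a) - 2) * newton x \<epsilon> y"
proof -
  have "\<rho> differentiable (at y)" unfolding \<rho>_def using Ck_differentiable[OF Ck_dist_sq, of 1] by simp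
  then have "pd i (newton x \<epsilon>) y = - \<alpha> * \<rho> y powr (- \<alpha> - 1) * pd i \<rho> y"
    unfolding newton_eq using newton_derivs(1)[of y]
    by (rule pd_compose_real[of \<rho> y "\<lambda>t. t powr (- \<alpha>)"])
  also have "pd i \<rho> y = 2 * ((y - x) \<bullet> i)" unfolding \<rho>_def pd_dist_sq ..
  finally have "\<bar>pd i (newton x \<epsilon>) y\<bar> = 2 * \<alpha> * \<rho> y powr (- \<alpha> - 1) * \<bar>(y - x) \<bullet> i\<bar>"
    using dim by (simp add: abs_mult \<alpha>_def)
  then have "\<bar>pd i (newton x \<epsilon>) y\<bar> * dist y x
      = 2 * \<alpha> * \<rho> y powr (- \<alpha> - 1) * (\<bar>(y - x) \<bullet> i\<bar> * norm (y - x))" by (simp add: dist_norm)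
  also have "\<dots> \<le> 2 * \<alpha> * \<rho> y powr (- \<alpha> - 1) * \<rho> y"
  proof (rule mult_left_mono)
    have "\<bar>(y - x) \<bullet> i\<bar> * norm (y - x) \<le> norm (y - x) * norm (y - x)"
      using Basis_le_norm[OF assms] by (intro mult_right_mono) auto
    then show "\<bar>(y - x) \<bullet> i\<bar> * norm (y - x) \<le> \<rho> y" by (simp add: \<rho>_def power2_eq_square add_increasing2)
    show "0 \<le> 2 * \<alpha> * \<rho> y powr (- \<alpha> - 1)" using dim by (simp add: \<alpha>_def)
  qed
  also have "\<dots> = 2 * \<alpha> * newton x \<epsilon> y"
    using rho_pos[of y] by (simp add: newton_eq powr_diff)
  also have "2 * \<alpha> = real DIM('a) - 2" by (simp add: \<alpha>_def)
  finally show ?thesis .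
qed

text \<open>The terms with the factor \<open>\<rho> y\<close> cancel because 2 \<alpha> + 2 is the
  dimension. Only the \<epsilon>^2 term survives, with a negative sign: this is
  superharmonicity.\<close>

lemma laplacian_newton:
  "laplacian (newton x \<epsilon>) y
    = - (real DIM('a) * (real DIM('a) - 2) * \<epsilon>\<^sup>2 * \<rho> y powr (- (real DIM('a) + 2) / 2))"
proof -
  define t where "t = \<rho> y powr (- \<alpha> - 2)"
  have e1: "\<rho> y powr (- \<alpha> - 1) = \<rho> y * t"
  proof -
    have "\<rho> y powr (- \<alpha> - 1) = \<rho> y powr (1 + (- \<alpha> - 2))" by (rule arg_cong) simp
    also have "\<dots> = \<rho> y * t" unfolding powr_add t_def using rho_pos[of y] by simp
    finally show ?thesis .
  qed
  have "pd i (pd i (newton x \<epsilon>)) y = - \<alpha> * (\<rho> y * t) * 2 + \<alpha> * (\<alpha> + 1) * t * (2 * ((y - x) \<bullet> i))\<^sup>2"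
    if i: "i \<in> Basis" for i
  proof -
    have "Ck 2 \<rho>" unfolding \<rho>_def by (rule Ck_dist_sq)
    then have "pd i (pd i (newton x \<epsilon>)) y = - \<alpha> * \<rho> y powr (- \<alpha> - 1) * pd i (pd i \<rho>) y
        + \<alpha> * (\<alpha> + 1) * \<rho> y powr (- \<alpha> - 2) * (pd i \<rho> y)\<^sup>2"
      unfolding newton_eq
      by (rule pd_pd_compose_real[of \<rho> i "\<lambda>t. t powr (- \<alpha>)" "\<lambda>t. - \<alpha> * t powr (- \<alpha> - 1)"
            "\<lambda>t. \<alpha> * (\<alpha> + 1) * t powr (- \<alpha> - 2)", OF _ i newton_derivs])
    moreover have "pd i (pd i \<rho>) y = 2" unfolding \<rho>_def by (rule pd_pd_dist_sq[OF i])
    moreover have "pd i \<rho> y = 2 * ((y - x) \<bullet> i)" unfolding \<rho>_def pd_dist_sq ..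
    ultimately show ?thesis by (simp add: e1 t_def[symmetric])
  qed
  then have "laplacian (newton x \<epsilon>) y
      = real DIM('a) * (- \<alpha> * (\<rho> y * t) * 2) + \<alpha> * (\<alpha> + 1) * t * (\<Sum>i\<in>Basis. (2 * ((y - x) \<bullet> i))\<^sup>2)"
    unfolding laplacian_def by (simp add: sum_subtractf sum_distrib_left)
  also have "(\<Sum>i\<in>Basis. (2 * ((y - x) \<bullet> i))\<^sup>2) = 4 * (norm (y - x))\<^sup>2"
    unfolding power2_norm_eq_inner euclidean_inner[of "y - x" "y - x"]
    by (simp add: sum_distrib_left power2_eq_square mult_ac)
  also have "(norm (y - x))\<^sup>2 = \<rho> y - \<epsilon>\<^sup>2" by (simp add: \<rho>_def)
  also have "real DIM('a) * (- \<alpha> * (\<rho> y * t) * 2) + \<alpha> * (\<alpha> + 1) * t * (4 * (\<rho> y - \<epsilon>\<^sup>2))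
      = - (real DIM('a) * (real DIM('a) - 2) * \<epsilon>\<^sup>2 * t)"
    unfolding \<alpha>_def by (simp add: field_simps)
  also have "t = \<rho> y powr (- (real DIM('a) + 2) / 2)"
    unfolding t_def \<alpha>_def by (intro arg_cong2[where f="(powr)"]) (auto simp: field_simps)
  finally show ?thesis .
qed

lemma newton_le_annulus:
  assumes "y \<in> annulus x c" "c > 0"
  shows "newton x \<epsilon> y \<le> 4 powr (real DIM('a) - 2) * c powr (real DIM('a) - 2)"
proof -
  have d: "1 / (4 * c) \<le> dist y x" using assms by (simp add: annulus_def field_simps)
  then have "(1 / (4 * c))\<^sup>2 \<le> (dist y x)\<^sup>2" using assms by (intro power_mono) auto
  then have "(1 / (4 * c))\<^sup>2 \<le> \<rho> y" by (simp add: \<rho>_def dist_norm add_increasing2)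
  then have "newton x \<epsilon> y \<le> ((1 / (4 * c))\<^sup>2) powr (- \<alpha>)"
    unfolding newton_eq using assms dim by (intro powr_mono2') (auto simp: \<alpha>_def)
  also have "(1 / (4 * c))\<^sup>2 = (4 * c) powr (- 2)"
    using assms by (simp add: powr_minus powr_numeral power_divide field_simps)
  also have "((4 * c) powr (- 2)) powr (- \<alpha>) = (4 * c) powr (real DIM('a) - 2)"
    unfolding powr_powr \<alpha>_def by (rule arg_cong) (simp add: field_simps)
  also have "\<dots> = 4 powr (real DIM('a) - 2) * c powr (real DIM('a) - 2)"
    using assms by (simp add: powr_mult)
  finally show ?thesis .
qed

text \<open>On this ball \<open>\<rho> y\<close> \<le> 2 \<epsilon>^2, whence the power of 2. The
  height \<epsilon>^(-N) offsets the volume of the ball, so the mass does not degenerate as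
  \<epsilon> shrinks.\<close>

lemma laplacian_newton_ball:
  assumes "y \<in> cball x \<epsilon>"
  shows "- laplacian (newton x \<epsilon>) y
    \<ge> real DIM('a) * (real DIM('a) - 2) * 2 powr (- (real DIM('a) + 2) / 2) * \<epsilon> powr (- real DIM('a))"
proof -
  have "\<rho> y \<le> 2 * \<epsilon>\<^sup>2"
    using assms power_mono[of "norm (y - x)" \<epsilon> 2] by (simp add: \<rho>_def dist_norm norm_minus_commute)
  then have 1: "(2 * \<epsilon>\<^sup>2) powr (- (real DIM('a) + 2) / 2) \<le> \<rho> y powr (- (real DIM('a) + 2) / 2)"
    using rho_pos[of y] by (intro powr_mono2') auto
  have 2: "(2 * \<epsilon>\<^sup>2) powr (- (real DIM('a) + 2) / 2)
      = 2 powr (- (real DIM('a) + 2) / 2) * \<epsilon> powr (- (real DIM('a) + 2))"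
  proof -
    have "\<epsilon>\<^sup>2 = \<epsilon> powr 2" using eps by (simp add: powr_numeral)
    then show ?thesis using eps
      by (simp only:) (simp add: powr_mult powr_powr diff_divide_distrib del: powr_numeral)
  qed
  have 3: "\<epsilon>\<^sup>2 * \<epsilon> powr (- (real DIM('a) + 2)) = \<epsilon> powr (- real DIM('a))"
  proof -
    have "\<epsilon>\<^sup>2 = \<epsilon> powr 2" using eps by (simp add: powr_numeral)
    then show ?thesis by (simp flip: powr_add)
  qed
  have "2 powr (- (real DIM('a) + 2) / 2) * \<epsilon> powr (- real DIM('a))
      = \<epsilon>\<^sup>2 * ((2 * \<epsilon>\<^sup>2) powr (- (real DIM('a) + 2) / 2))"
    unfolding 2 3[symmetric] by simp
  also have "\<dots> \<le> \<epsilon>\<^sup>2 * \<rho> y powr (- (real DIM('a) + 2) / 2)"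
    by (intro mult_left_mono 1) simp
  finally have "2 powr (- (real DIM('a) + 2) / 2) * \<epsilon> powr (- real DIM('a))
      \<le> \<epsilon>\<^sup>2 * \<rho> y powr (- (real DIM('a) + 2) / 2)" .
  then have "real DIM('a) * (real DIM('a) - 2) * (2 powr (- (real DIM('a) + 2) / 2) * \<epsilon> powr (- real DIM('a)))
      \<le> real DIM('a) * (real DIM('a) - 2) * (\<epsilon>\<^sup>2 * \<rho> y powr (- (real DIM('a) + 2) / 2))"
    using dim by (intro mult_left_mono) auto
  then show ?thesis by (simp add: laplacian_newton mult.assoc)
qed

lemma laplacian_newton_nonpos: "laplacian (newton x \<epsilon>) y \<le> 0"
  using dim by (simp add: laplacian_newton)

end

section \<open>The test function estimate\<close>

text \<open>Young's inequality with exponents q and p, the coefficients 1/q and 1/p being rounded up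
  to 1. The power w^((k-2)q) is at most w^k because w \<le> 1 and (k-2)q \<ge> k is equivalent to k
  \<ge> 2p.\<close>

lemma young_absorb:
  fixes q p :: real
  assumes q: "q > 1" "p = q / (q - 1)" and k: "real k \<ge> 2 * p" "k \<ge> 3"
    and w: "0 \<le> w" "w \<le> 1" and nn: "u \<ge> 0" "A \<ge> 0" "T \<ge> 0"
  shows "A * u * w ^ (k - 2) * T \<le> u powr q * w ^ k + A powr p * T powr p"
proof -
  have p: "p > 1" using q by simp
  have wk: "(w ^ (k - 2)) powr q \<le> w ^ k"
  proof (cases "w = 0")
    \<comment> \<open>The conversion to real powers needs w > 0; at w = 0 the exponent k - 2 is
      positive since k \<ge> 3, so both sides are 0.\<close>
    case True
    then show ?thesis using k by (simp add: power_0_left)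
  next
    case False
    then have "w > 0" using w by simp
    then have "(w ^ (k - 2)) powr q = w powr (real (k - 2) * q)"
      by (simp add: powr_powr flip: powr_realpow)
    also have "\<dots> \<le> w powr real k"
    proof (rule powr_mono')
      have "2 * q \<le> real k * (q - 1)" using k(1) q by (simp add: field_simps)
      then show "real k \<le> real (k - 2) * q" using k(2) by (simp add: of_nat_diff algebra_simps)
    qed (use w in auto)
    also have "\<dots> = w ^ k" using \<open>w > 0\<close> by (simp add: powr_realpow)
    finally show ?thesis .
  qed
  have "A * u * w ^ (k - 2) * T = (u * w ^ (k - 2)) * (A * T)" by simp
  also have "\<dots> \<le> (u * w ^ (k - 2)) powr q / q + (A * T) powr p / p"
    by (rule Youngs_inequality) (use q p nn w in \<open>auto simp: field_simps\<close>)
  also have "\<dots> \<le> (u * w ^ (k - 2)) powr q / 1 + (A * T) powr p / 1"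
    by (intro add_mono divide_left_mono) (use q p in auto)
  also have "\<dots> = u powr q * (w ^ (k - 2)) powr q + A powr p * T powr p"
    using nn w by (simp add: powr_mult)
  also have "\<dots> \<le> u powr q * w ^ k + A powr p * T powr p"
    by (intro add_mono mult_left_mono wk) auto
  finally show ?thesis .
qed

lemma DERIV_cut_power:
  assumes "n \<ge> 2"
  shows "((\<lambda>s. max 0 (1 - 2 * s) ^ n) has_real_derivative - 2 * real n * max 0 (1 - 2 * s) ^ (n - 1)) (at s)"
proof -
  have "((\<lambda>s. 1 - 2 * s) has_real_derivative - 2) (at s)" by (auto intro!: derivative_eq_intros)
  from DERIV_chain2[OF DERIV_max_power[OF assms] this]
  have "((\<lambda>s. max 0 (1 - 2 * s) ^ n) has_real_derivative real n * max 0 (1 - 2 * s) ^ (n - 1) * - 2) (at s)" .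
  then show ?thesis by (rule DERIV_cong) simp
qed

text \<open>At least 2q', for the absorption, and at least 3, so that the power of the positive part
  is C^2 and its second derivative vanishes where the positive part does.\<close>

definition cut_exponent :: "real \<Rightarrow> nat" where
  "cut_exponent q = nat \<lceil>2 * conj_exp q\<rceil> + 3"

text \<open>N coordinate directions, each with three contributions: the mixed term of kernel and
  cut-off, the second derivative of S, and the square of its first derivative, with K^2 from the
  overlap.\<close>

definition absorption_const :: "real \<Rightarrow> real \<Rightarrow> nat \<Rightarrow> real" where
  "absorption_const q N K = N * (16 * real (cut_exponent q) * N + 2 * real (cut_exponent q)
    + 4 * (real (cut_exponent q))\<^sup>2 * (real K)\<^sup>2)"

text \<open>The factors are, in order, the constant fed into Young's inequality, the number of
  active pieces, and the bound for the kernel on an annulus.\<close>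

definition estimate_const :: "real \<Rightarrow> real \<Rightarrow> nat \<Rightarrow> real" where
  "estimate_const q N K = absorption_const q N K powr conj_exp q * real K powr conj_exp q * 4 powr (N - 2)"

text \<open>Separates the analysis from the geometry: finitely many cut-offs at scales 1/\<sigma>,
  with jets dominated by densities \<open>P\<close> on annuli of bounded overlap. The jets are
  controlled only where the sum is below 1/2, the region carrying the test function. The number c is
  a lower bound of u near x0 and is what gets estimated.\<close>

locale capacity_test =
  fixes q N :: real and K :: nat and x0 :: "'a::euclidean_space" and \<epsilon> c :: real
    and G :: "'a set" and u :: "'a \<Rightarrow> real"
    and J :: "'j set" and \<sigma> :: "'j \<Rightarrow> real" and \<zeta> P :: "'j \<Rightarrow> 'a \<Rightarrow> real"
  assumes dim: "DIM('a) \<ge> 3" and N: "N = real DIM('a)" and q: "q > 1"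
    and J: "finite J" and sg: "\<And>j. j \<in> J \<Longrightarrow> \<sigma> j > 0"
    and \<zeta>2: "\<And>j. j \<in> J \<Longrightarrow> Ck 2 (\<zeta> j)" and \<zeta>0: "\<And>j y. j \<in> J \<Longrightarrow> \<zeta> j y \<ge> 0"
    and P0: "\<And>j y. j \<in> J \<Longrightarrow> P j y \<ge> 0"
    and jet: "\<And>j y. j \<in> J \<Longrightarrow> (\<Sum>j\<in>J. \<zeta> j y) < 1/2 \<Longrightarrow> jet_bound (\<zeta> j) (\<sigma> j) (P j y) y"
    and Psupp: "\<And>j y. j \<in> J \<Longrightarrow> P j y \<noteq> 0 \<Longrightarrow> y \<in> annulus x0 (\<sigma> j)"
    and overlap: "\<And>y. card {j\<in>J. y \<in> annulus x0 (\<sigma> j)} \<le> K"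
    and Pint: "\<And>j. j \<in> J \<Longrightarrow> integrable lborel (\<lambda>y. P j y powr conj_exp q)"
    and G: "open G" and uc: "continuous_on G u" and u0: "\<And>y. y \<in> G \<Longrightarrow> u y \<ge> 0"
    and weak: "\<And>\<phi>. smooth \<phi> \<Longrightarrow> compact (tsupp \<phi>) \<Longrightarrow> tsupp \<phi> \<subseteq> G \<Longrightarrow>
      (\<integral>x. (- u x * laplacian \<phi> x + \<bar>u x\<bar> powr (q - 1) * u x * \<phi> x) \<partial>lebesgue) = 0"
    and cK: "compact {y. (\<Sum>j\<in>J. \<zeta> j y) \<le> 1/2}" and KG: "{y. (\<Sum>j\<in>J. \<zeta> j y) \<le> 1/2} \<subseteq> G"
    and eps: "\<epsilon> > 0" and ball0: "\<And>y. y \<in> cball x0 \<epsilon> \<Longrightarrow> (\<Sum>j\<in>J. \<zeta> j y) = 0"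
    and c: "c \<ge> 0" and uball: "\<And>y. y \<in> cball x0 \<epsilon> \<Longrightarrow> c \<le> u y"
begin

abbreviation "p \<equiv> conj_exp q"
abbreviation "k \<equiv> cut_exponent q"
abbreviation "A \<equiv> absorption_const q N K"
abbreviation "M \<equiv> estimate_const q N K"
definition "S y = (\<Sum>j\<in>J. \<zeta> j y)"
definition "T y = (\<Sum>j\<in>J. (\<sigma> j)\<^sup>2 * P j y)"
definition "w y = max 0 (1 - 2 * S y)"
definition "H y = w y ^ k"
definition "\<Phi> y = newton x0 \<epsilon> y * H y"

lemma p: "p > 1" using q by (simp add: conj_exp_def)

lemma k: "real k \<ge> 2 * p" "k \<ge> 3"
  unfolding cut_exponent_def by linarith+

lemma N3: "N \<ge> 3" using dim N by simp

lemmas newton_facts = pd_newton_bound[OF dim eps, folded N] newton_le_annulus[OF dim eps, folded N]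
  laplacian_newton_ball[OF dim eps, folded N]

lemma A_nonneg: "A \<ge> 0" using N3 by (simp add: absorption_const_def)

lemma T_nonneg: "T y \<ge> 0" unfolding T_def by (intro sum_nonneg mult_nonneg_nonneg P0) auto

lemma S_nonneg: "S y \<ge> 0" unfolding S_def by (intro sum_nonneg \<zeta>0)

lemma w_range: "0 \<le> w y" "w y \<le> 1" using S_nonneg[of y] by (auto simp: w_def)

lemma newton0: "newton x0 \<epsilon> y > 0" by (rule newton_pos[OF dim eps])

lemma Ck2_S: "Ck 2 S" unfolding S_def[abs_def] by (rule Ck_sum[OF \<zeta>2])

lemma card_active: "card {j\<in>J. P j y \<noteq> 0} \<le> K"
proof -
  have "{j\<in>J. P j y \<noteq> 0} \<subseteq> {j\<in>J. y \<in> annulus x0 (\<sigma> j)}" using Psupp by blast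
  then have "card {j\<in>J. P j y \<noteq> 0} \<le> card {j\<in>J. y \<in> annulus x0 (\<sigma> j)}"
    using J by (intro card_mono) auto
  then show ?thesis using overlap[of y] by linarith
qed

section \<open>The truncated power of S and the Laplacian of the test function\<close>

lemma DERIV_H:
  "((\<lambda>s. max 0 (1 - 2 * s) ^ k) has_real_derivative - 2 * real k * max 0 (1 - 2 * s) ^ (k - 1)) (at s)"
  "((\<lambda>s. - 2 * real k * max 0 (1 - 2 * s) ^ (k - 1)) has_real_derivative
    4 * real k * real (k - 1) * max 0 (1 - 2 * s) ^ (k - 2)) (at s)"
proof -
  show "((\<lambda>s. max 0 (1 - 2 * s) ^ k) has_real_derivative - 2 * real k * max 0 (1 - 2 * s) ^ (k - 1)) (at s)"
    by (rule DERIV_cut_power) (use k in simp)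
  have "((\<lambda>s. max 0 (1 - 2 * s) ^ (k - 1)) has_real_derivative
      - 2 * real (k - 1) * max 0 (1 - 2 * s) ^ (k - 1 - 1)) (at s)"
    by (rule DERIV_cut_power) (use k in simp)
  from DERIV_cmult[OF this, of "- 2 * real k"]
  show "((\<lambda>s. - 2 * real k * max 0 (1 - 2 * s) ^ (k - 1)) has_real_derivative
    4 * real k * real (k - 1) * max 0 (1 - 2 * s) ^ (k - 2)) (at s)"
    by (simp add: mult_ac numeral_2_eq_2 del: mult_minus_left)
qed

lemma Ck2_H: "Ck 2 H"
  unfolding H_def[abs_def] w_def
  by (rule Ck2_compose_real[of "\<lambda>s. max 0 (1 - 2 * s) ^ k" "\<lambda>s. - 2 * real k * max 0 (1 - 2 * s) ^ (k - 1)"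
        S "\<lambda>s. 4 * real k * real (k - 1) * max 0 (1 - 2 * s) ^ (k - 2)", OF DERIV_H _ Ck2_S])
    (intro continuous_intros)

lemma pd_H: "pd i H y = - 2 * real k * w y ^ (k - 1) * pd i S y"
proof -
  have "S differentiable (at y)" by (rule Ck_differentiable[OF Ck2_S]) simp
  from pd_compose_real[OF this DERIV_H(1), of i] show ?thesis by (simp add: H_def[abs_def] w_def)
qed

lemma pd_pd_H:
  assumes "i \<in> Basis"
  shows "pd i (pd i H) y = - 2 * real k * w y ^ (k - 1) * pd i (pd i S) y
    + 4 * real k * real (k - 1) * w y ^ (k - 2) * (pd i S y)\<^sup>2"
  unfolding H_def[abs_def] w_def
  by (rule pd_pd_compose_real[of S i "\<lambda>s. max 0 (1 - 2 * s) ^ k" "\<lambda>s. - 2 * real k * max 0 (1 - 2 * s) ^ (k - 1)"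
        "\<lambda>s. 4 * real k * real (k - 1) * max 0 (1 - 2 * s) ^ (k - 2)", OF Ck2_S assms DERIV_H])

lemma Ck2_\<Phi>: "Ck 2 \<Phi>"
  unfolding \<Phi>_def[abs_def] by (rule Ck_mult[OF Ck2_newton[OF dim eps] Ck2_H])

lemma laplacian_\<Phi>:
  "laplacian \<Phi> y = laplacian (newton x0 \<epsilon>) y * H y
    + (\<Sum>i\<in>Basis. 2 * pd i (newton x0 \<epsilon>) y * pd i H y + newton x0 \<epsilon> y * pd i (pd i H) y)"
proof -
  have "laplacian \<Phi> y = (\<Sum>i\<in>Basis. pd i (pd i (newton x0 \<epsilon>)) y * H y
    + (2 * pd i (newton x0 \<epsilon>) y * pd i H y + newton x0 \<epsilon> y * pd i (pd i H) y))"
    unfolding laplacian_def \<Phi>_def[abs_def]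
    using pd_pd_mult[OF Ck2_newton[OF dim eps] Ck2_H] by (intro sum.cong) auto
  then show ?thesis by (simp add: laplacian_def sum.distrib sum_distrib_right)
qed

lemma pd_S: "i \<in> Basis \<Longrightarrow> pd i S y = (\<Sum>j\<in>J. pd i (\<zeta> j) y)"
  unfolding S_def[abs_def] by (rule pd_sum) (use Ck_differentiable[OF \<zeta>2] in auto)

lemma pd_pd_S:
  assumes i: "i \<in> Basis"
  shows "pd i (pd i S) y = (\<Sum>j\<in>J. pd i (pd i (\<zeta> j)) y)"
proof -
  have "pd i S = (\<lambda>y. \<Sum>j\<in>J. pd i (\<zeta> j) y)" using pd_S[OF i] by blast
  then show ?thesis
    using Ck_differentiable[OF Ck2_pd[OF \<zeta>2 i]] by (simp add: pd_sum)
qed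

section \<open>Derivative bounds in one coordinate direction, where the cut-off is active\<close>

context
  fixes y i :: 'a assumes y: "S y < 1/2" and i: "i \<in> Basis"
begin

lemma jets: "j \<in> J \<Longrightarrow> \<bar>pd i (\<zeta> j) y\<bar> \<le> \<sigma> j * P j y"
  "j \<in> J \<Longrightarrow> (pd i (\<zeta> j) y)\<^sup>2 \<le> (\<sigma> j)\<^sup>2 * P j y"
  "j \<in> J \<Longrightarrow> \<bar>pd i (pd i (\<zeta> j)) y\<bar> \<le> (\<sigma> j)\<^sup>2 * P j y"
  using jet[of j y] y i by (auto simp: S_def jet_bound_def)

lemma pd_pd_S_le: "\<bar>pd i (pd i S) y\<bar> \<le> T y"
  unfolding pd_pd_S[OF i] T_def by (rule order_trans[OF sum_abs]) (intro sum_mono jets)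

text \<open>The jet bounds control the individual squares; as at most K of the derivatives are
  nonzero at y, squaring their sum costs only K^2.\<close>

lemma pd_S_sq_le: "(pd i S y)\<^sup>2 \<le> (real K)\<^sup>2 * T y"
proof -
  have "(pd i S y)\<^sup>2 = \<bar>pd i S y\<bar>\<^sup>2" by simp
  also have "\<dots> \<le> (\<Sum>j\<in>J. \<bar>pd i (\<zeta> j) y\<bar>)\<^sup>2"
    unfolding pd_S[OF i] by (intro power_mono sum_abs) auto
  also have "\<dots> = (\<Sum>j\<in>J. \<bar>pd i (\<zeta> j) y\<bar>) powr 2" by (simp add: powr_numeral sum_nonneg)
  also have "\<dots> \<le> real K powr 2 * (\<Sum>j\<in>J. \<bar>pd i (\<zeta> j) y\<bar> powr 2)"
  proof (rule sum_powr_le[OF J])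
    have "{j\<in>J. \<bar>pd i (\<zeta> j) y\<bar> \<noteq> 0} \<subseteq> {j\<in>J. P j y \<noteq> 0}" using jets(1) by fastforce
    then have "card {j\<in>J. \<bar>pd i (\<zeta> j) y\<bar> \<noteq> 0} \<le> card {j\<in>J. P j y \<noteq> 0}"
      using J by (intro card_mono) auto
    then show "card {j\<in>J. \<bar>pd i (\<zeta> j) y\<bar> \<noteq> 0} \<le> K" using card_active[of y] by linarith
  qed auto
  also have "\<dots> = (real K)\<^sup>2 * (\<Sum>j\<in>J. (pd i (\<zeta> j) y)\<^sup>2)" by (simp add: powr_numeral)
  also have "\<dots> \<le> (real K)\<^sup>2 * T y"
    unfolding T_def by (intro mult_left_mono sum_mono jets) auto
  finally show ?thesis .
qed

text \<open>A first derivative of a piece carries one power of \<sigma>, but two are needed. The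
  derivative of the kernel gains 1/dist, which is at most 4 \<sigma> on the annulus: this supplies
  the missing power and the factor 4.\<close>

lemma pd_newton_pd_S_le: "\<bar>pd i (newton x0 \<epsilon>) y * pd i S y\<bar> \<le> 4 * N * newton x0 \<epsilon> y * T y"
proof -
  let ?D = "\<bar>pd i (newton x0 \<epsilon>) y\<bar>"
  have "\<bar>pd i (newton x0 \<epsilon>) y * pd i S y\<bar> \<le> ?D * (\<Sum>j\<in>J. \<bar>pd i (\<zeta> j) y\<bar>)"
    unfolding abs_mult pd_S[OF i] by (intro mult_left_mono sum_abs) auto
  also have "\<dots> = (\<Sum>j\<in>J. ?D * \<bar>pd i (\<zeta> j) y\<bar>)" by (simp add: sum_distrib_left)
  also have "\<dots> \<le> (\<Sum>j\<in>J. 4 * N * newton x0 \<epsilon> y * ((\<sigma> j)\<^sup>2 * P j y))"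
  proof (rule sum_mono)
    fix j assume j: "j \<in> J"
    show "?D * \<bar>pd i (\<zeta> j) y\<bar> \<le> 4 * N * newton x0 \<epsilon> y * ((\<sigma> j)\<^sup>2 * P j y)"
    proof (cases "P j y = 0")
      case True
      then show ?thesis using jets(1)[OF j] by simp
    next
      case False
      then have "y \<in> annulus x0 (\<sigma> j)" by (rule Psupp[OF j])
      then have d: "1 \<le> 4 * \<sigma> j * dist y x0" by (simp add: annulus_def)
      have "?D * \<bar>pd i (\<zeta> j) y\<bar> \<le> ?D * (\<sigma> j * P j y)"
        by (intro mult_left_mono jets(1)[OF j]) auto
      also have "\<dots> = ?D * (\<sigma> j * P j y) * 1" by simp
      also have "\<dots> \<le> ?D * (\<sigma> j * P j y) * (4 * \<sigma> j * dist y x0)"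
        by (rule mult_left_mono[OF d]) (use sg[OF j] P0[OF j] in auto)
      also have "\<dots> = (?D * dist y x0) * (4 * ((\<sigma> j)\<^sup>2 * P j y))" by (simp add: power2_eq_square)
      also have "\<dots> \<le> (N * newton x0 \<epsilon> y) * (4 * ((\<sigma> j)\<^sup>2 * P j y))"
      proof (rule mult_right_mono)
        have "?D * dist y x0 \<le> (N - 2) * newton x0 \<epsilon> y" by (rule newton_facts(1)[OF i])
        also have "\<dots> \<le> N * newton x0 \<epsilon> y" using newton0[of y] by (intro mult_right_mono) auto
        finally show "?D * dist y x0 \<le> N * newton x0 \<epsilon> y" .
      qed (use P0[OF j] in auto)
      finally show ?thesis by simp
    qed
  qed
  also have "\<dots> = 4 * N * newton x0 \<epsilon> y * T y" by (simp add: T_def sum_distrib_left)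
  finally show ?thesis .
qed

text \<open>Since 0 \<le> w \<le> 1, the power w^(k-1) can be weakened to w^(k-2), so that all terms
  share the power expected by \<open>young_absorb\<close>. The 16 k N is 4 k from differentiating
  \<open>H\<close> times 4 N from the mixed bound.\<close>

lemma laplacian_term_le:
  "2 * pd i (newton x0 \<epsilon>) y * pd i H y + newton x0 \<epsilon> y * pd i (pd i H) y
    \<le> (16 * k * N + 2 * k + 4 * (real k)\<^sup>2 * (real K)\<^sup>2) * (newton x0 \<epsilon> y * w y ^ (k - 2) * T y)"
proof -
  let ?g = "newton x0 \<epsilon> y" and ?W = "w y ^ (k - 2)"
  have W: "w y ^ (k - 1) \<le> ?W" "0 \<le> w y ^ (k - 1)"
    using w_range[of y] k by (auto intro!: power_decreasing)
  have t1: "2 * pd i (newton x0 \<epsilon>) y * pd i H y \<le> 16 * k * N * (?g * ?W * T y)"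
  proof -
    have "2 * pd i (newton x0 \<epsilon>) y * pd i H y = - (4 * k * w y ^ (k - 1) * (pd i (newton x0 \<epsilon>) y * pd i S y))"
      by (simp add: pd_H)
    also have "\<dots> \<le> 4 * k * w y ^ (k - 1) * \<bar>pd i (newton x0 \<epsilon>) y * pd i S y\<bar>"
      unfolding mult_minus_right[symmetric] by (rule mult_left_mono) (use W in auto)
    also have "\<dots> \<le> 4 * k * ?W * (4 * N * ?g * T y)"
      by (intro mult_mono mult_left_mono W pd_newton_pd_S_le) (use W N3 in auto)
    finally show ?thesis by (simp add: mult_ac)
  qed
  have t2: "pd i (pd i H) y \<le> (2 * k + 4 * (real k)\<^sup>2 * (real K)\<^sup>2) * (?W * T y)"
  proof -
    have "pd i (pd i H) y = 2 * k * w y ^ (k - 1) * (- pd i (pd i S) y) + 4 * k * real (k - 1) * ?W * (pd i S y)\<^sup>2"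
      unfolding pd_pd_H[OF i] by simp
    also have "\<dots> \<le> 2 * k * ?W * T y + 4 * k * real k * ?W * ((real K)\<^sup>2 * T y)"
    proof (rule add_mono)
      have "2 * k * w y ^ (k - 1) * (- pd i (pd i S) y) \<le> 2 * k * w y ^ (k - 1) * T y"
        using pd_pd_S_le W by (intro mult_left_mono) auto
      also have "\<dots> \<le> 2 * k * ?W * T y"
        using W T_nonneg by (intro mult_right_mono mult_left_mono) auto
      finally show "2 * k * w y ^ (k - 1) * (- pd i (pd i S) y) \<le> 2 * k * ?W * T y" .
      show "4 * k * real (k - 1) * ?W * (pd i S y)\<^sup>2 \<le> 4 * k * real k * ?W * ((real K)\<^sup>2 * T y)"
        by (intro mult_mono mult_left_mono mult_right_mono pd_S_sq_le) (use w_range[of y] in auto)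
    qed
    finally show ?thesis by (simp add: algebra_simps power2_eq_square)
  qed
  have "?g * pd i (pd i H) y \<le> ?g * ((2 * k + 4 * (real k)\<^sup>2 * (real K)\<^sup>2) * (?W * T y))"
    using newton0[of y] by (intro mult_left_mono t2) auto
  with t1 show ?thesis by (simp add: algebra_simps)
qed

end

text \<open>The exponent collects N-2 from the kernel on the annulus of scale 1/\<sigma> and 2p from
  the p-th power of \<sigma>^2.\<close>

lemma newton_T_le:
  "newton x0 \<epsilon> y * T y powr p \<le> real K powr p * 4 powr (N - 2) * (\<Sum>j\<in>J. \<sigma> j powr (N - 2 + 2 * p) * P j y powr p)"
proof -
  have "T y powr p \<le> real K powr p * (\<Sum>j\<in>J. ((\<sigma> j)\<^sup>2 * P j y) powr p)"
    unfolding T_def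
  proof (rule sum_powr_le[OF J])
    have "{j\<in>J. (\<sigma> j)\<^sup>2 * P j y \<noteq> 0} \<subseteq> {j\<in>J. P j y \<noteq> 0}" by auto
    then have "card {j\<in>J. (\<sigma> j)\<^sup>2 * P j y \<noteq> 0} \<le> card {j\<in>J. P j y \<noteq> 0}"
      using J by (intro card_mono) auto
    then show "card {j\<in>J. (\<sigma> j)\<^sup>2 * P j y \<noteq> 0} \<le> K" using card_active[of y] by linarith
  qed (use P0 p in auto)
  then have "newton x0 \<epsilon> y * T y powr p
      \<le> newton x0 \<epsilon> y * (real K powr p * (\<Sum>j\<in>J. ((\<sigma> j)\<^sup>2 * P j y) powr p))"
    using newton0[of y] by (intro mult_left_mono) auto
  also have "\<dots> = real K powr p * (\<Sum>j\<in>J. newton x0 \<epsilon> y * ((\<sigma> j)\<^sup>2 * P j y) powr p)"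
    by (simp add: sum_distrib_left mult_ac)
  also have "\<dots> \<le> real K powr p * (\<Sum>j\<in>J. 4 powr (N - 2) * (\<sigma> j powr (N - 2 + 2 * p) * P j y powr p))"
  proof (intro mult_left_mono sum_mono)
    fix j assume j: "j \<in> J"
    show "newton x0 \<epsilon> y * ((\<sigma> j)\<^sup>2 * P j y) powr p \<le> 4 powr (N - 2) * (\<sigma> j powr (N - 2 + 2 * p) * P j y powr p)"
    proof (cases "P j y = 0")
      case True
      then show ?thesis using p by simp
    next
      case False
      have "newton x0 \<epsilon> y \<le> 4 powr (N - 2) * \<sigma> j powr (N - 2)"
        by (rule newton_facts(2)[OF Psupp[OF j False] sg[OF j]])
      then have "newton x0 \<epsilon> y * ((\<sigma> j)\<^sup>2 * P j y) powr p
          \<le> 4 powr (N - 2) * \<sigma> j powr (N - 2) * ((\<sigma> j)\<^sup>2 * P j y) powr p"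
        by (rule mult_right_mono) simp
      moreover have "((\<sigma> j)\<^sup>2 * P j y) powr p = \<sigma> j powr (2 * p) * P j y powr p"
      proof -
        have "(\<sigma> j)\<^sup>2 = \<sigma> j powr 2" using sg[OF j] by (simp add: powr_numeral)
        then have "((\<sigma> j)\<^sup>2) powr p = \<sigma> j powr (2 * p)" by (simp only: powr_powr)
        then show ?thesis using P0[OF j] by (simp add: powr_mult)
      qed
      ultimately show ?thesis by (simp only: powr_add)
    qed
  qed simp
  also have "\<dots> = real K powr p * 4 powr (N - 2) * (\<Sum>j\<in>J. \<sigma> j powr (N - 2 + 2 * p) * P j y powr p)"
    by (simp add: sum_distrib_left mult_ac)
  finally show ?thesis .
qed

lemma H_eq_0: "\<not> S y < 1/2 \<Longrightarrow> H y = 0"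
  using k by (simp add: H_def w_def)

text \<open>Young's inequality absorbs all the terms containing derivatives of the cut-off into
  the absorption term $u^q \Phi$.\<close>

lemma pointwise:
  "u y * (- laplacian (newton x0 \<epsilon>) y) * H y
    \<le> (- u y * laplacian \<Phi> y + \<bar>u y\<bar> powr (q - 1) * u y * \<Phi> y)
      + M * (\<Sum>j\<in>J. \<sigma> j powr (N - 2 + 2 * p) * P j y powr p)"
proof -
  let ?g = "newton x0 \<epsilon> y"
  have AT: "A powr p * (?g * T y powr p) \<le> M * (\<Sum>j\<in>J. \<sigma> j powr (N - 2 + 2 * p) * P j y powr p)"
    unfolding estimate_const_def mult.assoc by (rule mult_left_mono[OF newton_T_le[unfolded mult.assoc]]) simp
  show ?thesis
  proof (cases "S y < 1/2")
    case True
    then have "y \<in> G" using KG by (auto simp: S_def)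
    then have uy: "u y \<ge> 0" by (rule u0)
    have uq: "\<bar>u y\<bar> powr (q - 1) * u y = u y powr q"
      using uy by (cases "u y = 0") (auto simp: powr_diff)
    have "laplacian \<Phi> y \<le> laplacian (newton x0 \<epsilon>) y * H y
        + (\<Sum>i::'a\<in>Basis. (16 * k * N + 2 * k + 4 * (real k)\<^sup>2 * (real K)\<^sup>2) * (?g * w y ^ (k - 2) * T y))"
      unfolding laplacian_\<Phi> by (intro add_left_mono sum_mono laplacian_term_le[OF True])
    also have "\<dots> = laplacian (newton x0 \<epsilon>) y * H y + ?g * (A * w y ^ (k - 2) * T y)"
      by (simp add: absorption_const_def mult_ac flip: N)
    finally have "u y * laplacian \<Phi> y
        \<le> u y * (laplacian (newton x0 \<epsilon>) y * H y + ?g * (A * w y ^ (k - 2) * T y))"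
      using uy by (rule mult_left_mono)
    also have "\<dots> = u y * laplacian (newton x0 \<epsilon>) y * H y + ?g * (A * u y * w y ^ (k - 2) * T y)"
      by (simp add: algebra_simps)
    also have "\<dots> \<le> u y * laplacian (newton x0 \<epsilon>) y * H y + ?g * (u y powr q * w y ^ k + A powr p * T y powr p)"
      using newton0[of y]
      by (intro add_left_mono mult_left_mono young_absorb[OF q conj_exp_def k w_range uy A_nonneg T_nonneg]) auto
    also have "\<dots> = u y * laplacian (newton x0 \<epsilon>) y * H y + u y powr q * \<Phi> y + A powr p * (?g * T y powr p)"
      by (simp add: \<Phi>_def H_def algebra_simps)
    finally show ?thesis using AT uq by simp
  next
    case False
    then have "w y = 0" by (simp add: w_def)
    \<comment> \<open>Since k - 2 \<ge> 1, the first two derivatives of \<open>H\<close> vanish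
      together with w, so the region without jet bounds contributes nothing.\<close>
    then have z: "H y = 0" "\<And>i. pd i H y = 0" "\<And>i. i \<in> Basis \<Longrightarrow> pd i (pd i H) y = 0"
      using k pd_pd_H by (auto simp: H_def pd_H power_0_left)
    have "laplacian \<Phi> y = 0" "\<Phi> y = 0" by (simp_all add: laplacian_\<Phi> z \<Phi>_def)
    moreover have "0 \<le> A powr p * (?g * T y powr p)" using newton0[of y] by simp
    ultimately show ?thesis using AT z(1) by simp
  qed
qed

text \<open>Integrate \<open>pointwise\<close>; the weak equation removes the middle term. On the
  left, superharmonicity allows restriction to the \<epsilon>-ball, where \<epsilon>^(-N) cancels
  against the volume. The result is therefore free of \<epsilon>.\<close>

lemma estimate:
  "N * (N - 2) * 2 powr (- (N + 2) / 2) * unit_ball_vol N * c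
    \<le> M * (\<Sum>j\<in>J. \<sigma> j powr (N - 2 + 2 * p) * (\<integral>y. P j y powr p \<partial>lborel))"
proof -
  define \<kappa> where "\<kappa> = N * (N - 2) * 2 powr (- (N + 2) / 2) * \<epsilon> powr (- N)"
  have \<kappa>0: "\<kappa> \<ge> 0" unfolding \<kappa>_def using N3 by simp
  define D where "D = {y. S y \<le> 1/2}"
  have D: "compact D" "D \<subseteq> G" using cK KG by (auto simp: D_def S_def)
  have uD: "continuous_on D u" using uc D(2) by (rule continuous_on_subset)
  have H0: "H y = 0" if "y \<notin> D" for y using that by (intro H_eq_0) (simp add: D_def)
  have t\<Phi>: "compact (tsupp \<Phi>)" "tsupp \<Phi> \<subseteq> D"
    using compact_tsuppI[OF D(1), of \<Phi>] H0 by (auto simp: \<Phi>_def)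
  define f1 where "f1 y = u y * (- laplacian (newton x0 \<epsilon>) y) * H y" for y
  define f2 where "f2 y = - u y * laplacian \<Phi> y + \<bar>u y\<bar> powr (q - 1) * u y * \<Phi> y" for y
  define f3 where "f3 y = M * (\<Sum>j\<in>J. \<sigma> j powr (N - 2 + 2 * p) * P j y powr p)" for y
  have i1: "integrable lborel f1"
  proof (rule integrable_compact_support[OF D(1)])
    show "continuous_on D f1" unfolding f1_def
      by (intro continuous_intros uD continuous_on_subset[OF continuous_on_laplacian[OF Ck2_newton[OF dim eps]]]
          continuous_on_subset[OF Ck_imp_continuous[OF Ck2_H]]) auto
  qed (simp add: f1_def H0)
  have i2: "integrable lborel f2"
  proof (rule integrable_compact_support[OF D(1)])
    show "continuous_on D f2" unfolding f2_def
      by (intro continuous_intros continuous_on_abs_powr uD continuous_on_subset[OF continuous_on_laplacian[OF Ck2_\<Phi>]]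
          continuous_on_subset[OF Ck_imp_continuous[OF Ck2_\<Phi>]]) (use q in auto)
    fix y assume "y \<notin> D"
    then have "y \<notin> tsupp \<Phi>" using t\<Phi> by auto
    then show "f2 y = 0" by (simp add: f2_def laplacian_eq_0_outside_tsupp eq_0_outside_tsupp)
  qed
  have i3: "integrable lborel f3" unfolding f3_def using Pint by (intro integrable_mult_right Bochner_Integration.integrable_sum) auto
  have "(\<integral>y. f2 y \<partial>lborel) = 0" unfolding f2_def
  proof (rule weak_identity_C2[OF G uc _ weak Ck2_\<Phi> t\<Phi>(1)])
    show "continuous_on G (\<lambda>x. \<bar>u x\<bar> powr (q - 1) * u x)"
      using q by (intro continuous_intros continuous_on_abs_powr uc) auto
  qed (use t\<Phi> D in auto)
  have "c * \<kappa> * measure lborel (cball x0 \<epsilon>) = (\<integral>y. c * \<kappa> * indicator (cball x0 \<epsilon>) y \<partial>lborel)"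
    by simp
  also have "\<dots> \<le> (\<integral>y. f1 y \<partial>lborel)"
  proof (rule integral_mono[OF _ i1])
    show "integrable lborel (\<lambda>y. c * \<kappa> * indicator (cball x0 \<epsilon>) y :: real)"
      by (intro integrable_mult_right integrable_real_indicator) (use emeasure_lborel_cball_finite in auto)
    fix y
    show "c * \<kappa> * indicator (cball x0 \<epsilon>) y \<le> f1 y"
    proof (cases "y \<in> cball x0 \<epsilon>")
      case True
      then have "H y = 1" using ball0[OF True] by (simp add: H_def w_def S_def)
      moreover have "c * \<kappa> \<le> u y * (- laplacian (newton x0 \<epsilon>) y)"
        using newton_facts(3)[OF True] uball[OF True] c \<kappa>0
        by (intro mult_mono) (auto simp: \<kappa>_def)
      ultimately show ?thesis using True by (simp add: f1_def)
    next
      case False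
      \<comment> \<open>Outside the ball only the sign is used: u \<ge> 0, the kernel is
        superharmonic and the cut-off is nonnegative.\<close>
      have "f1 y \<ge> 0"
      proof (cases "y \<in> D")
        case True
        then have "u y \<ge> 0" using D u0 by auto
        then show ?thesis using laplacian_newton_nonpos[OF dim eps, of x0 y] w_range[of y]
          unfolding f1_def H_def by (intro mult_nonneg_nonneg) auto
      qed (simp add: f1_def H0)
      then show ?thesis using False by simp
    qed
  qed
  also have "\<dots> \<le> (\<integral>y. f2 y + f3 y \<partial>lborel)"
    using pointwise by (intro integral_mono i1 Bochner_Integration.integrable_add i2 i3) (auto simp: f1_def f2_def f3_def)
  also have "\<dots> = (\<integral>y. f3 y \<partial>lborel)" using i2 i3 \<open>(\<integral>y. f2 y \<partial>lborel) = 0\<close> by simp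
  also have "\<dots> = M * (\<Sum>j\<in>J. \<sigma> j powr (N - 2 + 2 * p) * (\<integral>y. P j y powr p \<partial>lborel))"
    unfolding f3_def using Pint by (simp add: Bochner_Integration.integral_sum)
  finally have "c * \<kappa> * measure lborel (cball x0 \<epsilon>)
    \<le> M * (\<Sum>j\<in>J. \<sigma> j powr (N - 2 + 2 * p) * (\<integral>y. P j y powr p \<partial>lborel))" .
  moreover have "measure lborel (cball x0 \<epsilon>) = unit_ball_vol N * \<epsilon> ^ DIM('a)"
    using content_cball[of \<epsilon> x0] eps N by simp
  then have "c * \<kappa> * measure lborel (cball x0 \<epsilon>)
      = N * (N - 2) * 2 powr (- (N + 2) / 2) * unit_ball_vol N * c * (\<epsilon> powr (- N) * \<epsilon> ^ DIM('a))"
    unfolding \<kappa>_def by (simp only: mult_ac)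
  moreover have "\<epsilon> powr (- N) * \<epsilon> ^ DIM('a) = 1"
    using eps by (simp add: N powr_minus powr_realpow)
  ultimately show ?thesis by simp
qed

end

section \<open>The capacitary estimate\<close>

text \<open>Membership means that m plus the base-2 logarithm of the distance lies between -2 and 1,
  and a closed interval of length 3 contains at most four integers.\<close>

lemma card_dyadic_annuli:
  "card {m \<in> M. y \<in> annulus x (2 powr real_of_int m)} \<le> 4"
proof -
  define r where "r = dist y x"
  define a where "a = \<lceil>- 2 - log 2 r\<rceil>"
  have sub: "{m. y \<in> annulus x (2 powr real_of_int m)} \<subseteq> {a..a+3}"
  proof
    fix m assume "m \<in> {m. y \<in> annulus x (2 powr real_of_int m)}"
    then have m: "1/4 \<le> 2 powr real_of_int m * r" "2 powr real_of_int m * r \<le> 2"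
      by (auto simp: annulus_def r_def)
    have r: "r > 0" using m(1) zero_le_dist[of y x] by (cases "r = 0") (auto simp: r_def)
    have e: "2 powr real_of_int m * r = 2 powr (real_of_int m + log 2 r)"
      using r by (simp add: powr_add)
    have "2 powr (- 2) \<le> 2 powr (real_of_int m + log 2 r)"
      using m(1) unfolding e by (simp add: powr_minus)
    then have "- 2 \<le> real_of_int m + log 2 r" by simp
    moreover have "2 powr (real_of_int m + log 2 r) \<le> 2 powr 1" using m(2) unfolding e by simp
    then have "real_of_int m + log 2 r \<le> 1" by (subst (asm) powr_le_cancel_iff) auto
    ultimately show "m \<in> {a..a+3}" unfolding a_def by simp linarith
  qed
  have "card {m \<in> M. y \<in> annulus x (2 powr real_of_int m)} \<le> card {a..a+3}"
    using sub by (intro card_mono) auto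
  then show "card {m \<in> M. y \<in> annulus x (2 powr real_of_int m)} \<le> 4" by simp
qed

lemma annulus_piece_dyadic:
  assumes "y \<in> annulus_piece F x m"
  shows "y \<in> F" "1/2 \<le> 2 powr real_of_int m * dist y x" "2 powr real_of_int m * dist y x \<le> 1"
proof -
  have h: "2 powr (- real_of_int (m + 1)) \<le> dist y x" "dist y x \<le> 2 powr (- real_of_int m)"
    using assms by (auto simp: annulus_piece_def)
  show "y \<in> F" using assms by (simp add: annulus_piece_def)
  have "2 powr real_of_int m * 2 powr (- real_of_int (m + 1)) \<le> 2 powr real_of_int m * dist y x"
    by (intro mult_left_mono h) simp
  moreover have "2 powr real_of_int m * 2 powr (- real_of_int (m + 1)) = 1/2"
    by (simp add: powr_minus flip: powr_add)
  ultimately show "1/2 \<le> 2 powr real_of_int m * dist y x" by linarith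
  have "2 powr real_of_int m * dist y x \<le> 2 powr real_of_int m * 2 powr (- real_of_int m)"
    by (intro mult_left_mono h) simp
  also have "\<dots> = 1" by (simp flip: powr_add)
  finally show "2 powr real_of_int m * dist y x \<le> 1" .
qed

lemma annulus_piece_covers:
  assumes "y \<in> F" "y \<noteq> x"
  obtains m where "y \<in> annulus_piece F x m"
proof -
  define m where "m = \<lfloor>- log 2 (dist y x)\<rfloor>"
  have r: "dist y x > 0" using assms by simp
  have "2 powr (- real_of_int (m + 1)) \<le> 2 powr log 2 (dist y x)"
    "2 powr log 2 (dist y x) \<le> 2 powr (- real_of_int m)"
    by (rule powr_mono; (simp add: m_def; linarith))+
  then have "y \<in> annulus_piece F x m" using r assms by (simp add: annulus_piece_def)
  then show ?thesis by (rule that)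
qed

text \<open>F keeps a positive distance from x, which bounds m above, and is bounded, which bounds m
  below.\<close>

lemma finite_annulus_pieces:
  fixes F :: "'a::euclidean_space set"
  assumes "compact F" "x \<notin> F"
  shows "finite {m. annulus_piece F x m \<noteq> {}}"
proof -
  obtain d where d: "d > 0" "\<And>y. y \<in> F \<Longrightarrow> d \<le> dist x y"
    using separate_point_closed[OF compact_imp_closed[OF assms(1)] assms(2)] by blast
  obtain R where R: "\<And>y. y \<in> F \<Longrightarrow> dist x y \<le> R"
    using compact_imp_bounded[OF assms(1)] bounded_any_center[of F x] by blast
  have "{m. annulus_piece F x m \<noteq> {}} \<subseteq> {- 1 - \<lceil>log 2 (max R 1)\<rceil>..\<lceil>- log 2 d\<rceil>}"
  proof
    fix m assume "m \<in> {m. annulus_piece F x m \<noteq> {}}"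
    then obtain y where y: "y \<in> F" "2 powr (- real_of_int (m + 1)) \<le> dist y x" "dist y x \<le> 2 powr (- real_of_int m)"
      by (auto simp: annulus_piece_def)
    have "2 powr log 2 d \<le> 2 powr (- real_of_int m)" using d(1) d(2)[OF y(1)] y(3) by (simp add: dist_commute)
    then have 1: "log 2 d \<le> - real_of_int m" by (subst (asm) powr_le_cancel_iff) auto
    have "2 powr (- real_of_int (m + 1)) \<le> 2 powr log 2 (max R 1)"
      using R[OF y(1)] y(2) by (simp add: dist_commute)
    then have "- real_of_int (m + 1) \<le> log 2 (max R 1)" by (subst (asm) powr_le_cancel_iff) auto
    then show "m \<in> {- 1 - \<lceil>log 2 (max R 1)\<rceil>..\<lceil>- log 2 d\<rceil>}" using 1 by simp linarith
  qed
  then show ?thesis by (rule finite_subset) simp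
qed

text \<open>Comparison with the zero solution gives U \<ge> 0 almost everywhere. The set U < 0 is
  open by continuity, and a nonempty open set is not null.\<close>

lemma maximal_solution_nonneg:
  fixes G :: "'a::euclidean_space set"
  assumes U: "is_maximal_solution q G U" and G: "open G" and x: "x \<in> G"
  shows "U x \<ge> 0"
proof (rule ccontr)
  assume neg: "\<not> U x \<ge> 0"
  have "is_solution q G (\<lambda>x. 0)" by (simp add: is_solution_def set_borel_measurable_def)
  then have ae: "AE x in lebesgue. x \<in> G \<longrightarrow> 0 \<le> U x" using U by (simp add: is_maximal_solution_def)
  define V where "V = {y \<in> G. U y < 0}"
  have "continuous_on G U" using U by (simp add: is_maximal_solution_def)
  then have V: "open V" unfolding V_def
    using continuous_open_preimage[OF _ G open_lessThan[of "0::real"], of U]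
    by (simp add: vimage_def Int_def)
  have "AE x in lebesgue. x \<notin> V" using ae by (rule AE_mp) (auto simp: V_def)
  then have "V \<in> null_sets lebesgue"
    using V by (subst AE_iff_null_sets) (auto intro: lborelD borel_open)
  then have "negligible V" by (simp add: negligible_iff_null_sets)
  moreover have "V \<noteq> {}" using neg x by (auto simp: V_def)
  ultimately show False using open_not_negligible[OF V] by blast
qed

section \<open>Integrals of the rescaled pieces\<close>

lemma jet_size_rescaled:
  fixes \<eta> :: "'a::euclidean_space \<Rightarrow> real"
  assumes \<eta>: "Ck 2 \<eta>" and supp: "compact (tsupp \<eta>)" and c: "c > 0" and B: "B \<ge> 0" and p: "p > 0"
  shows "integrable lborel (\<lambda>y. (indicator (annulus x c) y * (B * jet_size \<eta> (c *\<^sub>R y))) powr p)"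
    "(\<integral>y. (indicator (annulus x c) y * (B * jet_size \<eta> (c *\<^sub>R y))) powr p \<partial>lborel)
      \<le> B powr p * c powr (- real DIM('a)) * (\<integral>z. jet_size \<eta> z powr p \<partial>lborel)"
proof -
  have cj: "continuous_on UNIV (\<lambda>z. jet_size \<eta> z powr p)"
    using continuous_on_abs_powr[OF p continuous_on_jet_size[OF \<eta>]] jet_size_ge(4)[of \<eta>] by simp
  have cj': "continuous_on S (\<lambda>y. jet_size \<eta> (c *\<^sub>R y) powr p)" for S
    by (rule continuous_on_compose2[OF cj]) (auto intro!: continuous_intros)
  have eq: "(indicator (annulus x c) y * (B * jet_size \<eta> (c *\<^sub>R y))) powr p
      = indicator (annulus x c) y * (B powr p * jet_size \<eta> (c *\<^sub>R y) powr p)" for y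
    using B p jet_size_ge(4)[of \<eta>] by (simp add: indicator_def powr_mult)
  show 1: "integrable lborel (\<lambda>y. (indicator (annulus x c) y * (B * jet_size \<eta> (c *\<^sub>R y))) powr p)"
    using borel_integrable_compact[OF compact_annulus[OF c, of x] continuous_on_mult_left[OF cj', of "annulus x c" "B powr p"]]
    unfolding eq by simp
  have z: "jet_size \<eta> (c *\<^sub>R y) powr p = 0" if "y \<notin> (\<lambda>z. (1/c) *\<^sub>R z) ` tsupp \<eta>" for y
  proof -
    have "c *\<^sub>R y \<notin> tsupp \<eta>" using that c by (force simp: image_iff)
    then show ?thesis by (simp add: jet_size_eq_0)
  qed
  have 2: "integrable lborel (\<lambda>y. jet_size \<eta> (c *\<^sub>R y) powr p)"
    by (rule integrable_compact_support[OF compact_scaling[OF supp] cj' z])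
  have "(\<integral>y. (indicator (annulus x c) y * (B * jet_size \<eta> (c *\<^sub>R y))) powr p \<partial>lborel)
      \<le> (\<integral>y. B powr p * jet_size \<eta> (c *\<^sub>R y) powr p \<partial>lborel)"
    by (rule integral_mono[OF 1]) (use 2 eq in \<open>auto simp: indicator_def\<close>)
  also have "\<dots> = B powr p * ((\<integral>z. jet_size \<eta> z powr p \<partial>lborel) / c ^ DIM('a))"
    using lborel_integral_affine[of c "\<lambda>z. jet_size \<eta> z powr p" 0] c continuous_imp_borel[OF cj] by simp
  finally show "(\<integral>y. (indicator (annulus x c) y * (B * jet_size \<eta> (c *\<^sub>R y))) powr p \<partial>lborel)
      \<le> B powr p * c powr (- real DIM('a)) * (\<integral>z. jet_size \<eta> z powr p \<partial>lborel)"
    using c by (simp add: powr_minus powr_realpow field_simps)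
qed

lemma exterior_piece_integral:
  fixes x :: "'a::euclidean_space"
  assumes R: "R > 0" and B: "B \<ge> 0" and p: "p > 0"
  shows "integrable lborel (\<lambda>y. (indicator (annulus x (1/R)) y * B) powr p)"
    "(\<integral>y. (indicator (annulus x (1/R)) y * B) powr p \<partial>lborel)
      \<le> B powr p * unit_ball_vol (real DIM('a)) * 2 ^ DIM('a) * R powr real DIM('a)"
proof -
  have eq: "(indicator (annulus x (1/R)) y * B) powr p = B powr p * indicator (annulus x (1/R)) y" for y
    using p by (simp add: indicator_def)
  have cmp: "compact (annulus x (1/R))" using R by (intro compact_annulus) simp
  have fin: "emeasure lborel (annulus x (1/R)) < \<infinity>"
    by (rule emeasure_bounded_finite[OF compact_imp_bounded[OF cmp]])
  have sets: "annulus x (1/R) \<in> sets lborel" using compact_imp_closed[OF cmp] by auto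
  show 1: "integrable lborel (\<lambda>y. (indicator (annulus x (1/R)) y * B) powr p)"
    unfolding eq using fin sets by (intro integrable_mult_right integrable_real_indicator) auto
  have "(\<integral>y. (indicator (annulus x (1/R)) y * B) powr p \<partial>lborel)
      \<le> (\<integral>y. B powr p * indicator (cball x (2 * R)) y \<partial>lborel)"
  proof (rule integral_mono[OF 1])
    show "integrable lborel (\<lambda>y. B powr p * indicator (cball x (2 * R)) y)"
      by (intro integrable_mult_right integrable_real_indicator) (use emeasure_lborel_cball_finite in auto)
    show "(indicator (annulus x (1/R)) y * B) powr p \<le> B powr p * indicator (cball x (2 * R)) y" for y
      unfolding eq using R by (auto simp: indicator_def annulus_def dist_commute field_simps)
  qed
  also have "\<dots> = B powr p * (unit_ball_vol (real DIM('a)) * (2 * R) ^ DIM('a))"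
    using content_cball[of "2 * R" x] R by simp
  finally show "(\<integral>y. (indicator (annulus x (1/R)) y * B) powr p \<partial>lborel)
      \<le> B powr p * unit_ball_vol (real DIM('a)) * 2 ^ DIM('a) * R powr real DIM('a)"
    using R by (simp add: power_mult_distrib powr_realpow mult_ac)
qed

text \<open>The competitors \<open>\<eta>\<close> are left free, so that C is fixed before any
  capacity is approximated; passing to the infimum is left to the theorem.\<close>

lemma maximal_solution_estimate:
  fixes q :: real
  assumes dim: "DIM('a::euclidean_space) \<ge> 3" and q: "q > 1"
  obtains C where "C > 0"
    "\<And>(F :: 'a set) U x M \<eta>. compact F \<Longrightarrow> is_maximal_solution q (- F) U \<Longrightarrow> x \<notin> F \<Longrightarrow> finite M \<Longrightarrow>
      (\<And>y. y \<in> F \<Longrightarrow> \<exists>m\<in>M. y \<in> annulus_piece F x m) \<Longrightarrow>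
      (\<And>m. m \<in> M \<Longrightarrow> Ck 2 (\<eta> m) \<and> compact (tsupp (\<eta> m)) \<and> (\<forall>z. 0 \<le> \<eta> m z \<and> \<eta> m z \<le> 1)
        \<and> (\<forall>y\<in>annulus_piece F x m. \<eta> m (2 powr real_of_int m *\<^sub>R y) = 1)) \<Longrightarrow>
      U x \<le> C * (\<Sum>m\<in>M. 2 powr (2 * real_of_int m / (q - 1)) * (\<integral>z. jet_size (\<eta> m) z powr conj_exp q \<partial>lborel))"
proof -
  define N where "N = real DIM('a)"
  define p where "p = conj_exp q"
  have N3: "N \<ge> 3" using dim by (simp add: N_def)
  have p: "p > 1" using q by (simp add: p_def conj_exp_def)
  have pq: "2 * p - 2 = 2 / (q - 1)" using q by (simp add: p_def conj_exp_def field_simps)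
  obtain B1 where B1: "B1 \<ge> 1" "\<And>(\<eta> :: 'a \<Rightarrow> real) c x y. Ck 2 \<eta> \<Longrightarrow> (\<And>z. 0 \<le> \<eta> z \<and> \<eta> z \<le> 1) \<Longrightarrow> c > 0 \<Longrightarrow>
    jet_bound (\<lambda>y. annulus_cut (c *\<^sub>R y + - (c *\<^sub>R x)) * \<eta> (c *\<^sub>R y)) c
      (indicator (annulus x c) y * (B1 * jet_size \<eta> (c *\<^sub>R y))) y"
    using annulus_piece_jet[where 'a='a] by blast
  obtain B2 where B2: "B2 \<ge> 1" "\<And>c (x::'a) y. c > 0 \<Longrightarrow> c * dist y x \<le> 2 \<Longrightarrow>
    jet_bound (\<lambda>y. exterior_cut (c *\<^sub>R y + - (c *\<^sub>R x))) c (indicator (annulus x c) y * B2) y"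
    using exterior_piece_jet[where 'a='a] by blast
  define \<kappa> where "\<kappa> = N * (N - 2) * 2 powr (- (N + 2) / 2) * unit_ball_vol N"
  have \<kappa>: "\<kappa> > 0" unfolding \<kappa>_def using N3 by (intro mult_pos_pos unit_ball_vol_pos) auto
  \<comment> \<open>At most four dyadic annuli and the exterior one meet at a point, hence
    5.\<close>
  define MM where "MM = estimate_const q N 5"
  have MM0: "MM \<ge> 0" unfolding MM_def estimate_const_def by simp
  \<comment> \<open>The summand 1 makes C positive even if \<open>MM\<close> is 0.\<close>
  define C where "C = MM * B1 powr p / \<kappa> + 1"
  show ?thesis
  proof (rule that[of C])
    show "C > 0" unfolding C_def using MM0 \<kappa> by (intro add_nonneg_pos divide_nonneg_pos mult_nonneg_nonneg) auto
    fix F :: "'a set" and U x M \<eta>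
    assume F: "compact F" and U: "is_maximal_solution q (- F) U" and x: "x \<notin> F" and M: "finite M"
      and cover: "\<And>y. y \<in> F \<Longrightarrow> \<exists>m\<in>M. y \<in> annulus_piece F x m"
      and \<eta>': "\<And>m. m \<in> M \<Longrightarrow> Ck 2 (\<eta> m) \<and> compact (tsupp (\<eta> m)) \<and> (\<forall>z. 0 \<le> \<eta> m z \<and> \<eta> m z \<le> 1)
        \<and> (\<forall>y\<in>annulus_piece F x m. \<eta> m (2 powr real_of_int m *\<^sub>R y) = 1)"
    have \<eta>: "Ck 2 (\<eta> m)" "compact (tsupp (\<eta> m))" "\<And>z. 0 \<le> \<eta> m z \<and> \<eta> m z \<le> 1"
      "\<And>y. y \<in> annulus_piece F x m \<Longrightarrow> \<eta> m (2 powr real_of_int m *\<^sub>R y) = 1" if "m \<in> M" for m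
      using \<eta>'[OF that] by auto
    define G where "G = - F"
    have G: "open G" "x \<in> G" using compact_imp_closed[OF F] x by (auto simp: G_def)
    have sol: "is_solution q G U" and Uc: "continuous_on G U"
      using U by (auto simp: is_maximal_solution_def G_def)
    have U0: "U y \<ge> 0" if "y \<in> G" for y
      using maximal_solution_nonneg[OF U] G(1) that by (simp add: G_def)
    define X where "X = (\<Sum>m\<in>M. 2 powr (2 * real_of_int m / (q - 1)) * (\<integral>z. jet_size (\<eta> m) z powr p \<partial>lborel))"
    have X0: "X \<ge> 0" unfolding X_def by (intro sum_nonneg mult_nonneg_nonneg Bochner_Integration.integral_nonneg) auto
    define E where "E = B2 powr p * unit_ball_vol N * 2 ^ DIM('a)"
    define s where "s m = 2 powr real_of_int m" for m
    have s: "s m > 0" for m by (simp add: s_def)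
    obtain \<epsilon>1 where \<epsilon>1: "\<epsilon>1 > 0" "cball x \<epsilon>1 \<subseteq> G" using open_contains_cball[of G] G by blast
    \<comment> \<open>Within distance \<epsilon>2 of x every rescaled annulus cut-off vanishes, its
      argument having norm at most 1/4.\<close>
    define \<epsilon>2 where "\<epsilon>2 = 1 / (4 * (1 + (\<Sum>m\<in>M. s m)))"
    have ss: "(\<Sum>m\<in>M. s m) \<ge> 0" using s by (intro sum_nonneg less_imp_le)
    have \<epsilon>2: "\<epsilon>2 > 0" using ss by (simp add: \<epsilon>2_def)
    have \<epsilon>2s: "s m * \<epsilon>2 \<le> 1/4" if "m \<in> M" for m
    proof -
      have "s m \<le> (\<Sum>m\<in>M. s m)" using that M s by (intro member_le_sum) (auto intro: less_imp_le)
      then show ?thesis using ss by (simp add: \<epsilon>2_def field_simps)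
    qed
    \<comment> \<open>Continuity makes U x - \<delta> a lower bound for U near x; truncating at 0
      meets the sign condition on the parameter c of the locale.\<close>
    have main: "\<kappa> * max 0 (U x - \<delta>) \<le> MM * (B1 powr p * X + E * R powr (2 - 2 * p))"
      if \<delta>: "\<delta> > 0" and R: "R \<ge> 1" for \<delta> R
    proof -
      obtain \<epsilon>3 where \<epsilon>3: "\<epsilon>3 > 0" "\<And>y. y \<in> G \<Longrightarrow> dist y x < \<epsilon>3 \<Longrightarrow> dist (U y) (U x) < \<delta>"
        using Uc G(2) \<delta> unfolding continuous_on_iff by blast
      \<comment> \<open>In turn: the ball stays in G, the dyadic cut-offs vanish on it, U exceeds U
        x - \<delta> on it, and the exterior cut-off vanishes because \<epsilon> \<le> 1 \<le>
        R.\<close>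
      define \<epsilon> where "\<epsilon> = min (min \<epsilon>1 \<epsilon>2) (min (\<epsilon>3 / 2) 1)"
      have \<epsilon>: "\<epsilon> > 0" "\<epsilon> \<le> \<epsilon>1" "\<epsilon> \<le> \<epsilon>2" "\<epsilon> < \<epsilon>3" "\<epsilon> \<le> 1"
        using \<epsilon>1(1) \<epsilon>2 \<epsilon>3(1) by (auto simp: \<epsilon>_def)
      \<comment> \<open>\<open>None\<close> stands for the exterior cut-off at scale R,
        \<open>Some m\<close> for the dyadic piece of index m.\<close>
      define J where "J = insert None (Some ` M)"
      define \<sigma> where "\<sigma> j = (case j of None \<Rightarrow> 1 / R | Some m \<Rightarrow> s m)" for j
      define \<zeta> where "\<zeta> j y = (case j of None \<Rightarrow> exterior_cut ((1 / R) *\<^sub>R y + - ((1 / R) *\<^sub>R x))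
        | Some m \<Rightarrow> annulus_cut (s m *\<^sub>R y + - (s m *\<^sub>R x)) * \<eta> m (s m *\<^sub>R y))" for j y
      define P where "P j y = (case j of None \<Rightarrow> indicator (annulus x (1 / R)) y * B2
        | Some m \<Rightarrow> indicator (annulus x (s m)) y * (B1 * jet_size (\<eta> m) (s m *\<^sub>R y)))" for j y
      have nrm: "norm (c *\<^sub>R y + - (c *\<^sub>R x)) = c * dist y x" if "c > 0" for c y
        using that by (simp add: dist_norm flip: scaleR_diff_right)
      have \<zeta>0: "\<zeta> j y \<ge> 0" if "j \<in> J" for j y
        using that \<eta>(3) by (auto simp: J_def \<zeta>_def exterior_cut_nonneg annulus_cut_nonneg)
      have \<zeta>2: "Ck 2 (\<zeta> j)" if "j \<in> J" for j
      proof (cases j)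
        case None
        then show ?thesis unfolding \<zeta>_def[abs_def] by (simp only: option.case) (rule Ck_affine[OF Ck2_exterior_cut])
      next
        case (Some m)
        then have m: "m \<in> M" using that by (auto simp: J_def)
        show ?thesis unfolding \<zeta>_def[abs_def] Some option.case
          using Ck_mult[OF Ck_affine[OF Ck2_annulus_cut, of "s m" "- (s m *\<^sub>R x)"] Ck_affine[OF \<eta>(1)[OF m], of "s m" 0]] by simp
      qed
      have fJ: "finite J" using M by (simp add: J_def)
      have le_S: "\<zeta> j y \<le> (\<Sum>j\<in>J. \<zeta> j y)" if "j \<in> J" for j y
        using that fJ \<zeta>0 by (intro member_le_sum) auto
      have far: "1 \<le> (\<Sum>j\<in>J. \<zeta> j y)" if "(1 / R) * dist y x \<ge> 2" for y
      proof -
        have "1 \<le> \<zeta> None y" unfolding \<zeta>_def option.case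
          by (rule exterior_cut_ge_1) (subst nrm; use R that in simp)
        also have "\<dots> \<le> (\<Sum>j\<in>J. \<zeta> j y)" by (rule le_S) (simp add: J_def)
        finally show ?thesis .
      qed
      \<comment> \<open>This keeps the support of the test function away from F: on its own piece
        the competitor equals 1 and the annulus cut-off is at least 1.\<close>
      have onF: "1 \<le> (\<Sum>j\<in>J. \<zeta> j y)" if yF: "y \<in> F" for y
      proof -
        obtain m where m: "m \<in> M" "y \<in> annulus_piece F x m" using cover[OF yF] by blast
        have "1 \<le> annulus_cut (s m *\<^sub>R y + - (s m *\<^sub>R x))"
          by (rule annulus_cut_ge_1; subst nrm; use s annulus_piece_dyadic[OF m(2)] in \<open>simp add: s_def\<close>)
        then have "1 \<le> \<zeta> (Some m) y" using \<eta>(4)[OF m] by (simp add: \<zeta>_def s_def)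
        also have "\<dots> \<le> (\<Sum>j\<in>J. \<zeta> j y)" by (rule le_S) (use m in \<open>simp add: J_def\<close>)
        finally show ?thesis .
      qed
      interpret test: capacity_test q N 5 x \<epsilon> "max 0 (U x - \<delta>)" G U J \<sigma> \<zeta> P
      proof
        show "3 \<le> DIM('a)" "N = real DIM('a)" "1 < q" "finite J" "open G" "continuous_on G U"
          "0 < \<epsilon>" "0 \<le> max 0 (U x - \<delta>)"
          using dim q fJ G Uc \<epsilon> by (auto simp: N_def)
        show "0 < \<sigma> j" if "j \<in> J" for j using s R by (cases j) (auto simp: \<sigma>_def)
        show "Ck 2 (\<zeta> j)" if "j \<in> J" for j by (rule \<zeta>2[OF that])
        show "0 \<le> \<zeta> j y" if "j \<in> J" for j y by (rule \<zeta>0[OF that])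
        show "0 \<le> P j y" if "j \<in> J" for j y
          using B1(1) B2(1) jet_size_ge(4) by (cases j) (auto simp: P_def intro!: mult_nonneg_nonneg)
        show "jet_bound (\<zeta> j) (\<sigma> j) (P j y) y" if j: "j \<in> J" and S: "(\<Sum>j\<in>J. \<zeta> j y) < 1 / 2" for j y
        proof (cases j)
          case None
          have "(1 / R) * dist y x \<le> 2" using far[of y] S by linarith
          then show ?thesis unfolding None \<zeta>_def[abs_def] P_def \<sigma>_def option.case using R by (intro B2(2)) auto
        next
          case (Some m)
          then have "m \<in> M" using j by (auto simp: J_def)
          then show ?thesis unfolding Some \<zeta>_def[abs_def] P_def \<sigma>_def option.case by (intro B1(2) \<eta> s)
        qed
        show "y \<in> annulus x (\<sigma> j)" if "j \<in> J" "P j y \<noteq> 0" for j y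
          using that by (cases j) (auto simp: P_def \<sigma>_def indicator_def split: if_splits)
        show "card {j \<in> J. y \<in> annulus x (\<sigma> j)} \<le> 5" for y
        proof -
          have "{j \<in> J. y \<in> annulus x (\<sigma> j)} \<subseteq> insert None (Some ` {m\<in>M. y \<in> annulus x (2 powr real_of_int m)})"
            by (auto simp: J_def \<sigma>_def s_def)
          then have "card {j \<in> J. y \<in> annulus x (\<sigma> j)} \<le> card (insert None (Some ` {m\<in>M. y \<in> annulus x (2 powr real_of_int m)}))"
            using M by (intro card_mono) auto
          also have "\<dots> \<le> Suc (card {m\<in>M. y \<in> annulus x (2 powr real_of_int m)})"
            using M by (simp add: card_image)
          finally show ?thesis using card_dyadic_annuli[of M y x] by linarith
        qed
        show "integrable lborel (\<lambda>y. P j y powr conj_exp q)" if j: "j \<in> J" for j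
        proof (cases j)
          case None
          then show ?thesis unfolding P_def option.case p_def[symmetric]
            using exterior_piece_integral(1)[of R B2 p x] R B2 p by simp
        next
          case (Some m)
          then have m: "m \<in> M" using j by (auto simp: J_def)
          show ?thesis unfolding Some P_def option.case p_def[symmetric]
            by (rule jet_size_rescaled(1)[OF \<eta>(1,2)[OF m] s]) (use B1 p in auto)
        qed
        show "0 \<le> U y" if "y \<in> G" for y by (rule U0[OF that])
        show "(\<integral>x. - U x * laplacian \<phi> x + \<bar>U x\<bar> powr (q - 1) * U x * \<phi> x \<partial>lebesgue) = 0"
          if "smooth \<phi>" "compact (tsupp \<phi>)" "tsupp \<phi> \<subseteq> G" for \<phi>
          using sol that by (simp add: is_solution_def)
        show "{y. (\<Sum>j\<in>J. \<zeta> j y) \<le> 1 / 2} \<subseteq> G" using onF by (force simp: G_def)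
        have "continuous_on UNIV (\<lambda>y. \<Sum>j\<in>J. \<zeta> j y)" by (intro continuous_on_sum Ck_imp_continuous[OF \<zeta>2])
        then have "closed {y. (\<Sum>j\<in>J. \<zeta> j y) \<le> 1 / 2}" by (intro closed_Collect_le continuous_on_const)
        moreover have "{y. (\<Sum>j\<in>J. \<zeta> j y) \<le> 1 / 2} \<subseteq> cball x (2 * R)"
        proof
          fix y assume "y \<in> {y. (\<Sum>j\<in>J. \<zeta> j y) \<le> 1 / 2}"
          then have "(1 / R) * dist y x < 2" using far[of y] by force
          then show "y \<in> cball x (2 * R)" using R by (simp add: dist_commute field_simps)
        qed
        ultimately show "compact {y. (\<Sum>j\<in>J. \<zeta> j y) \<le> 1 / 2}"
          using bounded_subset[OF bounded_cball] by (simp add: compact_eq_bounded_closed)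
        show "(\<Sum>j\<in>J. \<zeta> j y) = 0" if "y \<in> cball x \<epsilon>" for y
        proof (rule sum.neutral, rule ballI)
          fix j assume j: "j \<in> J"
          have y: "dist y x \<le> \<epsilon>" using that by (simp add: dist_commute)
          show "\<zeta> j y = 0"
          proof (cases j)
            case None
            have "(1 / R) * dist y x \<le> 1" using y \<epsilon>(5) R by (simp add: field_simps)
            then show ?thesis unfolding None \<zeta>_def option.case using R by (intro exterior_cut_eq_0) (subst nrm; simp)
          next
            case (Some m)
            then have m: "m \<in> M" using j by (auto simp: J_def)
            have "s m * dist y x \<le> s m * \<epsilon>2" using y \<epsilon>(3) s[of m] by (intro mult_left_mono) auto
            then have "s m * dist y x \<le> 1/4" using \<epsilon>2s[OF m] by linarith
            then have "annulus_cut (s m *\<^sub>R y + - (s m *\<^sub>R x)) = 0"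
              using s by (intro annulus_cut_eq_0) (subst nrm; simp)
            then show ?thesis by (simp add: Some \<zeta>_def)
          qed
        qed
        show "max 0 (U x - \<delta>) \<le> U y" if "y \<in> cball x \<epsilon>" for y
        proof -
          have y: "dist y x \<le> \<epsilon>" using that by (simp add: dist_commute)
          have yG: "y \<in> G" using that \<epsilon>(2) \<epsilon>1(2) by auto
          have "dist (U y) (U x) < \<delta>" by (rule \<epsilon>3(2)[OF yG]) (use y \<epsilon> in linarith)
          then show ?thesis using U0[OF yG] by (simp add: dist_real_def)
        qed
      qed
      have "\<kappa> * max 0 (U x - \<delta>) \<le> MM * (\<Sum>j\<in>J. \<sigma> j powr (N - 2 + 2 * p) * (\<integral>y. P j y powr p \<partial>lborel))"
        using test.estimate by (simp only: \<kappa>_def MM_def p_def)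
      also have "\<dots> \<le> MM * (B1 powr p * X + E * R powr (2 - 2 * p))"
      proof (rule mult_left_mono[OF _ MM0])
        \<comment> \<open>N-2+2p powers of 1/R against a volume of order R^N leave R^(2-2p), which
          tends to 0 since p > 1.\<close>
        have n: "\<sigma> None powr (N - 2 + 2 * p) * (\<integral>y. P None y powr p \<partial>lborel) \<le> E * R powr (2 - 2 * p)"
        proof -
          have eq: "\<sigma> None powr (N - 2 + 2 * p) = R powr (- (N - 2 + 2 * p))"
            unfolding \<sigma>_def option.case powr_minus using R by (simp add: powr_divide inverse_eq_divide)
          have "\<sigma> None powr (N - 2 + 2 * p) * (\<integral>y. P None y powr p \<partial>lborel)
            \<le> R powr (- (N - 2 + 2 * p)) * (E * R powr N)"
            unfolding eq unfolding P_def option.case E_def N_def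
            by (intro mult_left_mono exterior_piece_integral(2)) (use R B2 p in auto)
          also have "R powr (- (N - 2 + 2 * p)) * (E * R powr N) = E * R powr (2 - 2 * p)"
            by (simp add: mult.left_commute flip: powr_add)
          finally show ?thesis .
        qed
        have m: "\<sigma> (Some m) powr (N - 2 + 2 * p) * (\<integral>y. P (Some m) y powr p \<partial>lborel)
          \<le> B1 powr p * (2 powr (2 * real_of_int m / (q - 1)) * (\<integral>z. jet_size (\<eta> m) z powr p \<partial>lborel))"
          if m: "m \<in> M" for m
        proof -
          let ?I = "\<integral>z. jet_size (\<eta> m) z powr p \<partial>lborel"
          have "\<sigma> (Some m) powr (N - 2 + 2 * p) * (\<integral>y. P (Some m) y powr p \<partial>lborel)
            \<le> s m powr (N - 2 + 2 * p) * (B1 powr p * s m powr (- N) * ?I)"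
            unfolding P_def \<sigma>_def option.case N_def
            by (intro mult_left_mono jet_size_rescaled(2) \<eta> m s) (use B1 p in auto)
          also have "\<dots> = B1 powr p * ((s m powr (N - 2 + 2 * p) * s m powr (- N)) * ?I)" by simp
          \<comment> \<open>The change of variables removes N powers, and the remaining exponent 2p
            - 2 = 2/(q-1) is the weight in \<open>Wpot\<close>.\<close>
          also have "s m powr (N - 2 + 2 * p) * s m powr (- N) = s m powr (2 * p - 2)"
            by (simp flip: powr_add)
          also have "\<dots> = 2 powr (2 * real_of_int m / (q - 1))"
            unfolding pq s_def by (simp add: powr_powr mult.commute)
          finally show ?thesis .
        qed
        have "(\<Sum>j\<in>J. \<sigma> j powr (N - 2 + 2 * p) * (\<integral>y. P j y powr p \<partial>lborel))
          = \<sigma> None powr (N - 2 + 2 * p) * (\<integral>y. P None y powr p \<partial>lborel)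
            + (\<Sum>m\<in>M. \<sigma> (Some m) powr (N - 2 + 2 * p) * (\<integral>y. P (Some m) y powr p \<partial>lborel))"
          unfolding J_def using M by (simp add: sum.reindex)
        also have "\<dots> \<le> E * R powr (2 - 2 * p) + B1 powr p * X"
          unfolding X_def sum_distrib_left by (intro add_mono n sum_mono m)
        finally show "(\<Sum>j\<in>J. \<sigma> j powr (N - 2 + 2 * p) * (\<integral>y. P j y powr p \<partial>lborel))
          \<le> B1 powr p * X + E * R powr (2 - 2 * p)" by simp
      qed
      finally show ?thesis .
    qed
    \<comment> \<open>The radius \<epsilon> chosen in \<open>main\<close> depends on \<delta>, but
      the bound does not contain it, so R can tend to infinity with \<delta> fixed.\<close>
    have lim: "\<kappa> * max 0 (U x - \<delta>) \<le> MM * (B1 powr p * X)" if "\<delta> > 0" for \<delta>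
    proof (rule tendsto_lowerbound)
      have "((\<lambda>R. R powr (2 - 2 * p)) \<longlongrightarrow> 0) at_top"
        using p by (intro tendsto_neg_powr filterlim_ident) auto
      then have "((\<lambda>R. MM * (B1 powr p * X + E * R powr (2 - 2 * p))) \<longlongrightarrow> MM * (B1 powr p * X + E * 0)) at_top"
        by (intro tendsto_intros)
      then show "((\<lambda>R. MM * (B1 powr p * X + E * R powr (2 - 2 * p))) \<longlongrightarrow> MM * (B1 powr p * X)) at_top" by simp
      show "\<forall>\<^sub>F R in at_top. \<kappa> * max 0 (U x - \<delta>) \<le> MM * (B1 powr p * X + E * R powr (2 - 2 * p))"
        using eventually_ge_at_top[of 1] by (rule eventually_mono) (rule main[OF that])
    qed simp
    have "U x \<le> MM * B1 powr p / \<kappa> * X"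
    proof (rule field_le_epsilon)
      fix \<delta> :: real assume \<delta>: "\<delta> > 0"
      have "\<kappa> * (U x - \<delta>) \<le> \<kappa> * max 0 (U x - \<delta>)" using \<kappa> by (intro mult_left_mono) auto
      with lim[OF \<delta>] have "\<kappa> * (U x - \<delta>) \<le> MM * (B1 powr p * X)" by linarith
      then show "U x \<le> MM * B1 powr p / \<kappa> * X + \<delta>" using \<kappa> by (simp add: field_simps)
    qed
    also have "\<dots> \<le> C * X" unfolding C_def using X0 by (intro mult_right_mono) auto
    finally show "U x \<le> C * (\<Sum>m\<in>M. 2 powr (2 * real_of_int m / (q - 1)) * (\<integral>z. jet_size (\<eta> m) z powr conj_exp q \<partial>lborel))"
      by (simp add: X_def p_def)
  qed
qed

theorem theorem2p1:
  fixes q :: real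
  assumes "DIM('a::euclidean_space) \<ge> 3"
    and "q \<ge> real DIM('a) / (real DIM('a) - 2)"
  shows "\<exists>C::real. C > 0 \<and>
    (\<forall>F::'a set. compact F \<and> F \<noteq> {} \<longrightarrow>
      (\<forall>U. is_maximal_solution q (- F) U \<longrightarrow>
        (\<forall>x\<in>- F. ennreal (U x) \<le> ennreal C * Wpot q F x)))"
proof -
  \<comment> \<open>The critical exponent N/(N-2) exceeds 1, so q > 1 and the conjugate exponent is
    meaningful.\<close>
  have "1 < real DIM('a) / (real DIM('a) - 2)" using assms(1) by (simp add: field_simps)
  then have q: "q > 1" using assms(2) by linarith
  define p where "p = conj_exp q"
  have p: "p > 1" using q by (simp add: p_def conj_exp_def)
  obtain C1 where C1: "C1 > 0" and est: "\<And>(F :: 'a set) U x M \<eta>. compact F \<Longrightarrow> is_maximal_solution q (- F) U \<Longrightarrow> x \<notin> F \<Longrightarrow> finite M \<Longrightarrow>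
      (\<And>y. y \<in> F \<Longrightarrow> \<exists>m\<in>M. y \<in> annulus_piece F x m) \<Longrightarrow>
      (\<And>m. m \<in> M \<Longrightarrow> Ck 2 (\<eta> m) \<and> compact (tsupp (\<eta> m)) \<and> (\<forall>z. 0 \<le> \<eta> m z \<and> \<eta> m z \<le> 1)
        \<and> (\<forall>y\<in>annulus_piece F x m. \<eta> m (2 powr real_of_int m *\<^sub>R y) = 1)) \<Longrightarrow>
      U x \<le> C1 * (\<Sum>m\<in>M. 2 powr (2 * real_of_int m / (q - 1)) * (\<integral>z. jet_size (\<eta> m) z powr conj_exp q \<partial>lborel))"
    using maximal_solution_estimate[OF assms(1) q] by blast
  obtain C0 where C0: "C0 > 0" and cap: "\<And>\<eta> :: 'a \<Rightarrow> real. Ck 2 \<eta> \<Longrightarrow> compact (tsupp \<eta>) \<Longrightarrow>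
    (\<And>x. 0 \<le> \<eta> x \<and> \<eta> x \<le> 1) \<Longrightarrow> ennreal (\<integral>z. jet_size \<eta> z powr p \<partial>lborel) \<le> ennreal C0 * sob2_pow p \<eta>"
    using jet_size_capacity[OF p, where 'a='a] by blast
  define C where "C = C1 * C0"
  have C: "C > 0" using C0 C1 by (simp add: C_def)
  have "ennreal (U x) \<le> ennreal C * Wpot q F x"
    if F: "compact F" and U: "is_maximal_solution q (- F) U" and x: "x \<notin> F" for F :: "'a set" and U x
  proof -
    define M where "M = {m. annulus_piece F x m \<noteq> {}}"
    have M: "finite M" unfolding M_def by (rule finite_annulus_pieces[OF F x])
    have cover: "\<exists>m\<in>M. y \<in> annulus_piece F x m" if "y \<in> F" for y
      using annulus_piece_covers[OF that, of x] x that by (metis (mono_tags, lifting) M_def empty_iff mem_Collect_eq)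
    define t where "t m = 2 powr (2 * real_of_int m / (q - 1))" for m :: int
    have t: "t m > 0" for m by (simp add: t_def)
    define K where "K m = (\<lambda>y. (2 powr real_of_int m) *\<^sub>R y) ` annulus_piece F x m" for m
    define Y where "Y = ennreal C * (\<Sum>m\<in>M. ennreal (t m) * cap2 p (K m))"
    have "ennreal (U x) \<le> Y"
    \<comment> \<open>Only the case Y < top remains; then every capacity in the sum is finite, so
      competitors within a positive d of the infimum exist.\<close>
    proof (rule ennreal_le_epsilon)
      fix e :: real assume fin: "Y < top" and e: "e > 0"
      define ts where "ts = (\<Sum>m\<in>M. t m)"
      have ts: "ts \<ge> 0" unfolding ts_def using t by (intro sum_nonneg less_imp_le)
      \<comment> \<open>An excess d in each capacity adds C * ts * d in total, which this choice
        keeps at most e; the 1 covers ts = 0.\<close>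
      define d where "d = e / (C * (1 + ts))"
      have d: "d > 0" using e C ts by (simp add: d_def)
      have "\<exists>\<eta>. Ck 2 \<eta> \<and> compact (tsupp \<eta>) \<and> (\<forall>z. 0 \<le> \<eta> z \<and> \<eta> z \<le> 1)
          \<and> (\<forall>y\<in>annulus_piece F x m. \<eta> (2 powr real_of_int m *\<^sub>R y) = 1)
          \<and> sob2_pow p \<eta> \<le> cap2 p (K m) + ennreal d" if m: "m \<in> M" for m
      proof -
        have "(\<Sum>m\<in>M. ennreal (t m) * cap2 p (K m)) \<noteq> top"
        proof
          assume "(\<Sum>m\<in>M. ennreal (t m) * cap2 p (K m)) = top"
          then have "Y = top" using C by (simp add: Y_def ennreal_mult_top)
          with fin show False by simp
        qed
        then have "ennreal (t m) * cap2 p (K m) \<noteq> top"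
          by (rule neq_top_trans) (use m M in \<open>auto intro: member_le_sum\<close>)
        then have "cap2 p (K m) \<noteq> top" using t[of m] by (auto simp: ennreal_mult_eq_top_iff)
        then have "cap2 p (K m) < cap2 p (K m) + ennreal d"
          using d by (cases "cap2 p (K m)") (auto simp: ennreal_plus[symmetric] ennreal_less_iff simp del: ennreal_plus)
        then obtain \<eta> where "Ck 2 \<eta>" "compact (tsupp \<eta>)" "\<forall>z. 0 \<le> \<eta> z \<and> \<eta> z \<le> 1"
          "\<exists>V. open V \<and> K m \<subseteq> V \<and> (\<forall>z\<in>V. \<eta> z = 1)" "sob2_pow p \<eta> < cap2 p (K m) + ennreal d"
          unfolding cap2_def INF_less_iff by auto
        moreover from this(4) have "\<forall>y\<in>annulus_piece F x m. \<eta> (2 powr real_of_int m *\<^sub>R y) = 1"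
          by (auto simp: K_def)
        ultimately show ?thesis by (auto intro: less_imp_le)
      qed
      then obtain \<eta> where \<eta>: "\<And>m. m \<in> M \<Longrightarrow> Ck 2 (\<eta> m) \<and> compact (tsupp (\<eta> m)) \<and> (\<forall>z. 0 \<le> \<eta> m z \<and> \<eta> m z \<le> 1)
          \<and> (\<forall>y\<in>annulus_piece F x m. \<eta> m (2 powr real_of_int m *\<^sub>R y) = 1)
          \<and> sob2_pow p (\<eta> m) \<le> cap2 p (K m) + ennreal d"
        by metis
      define I where "I m = (\<integral>z. jet_size (\<eta> m) z powr p \<partial>lborel)" for m
      have I0: "I m \<ge> 0" for m unfolding I_def by (intro Bochner_Integration.integral_nonneg) simp
      have "U x \<le> C1 * (\<Sum>m\<in>M. t m * I m)"
        unfolding t_def I_def p_def by (rule est[OF F U x M cover]) (use \<eta> in auto)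
      then have "ennreal (U x) \<le> ennreal (C1 * (\<Sum>m\<in>M. t m * I m))" by (rule ennreal_leI)
      also have "\<dots> = ennreal C1 * (\<Sum>m\<in>M. ennreal (t m) * ennreal (I m))"
        using C1 t I0 by (simp add: ennreal_mult sum_nonneg less_imp_le flip: sum_ennreal)
      also have "\<dots> \<le> ennreal C1 * (\<Sum>m\<in>M. ennreal (t m) * (ennreal C0 * (cap2 p (K m) + ennreal d)))"
      proof (intro mult_left_mono sum_mono)
        fix m assume m: "m \<in> M"
        have "ennreal (I m) \<le> ennreal C0 * sob2_pow p (\<eta> m)" unfolding I_def using \<eta>[OF m] by (intro cap) auto
        also have "\<dots> \<le> ennreal C0 * (cap2 p (K m) + ennreal d)" using \<eta>[OF m] by (intro mult_left_mono) auto
        finally show "ennreal (I m) \<le> ennreal C0 * (cap2 p (K m) + ennreal d)" .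
      qed auto
      also have "\<dots> = Y + ennreal C * (\<Sum>m\<in>M. ennreal (t m) * ennreal d)"
        using C0 C1 by (simp add: Y_def C_def ennreal_mult distrib_left sum.distrib sum_distrib_left mult_ac)
      also have "ennreal C * (\<Sum>m\<in>M. ennreal (t m) * ennreal d) = ennreal (C * (ts * d))"
        using C d t ts by (simp add: ts_def ennreal_mult sum_distrib_right sum_nonneg less_imp_le flip: sum_ennreal)
      also have "\<dots> \<le> ennreal e"
      proof (rule ennreal_leI)
        have "C * (ts * d) = e * (ts / (1 + ts))" using C by (simp add: d_def)
        also have "\<dots> \<le> e * 1" using e ts by (intro mult_left_mono) auto
        finally show "C * (ts * d) \<le> e" by simp
      qed
      finally show "ennreal (U x) \<le> Y + ennreal e" by (simp add: add_left_mono)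
    qed
    also have "Y \<le> ennreal C * Wpot q F x"
      unfolding Y_def
    proof (rule mult_left_mono)
      \<comment> \<open>Y sums over the nonempty pieces only; the other terms of \<open>Wpot\<close>
        are nonnegative.\<close>
      have "(\<Sum>m\<in>M. ennreal (t m) * cap2 p (K m))
          = (\<integral>\<^sup>+ m. ennreal (t m) * cap2 p (K m) * indicator M m \<partial>count_space UNIV)"
        using M by (subst nn_integral_count_space'[of M]) (auto intro!: sum.cong)
      also have "\<dots> \<le> Wpot q F x"
        unfolding Wpot_def t_def K_def p_def by (intro nn_integral_mono) (auto simp: indicator_def)
      finally show "(\<Sum>m\<in>M. ennreal (t m) * cap2 p (K m)) \<le> Wpot q F x" .
    qed simp
    finally show ?thesis .
  qed
  with C show ?thesis by blast
qed

end
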